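(* Let $(v,\theta)$ be a weak solution on $[0,T]$ of the three-dimensional inviscid Boussinesq system with initial data $(v_{\mathrm{in}},\theta_{\mathrm{in}})$. Let $1\le p\le\infty$ and $\frac1p+\frac1{p'}=1$. Suppose $v\in L^\infty([0,T];B^{1/3}_{\infty,c(\mathbb{N})}(\mathbb{T}^3))$ and - if $1\le p<2$: $\theta\in C([0,T];L^p(\mathbb{T}^3))\cap L^2([0,T];B^{1/3}_{p',c(\mathbb{N})}(\mathbb{T}^3))$; - if $p\ge 2$: $\theta\in C([0,T];L^p(\mathbb{T}^3))\cap L^p([0,T];B^{1/3}_{p,c(\mathbb{N})}(\mathbb{T}^3))$. Then for all $t\in[0,T]$, $\|v(t)\|_{L^2(\mathbb{T}^3)}^2=\|v_{\mathrm{in}}\|_{L^2(\mathbb{T}^3)}^2+2\int_0^t\int_{\mathbb{T}^3}\theta(x,s)v_3(x,s)\,dx\,ds$ and $\|\theta(t)\|_{L^p(\mathbb{T}^3)}=\|\theta_{\mathrm{in}}\|_{L^p(\mathbb{T}^3)}$.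
   Context: $\mathbb{T}^3=\mathbb{R}^3/\mathbb{Z}^3$, $e_3=(0,0,1)^T$. The inviscid Boussinesq system is $\partial_t v+(v\cdot\nabla)v+\nabla p=\theta e_3$, $\partial_t\theta+v\cdot\nabla\theta=0$, $\nabla\cdot v=0$ on $\mathbb{T}^3\times(0,T)$, with $(v,\theta)|_{t=0}=(v_{\mathrm{in}},\theta_{\mathrm{in}})$. Weak solution: $(v_{\mathrm{in}},\theta_{\mathrm{in}})\in C^\infty(\mathbb{T}^3)$, $v_{\mathrm{in}}$ divergence-free; $(v,\theta)\in C(\mathbb{T}^3\times[0,T])$ with $v(\cdot,t)$ distributionally divergence-free for a.e. $t$, and for all divergence-free $\phi\in C_c^\infty([0,T);(C^\infty(\mathbb{T}^3))^3)$: $-\int v_{\mathrm{in}}\cdot\phi(x,0)\,dx-\int_0^T\!\int\partial_s\phi\cdot v=\int_0^T\!\int(\nabla\phi:v\otimes v+\theta e_3\cdot\phi)$, and for all $\varphi\in C_c^\infty([0,T);C^\infty(\mathbb{T}^3))$: $-\int\theta_{\mathrm{in}}\varphi(x,0)\,dx-\int_0^T\!\int\partial_s\varphi\,\theta=\int_0^T\!\int v\cdot\nabla\varphi\,\theta$ (integrals over $\mathbb{T}^3$). Littlewood–Paley on $\mathbb{T}^3$: let $\chi,\varphi$ be smooth radial functions on $\mathbb{R}^3$ with values in $[0,1]$, $\mathrm{supp}\,\chi\subset\{|\xi|\le 4/3\}$, $\chi\equiv1$ on $|\xi|\le3/4$, $\mathrm{supp}\,\varphi\subset\{3/4\le|\xi|\le8/3\}$,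 and $\chi(\xi)+\sum_{j\ge0}\varphi(2^{-j}\xi)=1$. For a distribution $f=\sum_{k\in\mathbb{Z}^3}\hat f(k)e^{2\pi i k\cdot x}$, set $\Delta_j f=0$ for $j\le-2$, $\Delta_{-1}f=\sum_k\chi(k)\hat f(k)e^{2\pi ik\cdot x}$, $\Delta_jf=\sum_k\varphi(2^{-j}k)\hat f(k)e^{2\pi ik\cdot x}$ for $j\ge0$. For $s\in\mathbb{R}$, $1\le p\le\infty$: $B^s_{p,\infty}(\mathbb{T}^3)$ is the set of periodic distributions with $\sup_j 2^{js}\|\Delta_ju\|_{L^p(\mathbb{T}^3)}<\infty$, and $B^s_{p,c(\mathbb{N})}(\mathbb{T}^3)=\{u\in B^s_{p,\infty}(\mathbb{T}^3):2^{js}\|\Delta_ju\|_{L^p(\mathbb{T}^3)}\to0\text{ as }j\to\infty\}$. *)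

theory Defs
  imports "HOL-Analysis.Analysis"
begin

text \<open>Points of the torus are represented by points of real^3 (fundamental domain
  the unit cube); functions on the torus are Z^3-periodic functions on real^3.\<close>

definition Zvecs :: "(real^3) set" where
  "Zvecs = {k. \<forall>i. k $ i \<in> \<int>}"

definition cube :: "(real^3) set" where
  "cube = cbox 0 One"

definition periodic3 :: "(real^3 \<Rightarrow> 'b) \<Rightarrow> bool" where
  "periodic3 f \<longleftrightarrow> (\<forall>x k. k \<in> Zvecs \<longrightarrow> f (x + k) = f x)"

coinductive smooth_fun :: "('a::euclidean_space \<Rightarrow> real) \<Rightarrow> bool" where
  "(\<forall>x. f differentiable (at x)) \<Longrightarrow>
   (\<forall>i\<in>Basis. smooth_fun (\<lambda>x. frechet_derivative f (at x) i)) \<Longrightarrow> smooth_fun f"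

definition pdx :: "(real^3 \<Rightarrow> 'b::real_normed_vector) \<Rightarrow> 3 \<Rightarrow> real^3 \<Rightarrow> 'b" where
  "pdx f i x = frechet_derivative f (at x) (axis i 1)"

definition pdt_st :: "(real \<Rightarrow> real^3 \<Rightarrow> 'b::real_normed_vector) \<Rightarrow> real \<Rightarrow> real^3 \<Rightarrow> 'b" where
  "pdt_st g s x = frechet_derivative (\<lambda>(s', x'). g s' x') (at (s, x)) (1, 0)"

definition pdx_st :: "(real \<Rightarrow> real^3 \<Rightarrow> 'b::real_normed_vector) \<Rightarrow> 3 \<Rightarrow> real \<Rightarrow> real^3 \<Rightarrow> 'b" where
  "pdx_st g i s x = frechet_derivative (\<lambda>(s', x'). g s' x') (at (s, x)) (0, axis i 1)"

definition smooth_vec3 :: "(real^3 \<Rightarrow> real^3) \<Rightarrow> bool" where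
  "smooth_vec3 f \<longleftrightarrow> (\<forall>i. smooth_fun (\<lambda>x. f x $ i))"

definition div_free_smooth :: "(real^3 \<Rightarrow> real^3) \<Rightarrow> bool" where
  "div_free_smooth f \<longleftrightarrow> (\<forall>x. (\<Sum>i\<in>UNIV. pdx (\<lambda>y. f y $ i) i x) = 0)"

text \<open>Divergence-free vector test functions in C_c^infty([0,T); C^infty(T^3)^3):
  restrictions to [0,T) x T^3 of smooth space-time functions, periodic in space,
  vanishing for times s \<ge> T' for some T' < T, divergence-free for s in [0,T).\<close>
definition test_vec :: "real \<Rightarrow> (real \<Rightarrow> real^3 \<Rightarrow> real^3) \<Rightarrow> bool" where
  "test_vec T \<phi> \<longleftrightarrow>
     (\<forall>i. smooth_fun (\<lambda>(s, x). \<phi> s x $ i)) \<and>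
     (\<forall>s. periodic3 (\<phi> s)) \<and>
     (\<exists>T'<T. \<forall>s x. T' \<le> s \<longrightarrow> \<phi> s x = 0) \<and>
     (\<forall>s\<in>{0..<T}. \<forall>x. (\<Sum>i\<in>UNIV. pdx_st (\<lambda>s' x'. \<phi> s' x' $ i) i s x) = 0)"

definition test_scal :: "real \<Rightarrow> (real \<Rightarrow> real^3 \<Rightarrow> real) \<Rightarrow> bool" where
  "test_scal T \<phi> \<longleftrightarrow>
     smooth_fun (\<lambda>(s, x). \<phi> s x) \<and>
     (\<forall>s. periodic3 (\<phi> s)) \<and>
     (\<exists>T'<T. \<forall>s x. T' \<le> s \<longrightarrow> \<phi> s x = 0)"

definition weak_solution ::
  "real \<Rightarrow> (real^3 \<Rightarrow> real^3) \<Rightarrow> (real^3 \<Rightarrow> real) \<Rightarrow>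
   (real \<Rightarrow> real^3 \<Rightarrow> real^3) \<Rightarrow> (real \<Rightarrow> real^3 \<Rightarrow> real) \<Rightarrow> bool" where
  "weak_solution T vin \<theta>in v \<theta> \<longleftrightarrow>
     smooth_vec3 vin \<and> periodic3 vin \<and> div_free_smooth vin \<and>
     smooth_fun \<theta>in \<and> periodic3 \<theta>in \<and>
     continuous_on ({0..T} \<times> UNIV) (\<lambda>(t, x). v t x) \<and>
     continuous_on ({0..T} \<times> UNIV) (\<lambda>(t, x). \<theta> t x) \<and>
     (\<forall>t\<in>{0..T}. periodic3 (v t) \<and> periodic3 (\<theta> t)) \<and>
     (AE t in lebesgue_on {0..T}. \<forall>\<psi>. smooth_fun \<psi> \<and> periodic3 \<psi> \<longrightarrow>
         integral cube (\<lambda>x. \<Sum>i\<in>UNIV. v t x $ i * pdx \<psi> i x) = 0) \<and>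
     (\<forall>\<phi>. test_vec T \<phi> \<longrightarrow>
         - integral cube (\<lambda>x. vin x \<bullet> \<phi> 0 x)
         - integral {0..T} (\<lambda>s. integral cube (\<lambda>x. pdt_st \<phi> s x \<bullet> v s x))
         = integral {0..T} (\<lambda>s. integral cube (\<lambda>x.
              (\<Sum>i\<in>UNIV. \<Sum>j\<in>UNIV. pdx_st (\<lambda>s' x'. \<phi> s' x' $ i) j s x * v s x $ i * v s x $ j)
              + \<theta> s x * \<phi> s x $ 3))) \<and>
     (\<forall>\<phi>. test_scal T \<phi> \<longrightarrow>
         - integral cube (\<lambda>x. \<theta>in x * \<phi> 0 x)
         - integral {0..T} (\<lambda>s. integral cube (\<lambda>x. pdt_st \<phi> s x * \<theta> s x))
         = integral {0..T} (\<lambda>s. integral cube (\<lambda>x.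
              (\<Sum>j\<in>UNIV. v s x $ j * pdx_st \<phi> j s x) * \<theta> s x)))"

text \<open>L^p norm over T^3 (p in [1,\<infinity>]); only applied to continuous functions, for which
  the essential supremum is the supremum.\<close>
definition Lp_norm :: "ereal \<Rightarrow> (real^3 \<Rightarrow> 'b::real_normed_vector) \<Rightarrow> real" where
  "Lp_norm p f =
     (if p = \<infinity> then Sup ((\<lambda>x. norm (f x)) ` cube)
      else integral cube (\<lambda>x. norm (f x) powr real_of_ereal p) powr (1 / real_of_ereal p))"

definition conj_exp :: "ereal \<Rightarrow> ereal" where
  "conj_exp p = (if p = 1 then \<infinity> else if p = \<infinity> then 1
                 else ereal (real_of_ereal p / (real_of_ereal p - 1)))"

definition LP_pair :: "(real^3 \<Rightarrow> real) \<Rightarrow> (real^3 \<Rightarrow> real) \<Rightarrow> bool" where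
  "LP_pair \<kappa> \<phi> \<longleftrightarrow>
     smooth_fun \<kappa> \<and> smooth_fun \<phi> \<and>
     (\<forall>x y. norm x = norm y \<longrightarrow> \<kappa> x = \<kappa> y) \<and>
     (\<forall>x y. norm x = norm y \<longrightarrow> \<phi> x = \<phi> y) \<and>
     (\<forall>\<xi>. 0 \<le> \<kappa> \<xi> \<and> \<kappa> \<xi> \<le> 1) \<and> (\<forall>\<xi>. 0 \<le> \<phi> \<xi> \<and> \<phi> \<xi> \<le> 1) \<and>
     closure {\<xi>. \<kappa> \<xi> \<noteq> 0} \<subseteq> cball 0 (4/3) \<and>
     (\<forall>\<xi>. norm \<xi> \<le> 3/4 \<longrightarrow> \<kappa> \<xi> = 1) \<and>
     closure {\<xi>. \<phi> \<xi> \<noteq> 0} \<subseteq> {\<xi>. 3/4 \<le> norm \<xi> \<and> norm \<xi> \<le> 8/3} \<and>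
     (\<forall>\<xi>. \<kappa> \<xi> + (\<Sum>j. \<phi> ((2 powr - real j) *\<^sub>R \<xi>)) = 1)"

definition fourier_coeff :: "(real^3 \<Rightarrow> complex) \<Rightarrow> real^3 \<Rightarrow> complex" where
  "fourier_coeff f k = integral cube (\<lambda>x. f x * exp (- 2 * pi * \<i> * complex_of_real (k \<bullet> x)))"

definition LP_block ::
  "(real^3 \<Rightarrow> real) \<Rightarrow> (real^3 \<Rightarrow> real) \<Rightarrow> int \<Rightarrow> (real^3 \<Rightarrow> real) \<Rightarrow> real^3 \<Rightarrow> complex" where
  "LP_block \<kappa> \<phi> j f x =
     (if j \<le> -2 then 0
      else infsum (\<lambda>k. complex_of_real (if j = -1 then \<kappa> k else \<phi> ((2 powr - real_of_int j) *\<^sub>R k))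
                      * fourier_coeff (\<lambda>y. complex_of_real (f y)) k
                      * exp (2 * pi * \<i> * complex_of_real (k \<bullet> x))) Zvecs)"

definition besov_norm ::
  "(real^3 \<Rightarrow> real) \<Rightarrow> (real^3 \<Rightarrow> real) \<Rightarrow> real \<Rightarrow> ereal \<Rightarrow> (real^3 \<Rightarrow> real) \<Rightarrow> ennreal" where
  "besov_norm \<kappa> \<phi> s p f = (SUP j::int. ennreal (2 powr (real_of_int j * s) * Lp_norm p (LP_block \<kappa> \<phi> j f)))"

definition besov_c ::
  "(real^3 \<Rightarrow> real) \<Rightarrow> (real^3 \<Rightarrow> real) \<Rightarrow> real \<Rightarrow> ereal \<Rightarrow> (real^3 \<Rightarrow> real) \<Rightarrow> bool" where
  "besov_c \<kappa> \<phi> s p f \<longleftrightarrow>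
     besov_norm \<kappa> \<phi> s p f < \<infinity> \<and>
     ((\<lambda>j::nat. 2 powr (real j * s) * Lp_norm p (LP_block \<kappa> \<phi> (int j) f)) \<longlonglongrightarrow> 0)"

definition besov_norm_vec ::
  "(real^3 \<Rightarrow> real) \<Rightarrow> (real^3 \<Rightarrow> real) \<Rightarrow> real \<Rightarrow> ereal \<Rightarrow> (real^3 \<Rightarrow> real^3) \<Rightarrow> ennreal" where
  "besov_norm_vec \<kappa> \<phi> s p f = (\<Sum>i\<in>UNIV. besov_norm \<kappa> \<phi> s p (\<lambda>x. f x $ i))"

definition besov_c_vec ::
  "(real^3 \<Rightarrow> real) \<Rightarrow> (real^3 \<Rightarrow> real) \<Rightarrow> real \<Rightarrow> ereal \<Rightarrow> (real^3 \<Rightarrow> real^3) \<Rightarrow> bool" where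
  "besov_c_vec \<kappa> \<phi> s p f \<longleftrightarrow> (\<forall>i. besov_c \<kappa> \<phi> s p (\<lambda>x. f x $ i))"

definition time_Lq :: "ereal \<Rightarrow> real \<Rightarrow> (real \<Rightarrow> ennreal) \<Rightarrow> bool" where
  "time_Lq q T g \<longleftrightarrow>
     (if q = \<infinity> then (\<exists>C::real. AE t in lebesgue_on {0..T}. g t \<le> ennreal C)
      else (AE t in lebesgue_on {0..T}. g t < \<infinity>) \<and>
           (\<integral>\<^sup>+ t. ennreal (enn2real (g t) powr real_of_ereal q) \<partial>(lebesgue_on {0..T})) < \<infinity>)"

end

theory Submission
  imports Defs
begin

text \<open>
  On the unit torus the Lq norms increase with q and every case of the hypothesis on \<theta> has q \<ge> 2,
  so \<theta> is square integrable in time with values in B^{1/3}_{2,\<infinity>}.  Mollify in space with a trigonometric kernel K and let J(f,g) be the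
  double mean over x, y of (\<nabla>K(x - y) \<cdot> v(x)) f(x) g(y).  As v is weakly divergence free,
  J(f,g) + J(g,f) is -1/2 times the double mean of \<nabla>K(x - y) \<cdot> \<delta>v \<delta>f \<delta>g, where
  \<delta> denotes the difference between x and y.  By Hoelder regularity the product of the increments is
  o(|x - y|) in the mean, which beats the gradient of K, so this flux tends to 0 as K concentrates at the
  origin.  The time derivative of half the energy mean of v \<cdot> (K * v) is the sum of the J(v_i,v_i) plus
  the buoyancy work, and that of the mean of (K * \<theta>)^n is J(\<theta>, n (K * \<theta>)^(n-1)),
  whose mirror image J(n (K * \<theta>)^(n-1), \<theta>) vanishes.  Hence all moments of \<theta> are
  conserved, and by the Weierstrass theorem so are all its Lp norms.
\<close>

section \<open>Mean values of periodic functions\<close>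

text \<open>Neither v nor \<theta> is differentiable in time, and the test functions at hand are
  products a(s) \<psi>(x), so the mollified solution cannot be inserted directly. For \<theta>, the
  kernel centred at x serves as \<psi>; this yields an integral equation in t for K * \<theta> at
  each x, and powers of K * \<theta> can be differentiated. For v, the form B(s,t), the mean of v(s)
  . (K * v(t)), is differentiated in s with t frozen, and its symmetry recovers the derivative along
  s = t. Mollification preserves weak incompressibility, so K * v(t) is an admissible test field and
  no pressure enters. The kernel is trigonometric because K * f is then a finite Fourier sum for
  every continuous f: it is smooth, and finitely many Littlewood-Paley blocks reproduce it exactly.
  The exponents balance: the velocity increment is o(|z|^(1/3)) uniformly in x, the other two are
  O(|z|^(1/3)) in L2, and |z| times the gradient of K has a mean bounded independently of K. Integer
  powers are used since each is smooth and together they determine the distribution of the values of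
  \<theta>, hence all the norms at once.\<close>

abbreviation avg :: "(real^3 \<Rightarrow> 'b::real_normed_vector) \<Rightarrow> 'b" where
  "avg \<equiv> integral cube"

definition cper :: "(real^3 \<Rightarrow> 'b::topological_space) \<Rightarrow> bool" where
  "cper f \<longleftrightarrow> continuous_on UNIV f \<and> periodic3 f"

lemma sum_Basis_nth [simp]: "(\<Sum>b\<in>(Basis::(real^3) set). b $ i) = 1"
proof -
  have "(\<Sum>(Basis::(real^3) set)) \<bullet> axis i 1 = 1"
    by (rule inner_sum_Basis) (simp add: axis_in_Basis_iff)
  then show ?thesis by (simp add: inner_axis)
qed

lemma mem_cube: "x \<in> cube \<longleftrightarrow> (\<forall>i. 0 \<le> x $ i \<and> x $ i \<le> 1)"
  by (auto simp: cube_def mem_box_cart)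

lemma integral_cube_const [simp]: "avg (\<lambda>x. c) = (c::'b::euclidean_space)"
proof -
  have "measure lborel cube = 1"
    unfolding cube_def by (subst measure_lborel_cbox) auto
  then show ?thesis by (simp add: cube_def)
qed

lemma compact_cube [simp]: "compact cube" by (simp add: cube_def)

lemma cube_nonempty: "cube \<noteq> {}"
proof -
  have "0 \<in> cube" by (simp add: mem_cube)
  then show ?thesis by blast
qed

lemma cont_UNIV_compose:
  "continuous_on UNIV f \<Longrightarrow> continuous_on S g \<Longrightarrow> continuous_on S (\<lambda>x. f (g x))"
  by (rule continuous_on_compose2) auto

lemma integrable_cube:
  fixes f :: "real^3 \<Rightarrow> 'b::banach"
  shows "continuous_on UNIV f \<Longrightarrow> f integrable_on cube"
  unfolding cube_def by (rule integrable_continuous) (erule continuous_on_subset, simp)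

lemma integral_cube_cong:
  "(\<And>x. f x = g x) \<Longrightarrow> avg f = avg g"
  by (rule integral_cong) simp

lemma cper_cont: "cper f \<Longrightarrow> continuous_on UNIV f"
  by (simp add: cper_def)

lemma periodic_in_cube:
  obtains k where "k \<in> Zvecs" "(x::real^3) - k \<in> cube"
proof -
  define k :: "real^3" where "k = (\<chi> i. of_int \<lfloor>x $ i\<rfloor>)"
  have "k \<in> Zvecs" by (auto simp: Zvecs_def k_def)
  moreover have "x - k \<in> cube"
    by (auto simp: mem_cube k_def) linarith
  ultimately show ?thesis using that by metis
qed

lemma cper_bounded:
  fixes f :: "real^3 \<Rightarrow> 'b::real_normed_vector"
  assumes "cper f" obtains M where "M > 0" "\<And>x. norm (f x) \<le> M"
proof -
  have "compact (f ` cube)"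
    using assms by (intro compact_continuous_image) (auto simp: cper_def intro: continuous_on_subset)
  then obtain M where M: "M > 0" "\<And>x. x \<in> cube \<Longrightarrow> norm (f x) \<le> M"
    using bounded_pos compact_imp_bounded by (metis (no_types, lifting) imageI)
  have "norm (f x) \<le> M" for x
  proof -
    obtain k where k: "k \<in> Zvecs" "x - k \<in> cube" by (rule periodic_in_cube)
    then have "f (x - k) = f x"
      using assms unfolding cper_def periodic3_def by (metis diff_add_cancel)
    with k M show ?thesis by metis
  qed
  with M show ?thesis using that by blast
qed

lemma axis_Zvecs [simp]: "axis i (1::real) \<in> (Zvecs::(real^3) set)"
  by (auto simp: Zvecs_def axis_def)

text \<open>The cube is cut at x_i = 1 - c. The lower piece moves up by c; on the upper piece
  periodicity replaces the shift c by c - 1, so it moves down. Together they tile the cube cut at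
  x_i = c.\<close>

lemma integral_cube_shift_axis:
  fixes f :: "real^3 \<Rightarrow> 'b::banach"
  assumes f: "cper f" and c: "0 \<le> c" "c \<le> 1"
  shows "avg (\<lambda>x. f (x + c *\<^sub>R axis i 1)) = avg f"
proof -
  let ?k = "axis i (1::real) :: real^3"
  let ?o = "\<Sum>(Basis::(real^3) set)"
  have cf: "continuous_on UNIV f" using f by (simp add: cper_def)
  have kB: "?k \<in> Basis" by (simp add: axis_in_Basis_iff)
  have ik: "x \<bullet> ?k = x $ i" for x by (simp add: inner_axis)
  have nk: "(r *\<^sub>R ?k) $ j = (if j = i then r else 0)" for j r by (auto simp: axis_def)
  have per: "f (x + (c - 1) *\<^sub>R ?k) = f (x + c *\<^sub>R ?k)" for x
  proof -
    have "f ((x + (c - 1) *\<^sub>R ?k) + ?k) = f (x + (c - 1) *\<^sub>R ?k)"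
      using f unfolding cper_def periodic3_def by (meson axis_Zvecs)
    then show ?thesis by (simp add: algebra_simps)
  qed
  have sp: "(\<forall>j. P j) \<longleftrightarrow> P i \<and> (\<forall>j. j \<noteq> i \<longrightarrow> P j)" for P :: "3 \<Rightarrow> bool" by auto
  \<comment> \<open>The right-hand sides of \<open>s1\<close> and \<open>s2\<close> are left as
    corner minus shift, the shape that \<open>integral_shift_cbox\<close> rewrites.\<close>
  have s1: "cbox 0 ?o \<inter> {x. x \<bullet> ?k \<le> 1 - c} = cbox (c *\<^sub>R ?k - c *\<^sub>R ?k) (?o - c *\<^sub>R ?k)"
    unfolding ik using c by (intro set_eqI) (simp add: mem_box_cart axis_def, subst (1 2) sp, auto)
  have s2: "cbox 0 ?o \<inter> {x. x \<bullet> ?k \<ge> 1 - c} = cbox (0 - (c-1) *\<^sub>R ?k) ((?o - (1-c) *\<^sub>R ?k) - (c-1) *\<^sub>R ?k)"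
    unfolding ik using c by (intro set_eqI) (simp add: mem_box_cart axis_def, subst (1 2) sp, auto)
  have s3: "cbox 0 ?o \<inter> {x. x \<bullet> ?k \<le> c} = cbox 0 (?o - (1-c) *\<^sub>R ?k)"
    unfolding ik using c by (intro set_eqI) (simp add: mem_box_cart axis_def, subst (1 2) sp, auto)
  have s4: "cbox 0 ?o \<inter> {x. x \<bullet> ?k \<ge> c} = cbox (c *\<^sub>R ?k) ?o"
    unfolding ik using c by (intro set_eqI) (simp add: mem_box_cart axis_def, subst (1 2) sp, auto)
  have "avg (\<lambda>x. f (x + c *\<^sub>R ?k)) =
     integral (cbox (c *\<^sub>R ?k - c *\<^sub>R ?k) (?o - c *\<^sub>R ?k)) (\<lambda>x. f (x + c *\<^sub>R ?k))
     + integral (cbox (0 - (c-1) *\<^sub>R ?k) ((?o - (1-c) *\<^sub>R ?k) - (c-1) *\<^sub>R ?k)) (\<lambda>x. f (x + (c-1) *\<^sub>R ?k))"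
    unfolding per s1[symmetric] s2[symmetric] unfolding cube_def
    by (rule integral_split[OF _ kB]) (intro integrable_continuous cont_UNIV_compose[OF cf] continuous_intros)
  also have "\<dots> = integral (cbox (c *\<^sub>R ?k) ?o) f + integral (cbox 0 (?o - (1-c) *\<^sub>R ?k)) f"
    by (simp only: integral_shift_cbox)
  also have "\<dots> = avg f"
    unfolding s3[symmetric] s4[symmetric] cube_def
    using integral_split[OF integrable_cube[OF cf, unfolded cube_def] kB, of c] by simp
  finally show ?thesis .
qed

lemma cper_shift: "cper f \<Longrightarrow> cper (\<lambda>x. f (x + a))"
proof -
  assume f: "cper f"
  have "continuous_on UNIV (\<lambda>x. f (x + a))"
    by (intro cont_UNIV_compose[OF cper_cont[OF f]] continuous_intros)
  moreover have "f (x + k + a) = f (x + a)" if "k \<in> Zvecs" for x k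
    using f that unfolding cper_def periodic3_def by (metis add.assoc add.commute)
  ultimately show ?thesis unfolding cper_def periodic3_def by blast
qed

lemma vec3_axis_sum: "(a::real^3) = a$1 *\<^sub>R axis 1 1 + a$2 *\<^sub>R axis 2 1 + a$3 *\<^sub>R axis 3 1"
  by (simp add: vec_eq_iff forall_3 axis_def)

lemma integral_cube_shift:
  fixes f :: "real^3 \<Rightarrow> 'b::banach"
  assumes f: "cper f"
  shows "avg (\<lambda>x. f (x + a)) = avg f"
proof -
  obtain k where k: "k \<in> Zvecs" "a - k \<in> cube" by (rule periodic_in_cube)
  let ?b = "a - k"
  have "f (x + a) = f (x + ?b)" for x
    using f k unfolding cper_def periodic3_def by (metis add_diff_eq diff_add_cancel)
  then have "avg (\<lambda>x. f (x + a)) = avg (\<lambda>x. f (x + ?b))" by simp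
  also have "\<dots> = avg (\<lambda>x. f (((x + ?b$1 *\<^sub>R axis 1 1) + ?b$2 *\<^sub>R axis 2 1) + ?b$3 *\<^sub>R axis 3 1))"
    by (subst vec3_axis_sum[of ?b]) (simp add: add.assoc)
  also have "\<dots> = avg (\<lambda>x. f ((x + ?b$2 *\<^sub>R axis 2 1) + ?b$3 *\<^sub>R axis 3 1))"
    using k(2)[unfolded mem_cube]
    by (intro integral_cube_shift_axis[where f="\<lambda>x. f (x + ?b$2 *\<^sub>R axis 2 1 + ?b$3 *\<^sub>R axis 3 1)"]
          cper_shift[OF cper_shift[OF f]]) auto
  also have "\<dots> = avg (\<lambda>x. f (x + ?b$3 *\<^sub>R axis 3 1))"
    using k(2)[unfolded mem_cube]
    by (intro integral_cube_shift_axis[where f="\<lambda>x. f (x + ?b$3 *\<^sub>R axis 3 1)"] cper_shift[OF f]) auto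
  also have "\<dots> = avg f"
    using k(2)[unfolded mem_cube] by (intro integral_cube_shift_axis f) auto
  finally show ?thesis .
qed

lemma integral_cube_swap:
  fixes F :: "real^3 \<Rightarrow> real^3 \<Rightarrow> 'b::banach"
  assumes "continuous_on UNIV (\<lambda>p. F (fst p) (snd p))"
  shows "avg (\<lambda>x. avg (F x)) = avg (\<lambda>y. avg (\<lambda>x. F x y))"
  unfolding cube_def
  by (rule integral_swap_continuous) (unfold case_prod_beta, rule continuous_on_subset[OF assms], simp)

lemma cont_integral_cube:
  fixes F :: "'a::topological_space \<Rightarrow> real^3 \<Rightarrow> 'b::banach"
  assumes "continuous_on (U \<times> UNIV) (\<lambda>p. F (fst p) (snd p))"
  shows "continuous_on U (\<lambda>x. avg (F x))"
  unfolding cube_def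
  by (rule integral_continuous_on_param) (unfold case_prod_beta, rule continuous_on_subset[OF assms], auto)

text \<open>By translation invariance the mean of f(x + h e_i) is constant in h, and differentiation
  under the integral gives its derivative at h = 0 as the mean of g. This is the form of integration
  by parts used for the kernel moments.\<close>

lemma integral_cube_deriv_axis:
  fixes f g :: "real^3 \<Rightarrow> real"
  assumes f: "cper f" and g: "continuous_on UNIV g"
    and d: "\<And>x. ((\<lambda>h. f (x + h *\<^sub>R axis i 1)) has_real_derivative g x) (at 0)"
  shows "avg g = 0"
proof -
  have d': "((\<lambda>h. f (x + h *\<^sub>R axis i 1)) has_vector_derivative g (x + h *\<^sub>R axis i 1)) (at h)" for x h
  proof -
    have "((\<lambda>u. f ((x + h *\<^sub>R axis i 1) + u *\<^sub>R axis i 1)) has_real_derivative g (x + h *\<^sub>R axis i 1)) (at (h - h))"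
      using d[of "x + h *\<^sub>R axis i 1"] by simp
    then have "((\<lambda>u. f ((x + h *\<^sub>R axis i 1) + (u - h) *\<^sub>R axis i 1)) has_real_derivative g (x + h *\<^sub>R axis i 1)) (at h)"
      using DERIV_shift[of "\<lambda>u. f ((x + h *\<^sub>R axis i 1) + u *\<^sub>R axis i 1)" _ h "-h"] by simp
    then show ?thesis
      by (simp add: has_real_derivative_iff_has_vector_derivative algebra_simps)
  qed
  have "((\<lambda>h. avg (\<lambda>x. f (x + h *\<^sub>R axis i 1))) has_vector_derivative
         avg (\<lambda>x. g (x + 0 *\<^sub>R axis i 1))) (at 0 within UNIV)"
    unfolding cube_def
  proof (rule leibniz_rule_vector_derivative)
    show "continuous_on (UNIV \<times> cbox 0 One) (\<lambda>(h, x). g (x + h *\<^sub>R axis i 1))"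
      unfolding case_prod_beta by (intro cont_UNIV_compose[OF g] continuous_intros)
    show "(\<lambda>x. f (x + h *\<^sub>R axis i 1)) integrable_on cbox 0 One" for h
      by (intro integrable_continuous cont_UNIV_compose[OF cper_cont[OF f]] continuous_intros)
  qed (use d' in auto)
  then have "((\<lambda>h. avg f) has_vector_derivative avg g) (at (0::real))"
    using integral_cube_shift[OF f] by simp
  then show ?thesis
    using vector_derivative_unique_at[OF _ has_vector_derivative_const] by metis
qed

section \<open>Trigonometric polynomials and the mollifier\<close>

definition ek :: "real^3 \<Rightarrow> real^3 \<Rightarrow> complex" where
  "ek k x = cis (2 * pi * (k \<bullet> x))"

lemma Zvecs_add [simp]: "k \<in> Zvecs \<Longrightarrow> l \<in> Zvecs \<Longrightarrow> k + l \<in> Zvecs"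
  and Zvecs_minus [simp]: "k \<in> Zvecs \<Longrightarrow> - k \<in> Zvecs"
  and Zvecs_0 [simp]: "0 \<in> Zvecs"
  by (auto simp: Zvecs_def)

lemma Zvecs_diff [simp]: "k \<in> Zvecs \<Longrightarrow> l \<in> Zvecs \<Longrightarrow> k - l \<in> Zvecs"
  using Zvecs_add[of k "-l"] by simp

lemma Zvecs_inner: "k \<in> Zvecs \<Longrightarrow> l \<in> Zvecs \<Longrightarrow> k \<bullet> l \<in> \<int>"
  unfolding inner_vec_def Zvecs_def by (auto intro!: Ints_sum)

lemma ek_add: "ek (k + l) x = ek k x * ek l x"
  by (simp add: ek_def cis_mult inner_add_left distrib_left)

lemma ek_add_right: "ek k (x + y) = ek k x * ek k y"
  by (simp add: ek_def cis_mult inner_add_right distrib_left)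

lemma ek_0 [simp]: "ek 0 x = 1" "ek k 0 = 1" by (simp_all add: ek_def)

lemma ek_minus: "ek (- k) x = cnj (ek k x)" "ek k (- x) = cnj (ek k x)"
  by (simp_all add: ek_def cis_cnj)

lemma ek_diff: "ek (k - l) x = ek k x * cnj (ek l x)"
  using ek_add[of k "- l"] by (simp add: ek_minus)

lemma ek_diff_right: "ek k (x - y) = ek k x * cnj (ek k y)"
  using ek_add_right[of k x "- y"] by (simp add: ek_minus)

lemma norm_ek [simp]: "norm (ek k x) = 1" by (simp add: ek_def)

lemma ek_Zvecs: "k \<in> Zvecs \<Longrightarrow> l \<in> Zvecs \<Longrightarrow> ek k l = 1"
  using cos_integer_2pi sin_integer_2pi by (simp add: ek_def complex_eq_iff Zvecs_inner)

lemma continuous_on_ek [continuous_intros]: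
  "continuous_on S f \<Longrightarrow> continuous_on S (\<lambda>x. ek k (f x))"
  unfolding ek_def by (intro continuous_intros)

lemma cper_ek: "k \<in> Zvecs \<Longrightarrow> cper (ek k)"
  by (auto simp: cper_def periodic3_def ek_add_right ek_Zvecs intro!: continuous_intros)

lemma cper_mult:
  fixes f g :: "real^3 \<Rightarrow> 'a::real_normed_algebra"
  shows "cper f \<Longrightarrow> cper g \<Longrightarrow> cper (\<lambda>x. f x * g x)"
  by (auto simp: cper_def periodic3_def intro!: continuous_intros)

lemma cper_add:
  fixes f g :: "real^3 \<Rightarrow> 'a::real_normed_vector"
  shows "cper f \<Longrightarrow> cper g \<Longrightarrow> cper (\<lambda>x. f x + g x)"
  by (auto simp: cper_def periodic3_def intro!: continuous_intros)

lemma cper_diff: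
  fixes f g :: "real^3 \<Rightarrow> 'a::real_normed_vector"
  shows "cper f \<Longrightarrow> cper g \<Longrightarrow> cper (\<lambda>x. f x - g x)"
  by (auto simp: cper_def periodic3_def intro!: continuous_intros)

lemma cper_const: "cper (\<lambda>x. c)"
  by (auto simp: cper_def periodic3_def)

lemma cper_vec_nth: "cper W \<Longrightarrow> cper (\<lambda>x. W x $ i)" for W :: "real^3 \<Rightarrow> real^3"
  by (auto simp: cper_def periodic3_def intro!: continuous_intros)

lemma cper_compose: "continuous_on UNIV h \<Longrightarrow> cper f \<Longrightarrow> cper (\<lambda>x. h (f x))"
  by (auto simp: cper_def periodic3_def intro!: cont_UNIV_compose[of h])

text \<open>If k_i is nonzero, a shift by 1/(2 k_i) along axis i multiplies \<open>ek k\<close> by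
  -1, so its mean equals its own negative.\<close>

lemma integral_ek:
  assumes "k \<in> Zvecs" shows "avg (ek k) = (if k = 0 then 1 else 0)"
proof (cases "k = 0")
  case True
  have "ek 0 = (\<lambda>x. 1)" by auto
  then show ?thesis using True by simp
next
  case False
  then obtain i where i: "k $ i \<noteq> 0" by (metis vec_eq_iff zero_index)
  have "ek k (axis i (1 / (2 * k $ i))) = -1"
    using i by (simp add: ek_def inner_axis complex_eq_iff)
  then have "avg (\<lambda>x. ek k (x + axis i (1 / (2 * k $ i)))) = - avg (ek k)"
    by (simp add: ek_add_right)
  then have "avg (ek k) = - avg (ek k)"
    using integral_cube_shift[OF cper_ek[OF assms]] by simp
  then show ?thesis using False
    by (metis add.inverse_neutral eq_neg_iff_add_eq_0 mult_2 mult_eq_0_iff zero_neq_numeral)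
qed

inductive trig_poly :: "(real^3 \<Rightarrow> complex) \<Rightarrow> bool" where
  trig_poly_ek: "k \<in> Zvecs \<Longrightarrow> trig_poly (\<lambda>x. c * ek k x)"
| trig_poly_add: "trig_poly f \<Longrightarrow> trig_poly g \<Longrightarrow> trig_poly (\<lambda>x. f x + g x)"

lemma trig_poly_const: "trig_poly (\<lambda>x. c)"
  using trig_poly_ek[of 0 c] by simp

lemma trig_poly_mult_ek: "trig_poly f \<Longrightarrow> k \<in> Zvecs \<Longrightarrow> trig_poly (\<lambda>x. (c * ek k x) * f x)"
proof (induction rule: trig_poly.induct)
  case (trig_poly_ek l d)
  have "(\<lambda>x. (c * ek k x) * (d * ek l x)) = (\<lambda>x. (c * d) * ek (k + l) x)"
    by (auto simp: ek_add)
  then show ?case using trig_poly_ek trig_poly.trig_poly_ek[of "k + l" "c * d"] by simp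
next
  case (trig_poly_add f g)
  then show ?case by (auto simp: distrib_left intro: trig_poly.trig_poly_add)
qed

lemma trig_poly_mult: "trig_poly g \<Longrightarrow> trig_poly f \<Longrightarrow> trig_poly (\<lambda>x. g x * f x)"
proof (induction rule: trig_poly.induct)
  case (trig_poly_ek l d)
  then show ?case using trig_poly_mult_ek by blast
next
  case (trig_poly_add f g)
  then show ?case by (auto simp: distrib_right intro: trig_poly.trig_poly_add)
qed

lemma trig_poly_power: "trig_poly f \<Longrightarrow> trig_poly (\<lambda>x. f x ^ n)"
  by (induction n) (auto intro: trig_poly_const trig_poly_mult)

lemma trig_poly_cper: "trig_poly f \<Longrightarrow> cper f"
  by (induction rule: trig_poly.induct) (auto intro: cper_add cper_mult cper_const cper_ek)

text \<open>The mollifier is the de la Vallee-Poussin kernel, the normalised 2m-th power of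
  cos (\<pi> x_1) cos (\<pi> x_2) cos (\<pi> x_3).  It is an even nonnegative trigonometric polynomial, and
  its moments follow from integration by parts over one period, without separating the variables.\<close>

definition Cf :: "real^3 \<Rightarrow> real" where
  "Cf x = cos (pi * x$1) * cos (pi * x$2) * cos (pi * x$3)"

text \<open>Up to the factor -pi this is the partial derivative of \<open>Cf\<close> in direction
  j.\<close>

definition Sf :: "3 \<Rightarrow> real^3 \<Rightarrow> real" where
  "Sf j x = sin (pi * x$j) * (\<Prod>i\<in>UNIV-{j}. cos (pi * x$i))"

definition sin_sq :: "real^3 \<Rightarrow> real" where
  "sin_sq x = (\<Sum>i\<in>UNIV. (sin (pi * x$i))\<^sup>2)"

definition Gk :: "nat \<Rightarrow> real^3 \<Rightarrow> real" where
  "Gk m x = Cf x ^ (2 * m)"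

\<comment> \<open>For m = 0 the truncated exponent 2m - 1 is harmless because of the factor m.\<close>
definition dG :: "nat \<Rightarrow> 3 \<Rightarrow> real^3 \<Rightarrow> real" where
  "dG m j x = - 2 * pi * real m * Cf x ^ (2 * m - 1) * Sf j x"

lemma UNIV_minus_3: "UNIV - {1::3} = {2,3}" "UNIV - {2::3} = {1,3}" "UNIV - {3::3} = {1,2}"
  using exhaust_3 by fastforce+

lemma Cf_Sf: "Cf x * sin (pi * x$j) = Sf j x * cos (pi * x$j)"
  using exhaust_3[of j] by (auto simp: Cf_def Sf_def UNIV_minus_3)

lemma axis_shift_nth: "(x + h *\<^sub>R axis j (1::real)) $ i = (if i = j then x $ i + h else x $ i)"
  by (auto simp: axis_def)

lemma Cf_deriv: "((\<lambda>h. Cf (x + h *\<^sub>R axis j 1)) has_real_derivative - pi * Sf j x) (at 0)"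
  using exhaust_3[of j] unfolding Cf_def Sf_def axis_shift_nth
  by (auto simp: UNIV_minus_3 intro!: derivative_eq_intros)

lemma Gk_deriv: "((\<lambda>h. Gk m (x + h *\<^sub>R axis j 1)) has_real_derivative dG m j x) (at 0)"
  unfolding Gk_def
  by (rule derivative_eq_intros Cf_deriv refl)+ (simp add: dG_def)

text \<open>The factors cos(pi x_i) have period 2; the even exponent is what gives period 1, because
  cos(pi x_i)^2 is a combination of the frequencies 0 and +-e_i.\<close>

lemma Gk_trig_poly: "trig_poly (\<lambda>x. complex_of_real (Gk m x))"
proof -
  have c2: "complex_of_real ((cos (pi * x$i))\<^sup>2) = 1/2 + (1/4 * ek (axis i 1) x + 1/4 * ek (- axis i 1) x)" for x i
  proof -
    have "(cos (pi * x$i))\<^sup>2 = (1 + cos (2 * (pi * x$i))) / 2"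
      by (simp add: cos_double_cos)
    then show ?thesis
      by (auto simp: complex_eq_iff ek_def inner_axis' algebra_simps)
  qed
  have t: "trig_poly (\<lambda>x. complex_of_real ((cos (pi * x$i))\<^sup>2))" for i
    unfolding c2 by (intro trig_poly_add trig_poly_const trig_poly_ek) auto
  have "(\<lambda>x. complex_of_real (Gk m x)) = (\<lambda>x. (complex_of_real ((cos (pi * x$1))\<^sup>2) * complex_of_real ((cos (pi * x$2))\<^sup>2) * complex_of_real ((cos (pi * x$3))\<^sup>2)) ^ m)"
    by (simp add: Gk_def Cf_def power_mult power_mult_distrib)
  moreover have "trig_poly \<dots>" by (intro trig_poly_power trig_poly_mult t)
  ultimately show ?thesis by simp
qed

lemma trig_poly_of_real_cper: "trig_poly (\<lambda>x. complex_of_real (f x)) \<Longrightarrow> cper f"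
  using cper_compose[of Re "\<lambda>x. complex_of_real (f x)"] trig_poly_cper
  by (simp add: continuous_on_Re)

lemma cper_Gk: "cper (Gk m)" using trig_poly_of_real_cper Gk_trig_poly by blast

lemma continuous_on_Cf [continuous_intros]: "continuous_on (S::'a::t2_space set) f \<Longrightarrow> continuous_on S (\<lambda>x. Cf (f x))"
  unfolding Cf_def by (intro continuous_intros)

lemma continuous_on_Sf [continuous_intros]: "continuous_on (S::'a::t2_space set) f \<Longrightarrow> continuous_on S (\<lambda>x. Sf j (f x))"
  unfolding Sf_def by (intro continuous_intros)

lemma continuous_on_sin_sq [continuous_intros]: "continuous_on (S::'a::t2_space set) f \<Longrightarrow> continuous_on S (\<lambda>x. sin_sq (f x))"
  unfolding sin_sq_def by (intro continuous_intros)

lemma continuous_on_Gk [continuous_intros]: "continuous_on (S::'a::t2_space set) f \<Longrightarrow> continuous_on S (\<lambda>x. Gk m (f x))"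
  unfolding Gk_def by (intro continuous_intros)

lemma continuous_on_dG [continuous_intros]: "continuous_on (S::'a::t2_space set) f \<Longrightarrow> continuous_on S (\<lambda>x. dG m j (f x))"
  unfolding dG_def by (intro continuous_intros)

text \<open>Inherited from \<open>Gk\<close> by uniqueness of the derivative. In the explicit
  formula the odd power of \<open>Cf\<close> and the factor \<open>Sf\<close> may each change sign
  under a lattice shift.\<close>

lemma dG_periodic: "periodic3 (dG m j)"
  unfolding periodic3_def
proof (intro allI impI)
  fix x k :: "real^3" assume k: "k \<in> Zvecs"
  have "Gk m (x + k + h) = Gk m (x + h)" for h
    using cper_Gk[of m] k unfolding cper_def periodic3_def by (metis add.assoc add.commute)
  then show "dG m j (x + k) = dG m j x"
    using Gk_deriv[of m "x + k" j] Gk_deriv[of m x j] DERIV_unique by fastforce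
qed

lemma cper_dG: "cper (dG m j)"
  by (auto simp: cper_def dG_periodic intro!: continuous_intros)

lemma cper_cos_2pi: "cper (\<lambda>x. cos (2 * pi * x$j))" and cper_sin_2pi: "cper (\<lambda>x. sin (2 * pi * x$j))"
  by (auto simp: cper_def periodic3_def Zvecs_def distrib_left cos_add sin_add cos_integer_2pi sin_integer_2pi
       intro!: continuous_intros)

lemma cper_sin2: "cper (\<lambda>x. (sin (pi * x$j))\<^sup>2)"
proof -
  have "(\<lambda>x::real^3. (sin (pi * x$j))\<^sup>2) = (\<lambda>x. 1/2 - 1/2 * cos (2 * pi * x$j))"
    by (rule ext) (simp add: cos_double_sin mult.assoc diff_divide_distrib)
  then show ?thesis using cper_diff[OF cper_const cper_mult[OF cper_const[of "1/2"] cper_cos_2pi[of j]], of "1/2"] by simp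
qed

lemma cper_sincos: "cper (\<lambda>x. cos (pi * x$j) * sin (pi * x$j))"
proof -
  have "(\<lambda>x::real^3. cos (pi * x$j) * sin (pi * x$j)) = (\<lambda>x. 1/2 * sin (2 * pi * x$j))"
    using sin_double[of "pi * x$j" for x::"real^3"] by (auto simp: mult.assoc)
  then show ?thesis using cper_sin_2pi cper_mult[OF cper_const[of "1/2"] cper_sin_2pi[of j]] by simp
qed

section \<open>Mass, second and fourth moments of the kernel\<close>

definition Zk :: "nat \<Rightarrow> real" where "Zk m = avg (Gk m)"

lemma Gk_nonneg [simp]: "0 \<le> Gk m x" by (simp add: Gk_def)

text \<open>The weight cos sin restores the exponent 2m of \<open>Cf\<close>, because
  \<open>Sf\<close> cos = \<open>Cf\<close> sin. Integrating by parts with this weight therefore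
  returns multiples of \<open>Gk m\<close> itself, and the recurrences for the moments
  close.\<close>

lemma dG_cossin: "dG m j x * (cos (pi * x$j) * sin (pi * x$j)) = - 2 * pi * real m * Gk m x * (sin (pi * x$j))\<^sup>2"
proof (cases m)
  case 0 then show ?thesis by (simp add: dG_def)
next
  case (Suc n)
  have "Cf x ^ (2 * m - 1) * (Sf j x * cos (pi * x$j)) = Gk m x * sin (pi * x$j)"
    unfolding Cf_Sf[symmetric] by (simp add: Gk_def Suc)
  then have "Cf x ^ (2 * m - 1) * (Sf j x * cos (pi * x$j)) * sin (pi * x$j) = Gk m x * (sin (pi * x$j))\<^sup>2"
    by (simp add: power2_eq_square)
  then show ?thesis by (simp add: dG_def algebra_simps)
qed

lemma sin_axis_deriv: "((\<lambda>h. sin (pi * (x + h *\<^sub>R axis j 1)$j)) has_real_derivative pi * cos (pi * x$j)) (at 0)"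
  and cos_axis_deriv: "((\<lambda>h. cos (pi * (x + h *\<^sub>R axis j 1)$j)) has_real_derivative - pi * sin (pi * x$j)) (at 0)"
  unfolding axis_shift_nth by (auto intro!: derivative_eq_intros)

text \<open>The derivative of \<open>Gk m\<close> cos sin in direction j is pi (\<open>Gk m\<close>
  - (2m + 2) \<open>Gk m\<close> sin^2), and its mean is zero.\<close>

lemma moment2: "avg (\<lambda>x. Gk m x * (sin (pi * x$j))\<^sup>2) = Zk m / (2 * real m + 2)"
proof -
  let ?s = "\<lambda>x::real^3. sin (pi * x$j)" and ?c = "\<lambda>x::real^3. cos (pi * x$j)"
  have "avg (\<lambda>x. pi * (Gk m x - (2 * real m + 2) * (Gk m x * (?s x)\<^sup>2))) = 0"
  proof (rule integral_cube_deriv_axis[where f="\<lambda>x. Gk m x * (?c x * ?s x)"])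
    show "cper (\<lambda>x. Gk m x * (?c x * ?s x))"
      by (intro cper_mult cper_Gk cper_sincos)
    show "continuous_on UNIV (\<lambda>x. pi * (Gk m x - (2 * real m + 2) * (Gk m x * (?s x)\<^sup>2)))"
      by (intro continuous_intros)
    fix x :: "real^3"
    have e: "dG m j x * (?c x * ?s x) + Gk m x * ((- pi * ?s x) * ?s x + ?c x * (pi * ?c x))
       = pi * (Gk m x - (2 * real m + 2) * (Gk m x * (?s x)\<^sup>2))"
      unfolding dG_cossin using cos_squared_eq[of "pi * x$j"] by algebra
    show "((\<lambda>h. Gk m (x + h *\<^sub>R axis j 1) * (?c (x + h *\<^sub>R axis j 1) * ?s (x + h *\<^sub>R axis j 1)))
       has_real_derivative pi * (Gk m x - (2 * real m + 2) * (Gk m x * (?s x)\<^sup>2))) (at 0)"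
      unfolding e[symmetric]
      by (rule derivative_eq_intros Gk_deriv sin_axis_deriv cos_axis_deriv refl)+ (simp add: algebra_simps)
  qed
  also have "avg (\<lambda>x. pi * (Gk m x - (2 * real m + 2) * (Gk m x * (?s x)\<^sup>2)))
     = pi * (Zk m - (2 * real m + 2) * avg (\<lambda>x. Gk m x * (?s x)\<^sup>2))"
    unfolding Zk_def
    by (subst integral_mult_right, subst integral_diff)
       (auto intro!: integrable_cube continuous_intros)
  finally have "Zk m = (2 * real m + 2) * avg (\<lambda>x. Gk m x * (?s x)\<^sup>2)" by simp
  moreover have "2 * real m + 2 > 0" by simp
  ultimately show ?thesis by (simp add: eq_divide_eq mult.commute)
qed

text \<open>With the weight cos sin^3 the derivative becomes pi (3 \<open>Gk m\<close> sin^2 - (2m +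
  4) \<open>Gk m\<close> sin^4), which reduces the fourth moment to the second.\<close>

lemma moment4: "avg (\<lambda>x. Gk m x * (sin (pi * x$j))^4) = 3 * Zk m / ((2 * real m + 2) * (2 * real m + 4))"
proof -
  let ?s = "\<lambda>x::real^3. sin (pi * x$j)" and ?c = "\<lambda>x::real^3. cos (pi * x$j)"
  have "avg (\<lambda>x. pi * (3 * (Gk m x * (?s x)\<^sup>2) - (2 * real m + 4) * (Gk m x * (?s x)^4))) = 0"
  proof (rule integral_cube_deriv_axis[where f="\<lambda>x. Gk m x * (?c x * ?s x) * (?s x)\<^sup>2"])
    show "cper (\<lambda>x. Gk m x * (?c x * ?s x) * (?s x)\<^sup>2)"
      by (intro cper_mult cper_Gk cper_sincos cper_sin2)
    show "continuous_on UNIV (\<lambda>x. pi * (3 * (Gk m x * (?s x)\<^sup>2) - (2 * real m + 4) * (Gk m x * (?s x)^4)))"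
      by (intro continuous_intros)
    fix x :: "real^3"
    have e: "(dG m j x * (?c x * ?s x)) * (?s x)\<^sup>2 + Gk m x * (((- pi * ?s x) * ?s x + ?c x * (pi * ?c x)) * (?s x)\<^sup>2
         + ?c x * ?s x * (2 * ?s x * (pi * ?c x)))
       = pi * (3 * (Gk m x * (?s x)\<^sup>2) - (2 * real m + 4) * (Gk m x * (?s x)^4))"
      unfolding dG_cossin using cos_squared_eq[of "pi * x$j"] by algebra
    show "((\<lambda>h. Gk m (x + h *\<^sub>R axis j 1) * (?c (x + h *\<^sub>R axis j 1) * ?s (x + h *\<^sub>R axis j 1)) * (?s (x + h *\<^sub>R axis j 1))\<^sup>2)
       has_real_derivative pi * (3 * (Gk m x * (?s x)\<^sup>2) - (2 * real m + 4) * (Gk m x * (?s x)^4))) (at 0)"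
      unfolding e[symmetric]
      by (rule derivative_eq_intros Gk_deriv sin_axis_deriv cos_axis_deriv refl)+ (simp add: algebra_simps)
  qed
  also have "avg (\<lambda>x. pi * (3 * (Gk m x * (?s x)\<^sup>2) - (2 * real m + 4) * (Gk m x * (?s x)^4)))
     = pi * (3 * (Zk m / (2 * real m + 2)) - (2 * real m + 4) * avg (\<lambda>x. Gk m x * (?s x)^4))"
    unfolding moment2[of m j, symmetric]
    by (subst integral_mult_right, subst integral_diff)
       (auto intro!: integrable_cube continuous_intros)
  finally have "3 * (Zk m / (2 * real m + 2)) = (2 * real m + 4) * avg (\<lambda>x. Gk m x * (?s x)^4)" by simp
  moreover have "2 * real m + 2 > 0" "2 * real m + 4 > 0" by simp_all
  ultimately show ?thesis by (simp add: eq_divide_eq divide_simps) (simp add: algebra_simps)?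
qed

lemma Zk_pos: "Zk m > 0"
proof -
  have "0 \<le> Zk m" unfolding Zk_def by (intro integral_nonneg integrable_cube continuous_intros) auto
  moreover have "Zk m \<noteq> 0"
  proof
    assume z: "Zk m = 0"
    have "Gk m x = 0" if "x \<in> cbox 0 One" for x
    proof (rule has_integral_0_cbox_imp_0[OF _ _ _ _ that])
      show "continuous_on (cbox 0 One) (Gk m)"
        by (intro continuous_intros continuous_on_subset[OF continuous_on_id])
      have "Gk m integrable_on cube" by (intro integrable_cube continuous_intros continuous_on_subset[OF continuous_on_id])
      then show "(Gk m has_integral 0) (cbox 0 One)"
        using z integrable_integral[of "Gk m" cube] unfolding Zk_def cube_def by metis
      show "box 0 (One::real^3) \<noteq> {}" by (simp add: box_ne_empty)
    qed (auto simp: Gk_def)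
    from this[of 0] show False by (auto simp: Gk_def Cf_def mem_box_cart)
  qed
  ultimately show ?thesis by linarith
qed

text \<open>The quotient of \<open>Gk (Suc m)\<close> by \<open>Gk m\<close> is a product of three
  factors 1 - sin^2, at least 1 - \<open>sin_sq\<close>. By the second moment the masses then
  decrease at most by the factor 1 - 3/(2m + 2), which is at least 1/4 for m \<ge> 1.\<close>

lemma Zk_ratio: assumes "m \<ge> 1" shows "Zk m \<le> 4 * Zk (Suc m)"
proof -
  have p: "(1 - a) * (1 - b) * (1 - c) \<ge> 1 - (a + b + c)" if "0 \<le> a" "a \<le> 1" "0 \<le> b" "b \<le> 1" "0 \<le> c" "c \<le> 1" for a b c :: real
  proof -
    have "(1 - a) * (1 - b) \<ge> 1 - (a + b)" using that by (simp add: algebra_simps)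
    then have "(1 - a) * (1 - b) * (1 - c) \<ge> (1 - (a + b)) * (1 - c)" using that by (intro mult_right_mono) auto
    moreover have "(1 - (a + b)) * (1 - c) \<ge> 1 - (a + b + c)" using that by (simp add: algebra_simps)
    ultimately show ?thesis by linarith
  qed
  have "Gk m x - (Gk m x * (sin (pi * x$1))\<^sup>2 + Gk m x * (sin (pi * x$2))\<^sup>2 + Gk m x * (sin (pi * x$3))\<^sup>2) \<le> Gk (Suc m) x" for x
  proof -
    have "Gk (Suc m) x = Gk m x * ((1 - (sin (pi * x$1))\<^sup>2) * (1 - (sin (pi * x$2))\<^sup>2) * (1 - (sin (pi * x$3))\<^sup>2))"
      unfolding cos_squared_eq[symmetric] by (simp add: Gk_def Cf_def power_mult_distrib mult_ac power2_eq_square)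
    moreover have "\<dots> \<ge> Gk m x * (1 - ((sin (pi * x$1))\<^sup>2 + (sin (pi * x$2))\<^sup>2 + (sin (pi * x$3))\<^sup>2))"
      by (intro mult_left_mono p) (auto simp: power2_eq_1_iff abs_square_le_1)
    ultimately show ?thesis by (simp add: algebra_simps)
  qed
  then have "avg (\<lambda>x. Gk m x - (Gk m x * (sin (pi * x$1))\<^sup>2 + Gk m x * (sin (pi * x$2))\<^sup>2 + Gk m x * (sin (pi * x$3))\<^sup>2)) \<le> Zk (Suc m)"
    unfolding Zk_def by (intro integral_le integrable_cube continuous_intros) auto
  moreover have "avg (\<lambda>x. Gk m x - (Gk m x * (sin (pi * x$1))\<^sup>2 + Gk m x * (sin (pi * x$2))\<^sup>2 + Gk m x * (sin (pi * x$3))\<^sup>2))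
    = Zk m - 3 * (Zk m / (2 * real m + 2))"
    by (subst integral_diff integral_add | intro integrable_cube continuous_intros | simp add: moment2 Zk_def[symmetric])+
  moreover have "Zk m - 3 * (Zk m / (2 * real m + 2)) \<ge> Zk m / 4"
    using assms Zk_pos[of m] by (simp add: field_simps)
  ultimately show ?thesis by linarith
qed

section \<open>The normalised kernel and its gradient\<close>

definition ker :: "nat \<Rightarrow> real^3 \<Rightarrow> real" where "ker m x = Gk m x / Zk m"
definition dker :: "nat \<Rightarrow> 3 \<Rightarrow> real^3 \<Rightarrow> real" where "dker m j x = dG m j x / Zk m"

lemma Zk_nonzero [simp]: "Zk m \<noteq> 0" using Zk_pos[of m] by simp

lemma ker_nonneg [simp]: "0 \<le> ker m x"
  using Zk_pos[of m] by (simp add: ker_def)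

lemma continuous_on_ker [continuous_intros]: "continuous_on (S::'a::t2_space set) f \<Longrightarrow> continuous_on S (\<lambda>x. ker m (f x))"
  unfolding ker_def by (intro continuous_intros) auto

lemma continuous_on_dker [continuous_intros]: "continuous_on (S::'a::t2_space set) f \<Longrightarrow> continuous_on S (\<lambda>x. dker m j (f x))"
  unfolding dker_def by (intro continuous_intros) auto

lemma cper_ker: "cper (ker m)"
  using cper_Gk[of m] by (auto simp: cper_def periodic3_def ker_def intro!: continuous_intros)

lemma cper_dker: "cper (dker m j)"
  using cper_dG[of m j] by (auto simp: cper_def periodic3_def dker_def intro!: continuous_intros)

lemma ker_trig_poly: "trig_poly (\<lambda>x. complex_of_real (ker m x))"
  using trig_poly_mult[OF trig_poly_const[of "1 / complex_of_real (Zk m)"] Gk_trig_poly[of m]] by (simp add: ker_def)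

lemma integral_ker [simp]: "avg (ker m) = 1"
  unfolding ker_def by (simp add: Zk_def[symmetric])

lemma ker_minus: "ker m (- x) = ker m x"
  by (simp add: ker_def Gk_def Cf_def)

lemma dker_minus: "dker m j (- x) = - dker m j x"
  by (simp add: dker_def dG_def Cf_def Sf_def)

lemma ker_deriv: "((\<lambda>h. ker m (x + h *\<^sub>R axis j 1)) has_real_derivative dker m j (x + h *\<^sub>R axis j 1)) (at h)"
proof -
  have "((\<lambda>u. Gk m ((x + h *\<^sub>R axis j 1) + u *\<^sub>R axis j 1)) has_real_derivative dG m j (x + h *\<^sub>R axis j 1)) (at (h + - h))"
    using Gk_deriv[of m "x + h *\<^sub>R axis j 1" j] by simp
  then have "((\<lambda>u. Gk m ((x + h *\<^sub>R axis j 1) + (u + - h) *\<^sub>R axis j 1)) has_real_derivative dG m j (x + h *\<^sub>R axis j 1)) (at h)"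
    unfolding DERIV_shift .
  then show ?thesis
    unfolding ker_def dker_def by (intro DERIV_cdivide) (simp add: algebra_simps)
qed

lemma integral_dker: "avg (dker m j) = 0"
  using integral_cube_deriv_axis[OF cper_ker[of m] cper_cont[OF cper_dker[of m j]], of j] ker_deriv[of m _ j 0]
  by simp

lemma sin_sq_nonneg [simp]: "0 \<le> sin_sq x" by (simp add: sin_sq_def sum_nonneg)

text \<open>The variance is of order 1/m: the kernel concentrates at scale m^(-1/2).\<close>

lemma ker_moment_sin_sq: "avg (\<lambda>x. ker m x * sin_sq x) = 3 / (2 * real m + 2)"
proof -
  have "avg (\<lambda>x. ker m x * sin_sq x) = avg (\<lambda>x. (1 / Zk m) * (\<Sum>i\<in>UNIV. Gk m x * (sin (pi * x$i))\<^sup>2))"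
    by (simp add: ker_def sin_sq_def sum_distrib_left[symmetric] sum_divide_distrib[symmetric])
  also have "\<dots> = (1 / Zk m) * (\<Sum>i\<in>UNIV. avg (\<lambda>x. Gk m x * (sin (pi * x$i))\<^sup>2))"
    by (subst integral_mult_right, subst integral_sum) (auto intro!: integrable_cube continuous_intros)
  also have "\<dots> = 3 / (2 * real m + 2)" by (simp add: moment2)
  finally show ?thesis .
qed

text \<open>The 27 is 3 * 3 * 3: one factor from (a + b + c)^2 \<le> 3 (a^2 + b^2 + c^2), one from
  the three axes, one from \<open>moment4\<close>.\<close>

lemma ker_moment_sq2: "avg (\<lambda>x. ker m x * (sin_sq x)\<^sup>2) \<le> 27 / ((2 * real m + 2) * (2 * real m + 4))"
proof -
  have "avg (\<lambda>x. ker m x * (sin_sq x)\<^sup>2) \<le> avg (\<lambda>x. (3 / Zk m) * (\<Sum>i\<in>UNIV. Gk m x * (sin (pi * x$i))^4))"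
  proof (intro integral_le integrable_cube continuous_intros)
    fix x :: "real^3"
    have "(a + b + c)\<^sup>2 \<le> 3 * (a\<^sup>2 + b\<^sup>2 + c\<^sup>2)" for a b c :: real
      using sum_squares_ge_zero[of "a - b" "b - c"] zero_le_power2[of "a - c"] by (simp add: power2_eq_square algebra_simps)
    from this[of "(sin (pi * x$1))\<^sup>2" "(sin (pi * x$2))\<^sup>2" "(sin (pi * x$3))\<^sup>2"]
    have "(sin_sq x)\<^sup>2 \<le> 3 * (\<Sum>i\<in>UNIV. (sin (pi * x$i))^4)"
      by (simp add: sin_sq_def sum_3 flip: power_mult)
    then have "ker m x * (sin_sq x)\<^sup>2 \<le> ker m x * (3 * (\<Sum>i\<in>UNIV. (sin (pi * x$i))^4))"
      by (intro mult_left_mono) auto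
    then show "ker m x * (sin_sq x)\<^sup>2 \<le> (3 / Zk m) * (\<Sum>i\<in>UNIV. Gk m x * (sin (pi * x$i))^4)"
      by (simp add: ker_def sum_distrib_left[symmetric] mult_ac)
  qed
  also have "\<dots> = (3 / Zk m) * (\<Sum>i\<in>UNIV. avg (\<lambda>x. Gk m x * (sin (pi * x$i))^4))"
    by (subst integral_mult_right, subst integral_sum) (auto intro!: integrable_cube continuous_intros)
  also have "\<dots> = 27 / ((2 * real m + 2) * (2 * real m + 4))" by (simp add: moment4)
  finally show ?thesis .
qed

lemma abs_sin_le_sqrt_sin_sq: "\<bar>sin (pi * x$j)\<bar> \<le> sqrt (sin_sq x)"
proof -
  have "(sin (pi * x$j))\<^sup>2 \<le> sin_sq x" unfolding sin_sq_def
    by (rule member_le_sum) auto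
  then show ?thesis by (simp add: real_le_rsqrt)
qed

lemma abs_Sf_le: "\<bar>Sf j x\<bar> \<le> sqrt (sin_sq x)"
proof -
  have "\<bar>Sf j x\<bar> = \<bar>sin (pi * x$j)\<bar> * (\<Prod>i\<in>UNIV-{j}. \<bar>cos (pi * x$i)\<bar>)"
    by (simp add: Sf_def abs_mult abs_prod)
  also have "\<dots> \<le> \<bar>sin (pi * x$j)\<bar> * 1"
    by (intro mult_left_mono prod_le_1) auto
  finally show ?thesis using abs_sin_le_sqrt_sin_sq[of x j] by linarith
qed

lemma abs_Cf_le: "\<bar>Cf x\<bar> \<le> 1"
  unfolding Cf_def abs_mult by (intro mult_le_one) auto

text \<open>The gradient of order m + 1 contains \<open>Cf\<close> to the power 2m + 1, at most
  \<open>Gk m\<close> in modulus, and \<open>Sf\<close>, at most the distance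
  sqrt(\<open>sin_sq\<close>). Passing to the normalisation of order m costs the 4 of
  \<open>Zk_ratio\<close>. Thus distance times gradient is dominated by m + 1 times the variance
  density, whose mean is of order 1/m.\<close>

lemma dker_bound:
  assumes "m \<ge> 1"
  shows "\<bar>dker (Suc m) j x\<bar> * sqrt (sin_sq x) \<le> 8 * pi * real (Suc m) * (ker m x * sin_sq x)"
proof -
  have "\<bar>dG (Suc m) j x\<bar> = 2 * pi * real (Suc m) * (\<bar>Cf x\<bar> ^ (2 * m + 1) * \<bar>Sf j x\<bar>)"
    by (simp add: dG_def abs_mult power_abs)
  also have "\<dots> \<le> 2 * pi * real (Suc m) * (Gk m x * sqrt (sin_sq x))"
  proof (intro mult_left_mono mult_mono)
    show "\<bar>Cf x\<bar> ^ (2 * m + 1) \<le> Gk m x"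
      using abs_Cf_le[of x] power_decreasing[of "2*m" "2*m+1" "\<bar>Cf x\<bar>"] by (simp add: Gk_def power_mult)
  qed (auto simp: abs_Sf_le)
  finally have 1: "\<bar>dG (Suc m) j x\<bar> * sqrt (sin_sq x) \<le> 2 * pi * real (Suc m) * (Gk m x * sqrt (sin_sq x)) * sqrt (sin_sq x)"
    by (intro mult_right_mono) auto
  have "\<bar>dker (Suc m) j x\<bar> * sqrt (sin_sq x) = \<bar>dG (Suc m) j x\<bar> * sqrt (sin_sq x) / Zk (Suc m)"
    using Zk_pos[of "Suc m"] by (simp add: dker_def)
  also have "\<dots> \<le> (2 * pi * real (Suc m) * (Gk m x * sqrt (sin_sq x)) * sqrt (sin_sq x)) / Zk (Suc m)"
    using 1 Zk_pos[of "Suc m"] by (intro divide_right_mono) auto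
  also have "\<dots> = 2 * pi * real (Suc m) * (Gk m x * sin_sq x) * (1 / Zk (Suc m))"
    by (simp add: mult.assoc)
  also have "\<dots> \<le> 2 * pi * real (Suc m) * (Gk m x * sin_sq x) * (4 / Zk m)"
    using Zk_ratio[OF assms] Zk_pos[of m] Zk_pos[of "Suc m"]
    by (intro mult_left_mono) (auto simp: field_simps)
  also have "\<dots> = 8 * pi * real (Suc m) * (ker m x * sin_sq x)"
    by (simp add: ker_def)
  finally show ?thesis .
qed

text \<open>From 3 < pi < 4 the argument x = pi t lies in [0, 2], where Taylor gives sin x \<ge> x -
  x^3/6 \<ge> x/3, and x/3 \<ge> t. Oddness covers negative t.\<close>

lemma abs_le_abs_sin_pi:
  assumes "\<bar>t\<bar> \<le> 1/2" shows "\<bar>t\<bar> \<le> \<bar>sin (pi * t)\<bar>"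
proof -
  have p: "3 < pi" "pi < 4" using pi_approx by auto
  have *: "t \<le> sin (pi * t)" if t: "0 \<le> t" "t \<le> 1/2" for t
  proof -
    let ?x = "pi * t"
    have x: "0 \<le> ?x" "?x \<le> 2" using t p mult_mono[of pi 4 t "1/2"] by auto
    have "\<bar>sin ?x - (\<Sum>m<3. sin_coeff m * ?x ^ m)\<bar> \<le> inverse (fact 3) * \<bar>?x\<bar> ^ 3"
      by (rule Maclaurin_sin_bound)
    then have "\<bar>sin ?x - ?x\<bar> \<le> ?x ^ 3 / 6"
      using x by (simp add: eval_nat_numeral sin_coeff_def fact_numeral)
    moreover have "?x ^ 3 \<le> 4 * ?x"
      using x mult_mono[of ?x 2 ?x 2] mult_right_mono[of "?x * ?x" 4 ?x] by (simp add: power3_eq_cube)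
    ultimately have "sin ?x \<ge> ?x / 3" by linarith
    moreover have "?x / 3 \<ge> t" using t p mult_right_mono[of 3 pi t] by simp
    ultimately show ?thesis by linarith
  qed
  show ?thesis
    using *[of t] *[of "-t"] assms by (cases "t \<ge> 0") auto
qed

text \<open>sin_sq is a smooth periodic substitute for the squared distance to the lattice.\<close>

lemma nearest_lattice:
  obtains k where "k \<in> Zvecs" "norm (z - k) \<le> sqrt (sin_sq z)" "norm (z - k) \<le> 2"
proof -
  define k :: "real^3" where "k = (\<chi> i. of_int (round (z $ i)))"
  have k: "k \<in> Zvecs" by (auto simp: Zvecs_def k_def)
  have le: "\<bar>(z - k) $ i\<bar> \<le> 1/2" for i
    using of_int_round_abs_le[of "z $ i"] by (simp add: k_def abs_minus_commute)
  have "\<bar>sin (pi * (z - k) $ i)\<bar> = \<bar>sin (pi * z $ i)\<bar>" for i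
    by (simp add: k_def right_diff_distrib sin_diff abs_mult)
       (simp add: mult.commute abs_mult sin_integer_2pi)?
  then have "((z - k) $ i)\<^sup>2 \<le> (sin (pi * z $ i))\<^sup>2" for i
    using abs_le_abs_sin_pi[OF le[of i]] by (metis abs_le_square_iff)
  then have "(norm (z - k))\<^sup>2 \<le> sin_sq z"
    unfolding norm_vec_def L2_set_def sin_sq_def
    by (simp add: sum_nonneg sum_mono)
  then have 1: "norm (z - k) \<le> sqrt (sin_sq z)" by (simp add: real_le_rsqrt)
  have "norm (z - k) \<le> (\<Sum>i\<in>UNIV. \<bar>(z - k) $ i\<bar>)" by (rule norm_le_l1_cart)
  also have "\<dots> \<le> 2" using le[of 1] le[of 2] le[of 3] by (simp add: sum_3)
  finally show ?thesis using 1 k that by blast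
qed

text \<open>An additive form of uniform continuity, valid for all z, which can be integrated against
  the kernel without splitting the domain. Where sqrt(\<open>sin_sq z\<close>) \<ge> d, the
  coefficient 2B/d^2 makes the second term at least the trivial bound 2B.\<close>

lemma cper_modulus:
  fixes u :: "real^3 \<Rightarrow> 'b::real_normed_vector"
  assumes u: "cper u" and e: "e > 0"
  obtains M where "M \<ge> 0" "\<And>x z. norm (u (x + z) - u x) \<le> e + M * sin_sq z"
proof -
  obtain B where B: "B > 0" "\<And>x. norm (u x) \<le> B" using cper_bounded[OF u] by blast
  \<comment> \<open>Modulo the lattice the two points have norm at most 3 and 3 + 2, well inside
    this ball.\<close>
  have "uniformly_continuous_on (cball 0 10) u"
    by (intro compact_uniformly_continuous continuous_on_subset[OF cper_cont[OF u]]) auto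
  then obtain d where d: "d > 0" "\<And>x y. x \<in> cball 0 10 \<Longrightarrow> y \<in> cball 0 10 \<Longrightarrow> dist y x < d \<Longrightarrow> dist (u y) (u x) < e"
    unfolding uniformly_continuous_on_def using e by metis
  have per: "u (x - k) = u x" if "k \<in> Zvecs" for x k
    using u that unfolding cper_def periodic3_def by (metis diff_add_cancel)
  have "norm (u (x + z) - u x) \<le> e + (2 * B / d\<^sup>2) * sin_sq z" for x z
  proof -
    obtain k where k: "k \<in> Zvecs" "norm (z - k) \<le> sqrt (sin_sq z)" "norm (z - k) \<le> 2" by (rule nearest_lattice)
    obtain l where l: "l \<in> Zvecs" "x - l \<in> cube" by (rule periodic_in_cube)
    have nx: "norm (x - l) \<le> 3"
      using norm_le_l1_cart[of "x - l"] l(2) by (simp add: sum_3 mem_cube) (smt (verit))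
    show ?thesis
    proof (cases "sqrt (sin_sq z) < d")
      case True
      have "dist (u (x - l + (z - k))) (u (x - l)) < e"
        using nx k True norm_triangle_ineq[of "x - l" "z - k"] by (intro d) (simp_all only: mem_cball_0 dist_norm, simp_all)
      moreover have "u (x - l + (z - k)) = u (x + z)"
        using per[OF Zvecs_add[OF l(1) k(1)], of "x + z"] by (simp add: algebra_simps)
      ultimately have "norm (u (x + z) - u x) < e" using per[OF l(1), of x] by (simp add: dist_norm)
      moreover have "0 \<le> (2 * B / d\<^sup>2) * sin_sq z" using B by simp
      ultimately show ?thesis by linarith
    next
      case False
      then have "d\<^sup>2 \<le> sin_sq z" using d by (metis abs_of_pos linorder_not_le real_sqrt_abs real_sqrt_le_iff)
      then have "2 * B \<le> (2 * B / d\<^sup>2) * sin_sq z"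
        using B d by (simp add: pos_le_divide_eq)
      moreover have "norm (u (x + z) - u x) \<le> 2 * B"
        using B(2)[of "x + z"] B(2)[of x] norm_triangle_ineq4[of "u (x+z)" "u x"] by linarith
      ultimately show ?thesis using e by linarith
    qed
  qed
  then show ?thesis using that[of "2 * B / d\<^sup>2"] B by auto
qed

section \<open>Convolution with the kernel as an approximate identity\<close>

definition conv :: "(real^3 \<Rightarrow> real) \<Rightarrow> (real^3 \<Rightarrow> 'b::banach) \<Rightarrow> real^3 \<Rightarrow> 'b" where
  "conv K u x = avg (\<lambda>y. K (x - y) *\<^sub>R u y)"

text \<open>Evenness of the kernel and translation by x. In this form differences of u at x + z and
  x can be estimated under the integral.\<close>

lemma conv_ker_shift:
  fixes u :: "real^3 \<Rightarrow> 'b::banach"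
  assumes u: "cper u"
  shows "conv (ker m) u x = avg (\<lambda>z. ker m z *\<^sub>R u (x + z))"
proof -
  have p: "ker m (y + k - x) = ker m (y - x)" if "k \<in> Zvecs" for y k
    using cper_ker[of m] that unfolding cper_def periodic3_def by (metis add_diff_eq add.commute)
  have c: "cper (\<lambda>y. ker m (y - x) *\<^sub>R u y)"
    using u by (auto simp: cper_def periodic3_def p intro!: continuous_intros)
  have "conv (ker m) u x = avg (\<lambda>y. ker m (y - x) *\<^sub>R u y)"
    unfolding conv_def using ker_minus[of m] by (metis minus_diff_eq)
  also have "\<dots> = avg (\<lambda>z. ker m (z + x - x) *\<^sub>R u (z + x))"
    by (rule integral_cube_shift[OF c, symmetric])
  finally show ?thesis by (simp add: add.commute)
qed

lemma norm_integral_ker_le: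
  fixes g :: "real^3 \<Rightarrow> 'b::banach"
  assumes g: "continuous_on UNIV g" and h: "continuous_on UNIV h" and le: "\<And>z. norm (g z) \<le> h z"
  shows "norm (avg (\<lambda>z. ker m z *\<^sub>R g z)) \<le> avg (\<lambda>z. ker m z * h z)"
  by (rule integral_norm_bound_integral)
     (auto intro!: integrable_cube continuous_intros g h mult_left_mono le)

lemma norm_conv_ker_le:
  fixes u :: "real^3 \<Rightarrow> 'b::banach"
  assumes u: "cper u" and M: "\<And>x. norm (u x) \<le> M"
  shows "norm (conv (ker m) u x) \<le> M"
proof -
  have "norm (conv (ker m) u x) \<le> avg (\<lambda>z. ker m z * M)"
    unfolding conv_ker_shift[OF u]
    by (intro norm_integral_ker_le cont_UNIV_compose[OF cper_cont[OF u]] continuous_intros M)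
  then show ?thesis by simp
qed

text \<open>The additive modulus is averaged against the kernel: unit mass keeps the constant e/2,
  and the variance makes the remaining term decay like 1/m.\<close>

lemma conv_ker_uniform_limit:
  fixes u :: "real^3 \<Rightarrow> 'b::banach"
  assumes u: "cper u"
  shows "uniform_limit UNIV (\<lambda>m. conv (ker m) u) u sequentially"
  unfolding uniform_limit_iff
proof (intro allI impI)
  fix e :: real assume e: "e > 0"
  then obtain M where M: "M \<ge> 0" "\<And>x z. norm (u (x + z) - u x) \<le> e/2 + M * sin_sq z"
    using cper_modulus[OF u, of "e/2"] by auto
  have b: "norm (conv (ker m) u x - u x) \<le> e/2 + M * (3 / (2 * real m + 2))" for m x
  proof -
    have "conv (ker m) u x - u x = avg (\<lambda>z. ker m z *\<^sub>R (u (x + z) - u x))"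
    proof -
      have "avg (\<lambda>z. ker m z *\<^sub>R (u (x + z) - u x)) = avg (\<lambda>z. ker m z *\<^sub>R u (x + z) - ker m z *\<^sub>R u x)"
        by (simp add: scaleR_right_diff_distrib)
      also have "\<dots> = avg (\<lambda>z. ker m z *\<^sub>R u (x + z)) - avg (\<lambda>z. ker m z *\<^sub>R u x)"
        by (intro integral_diff integrable_cube continuous_intros cont_UNIV_compose[OF cper_cont[OF u]])
      also have "avg (\<lambda>z. ker m z *\<^sub>R u x) = u x"
        using integral_linear[of "ker m" cube "\<lambda>r. r *\<^sub>R u x"] integrable_cube[OF cper_cont[OF cper_ker[of m]]]
        by (simp add: o_def bounded_linear_scaleR_left)
      finally show ?thesis by (simp add: conv_ker_shift[OF u])
    qed
    also have "norm \<dots> \<le> avg (\<lambda>z. ker m z * (e/2 + M * sin_sq z))"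
      by (intro norm_integral_ker_le cont_UNIV_compose[OF cper_cont[OF u]] continuous_intros M)
    also have "\<dots> = avg (\<lambda>z. e/2 * ker m z + M * (ker m z * sin_sq z))"
      by (simp add: algebra_simps)
    also have "\<dots> = e/2 * avg (ker m) + M * avg (\<lambda>z. ker m z * sin_sq z)"
      by (subst integral_add) (auto intro!: integrable_cube continuous_intros)
    also have "\<dots> = e/2 + M * (3 / (2 * real m + 2))" by (simp add: ker_moment_sin_sq)
    finally show ?thesis .
  qed
  have "(\<lambda>m. 3 / (2 * real m + 2)) \<longlonglongrightarrow> 0"
    using tendsto_mult_right_zero[OF LIMSEQ_inverse_real_of_nat, of "3/2"]
    by (simp add: field_simps)
  then have "(\<lambda>m. e/2 + M * (3 / (2 * real m + 2))) \<longlonglongrightarrow> e/2 + M * 0"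
    by (intro tendsto_intros)
  then have "\<forall>\<^sub>F m in sequentially. e/2 + M * (3 / (2 * real m + 2)) < e"
    using e by (intro order_tendstoD(2)[of _ "e/2"]) auto
  then show "\<forall>\<^sub>F m in sequentially. \<forall>x\<in>UNIV. dist (conv (ker m) u x) (u x) < e"
    by eventually_elim (use b in \<open>auto simp: dist_norm intro: le_less_trans\<close>)
qed

section \<open>Smooth functions and test functions\<close>

text \<open>Coinduction up to algebra closure: a set of functions is smooth as soon as its partial derivatives
  lie in the algebra that it generates.\<close>

inductive alg_gen :: "('a \<Rightarrow> real) set \<Rightarrow> ('a \<Rightarrow> real) \<Rightarrow> bool" for B where
  alg_base: "f \<in> B \<Longrightarrow> alg_gen B f"
| alg_const: "alg_gen B (\<lambda>x. c)"
| alg_add: "alg_gen B f \<Longrightarrow> alg_gen B g \<Longrightarrow> alg_gen B (\<lambda>x. f x + g x)"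
| alg_mult: "alg_gen B f \<Longrightarrow> alg_gen B g \<Longrightarrow> alg_gen B (\<lambda>x. f x * g x)"

lemma alg_sum: "finite I \<Longrightarrow> (\<And>i. i \<in> I \<Longrightarrow> alg_gen B (f i)) \<Longrightarrow> alg_gen B (\<lambda>x. \<Sum>i\<in>I. f i x)"
  by (induction I rule: finite_induct) (auto intro: alg_const alg_add)

lemma smooth_fun_differentiable: "smooth_fun f \<Longrightarrow> f differentiable (at x)"
  by (auto elim: smooth_fun.cases)

lemma smooth_fun_partial: "smooth_fun f \<Longrightarrow> b \<in> Basis \<Longrightarrow> smooth_fun (\<lambda>x. frechet_derivative f (at x) b)"
  by (auto elim: smooth_fun.cases)

lemma smooth_fun_has_derivative: "smooth_fun f \<Longrightarrow> (f has_derivative frechet_derivative f (at x)) (at x)"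
  using smooth_fun_differentiable[of f x] by (simp add: frechet_derivative_works)

text \<open>The coinduction invariant is membership in the generated algebra: by the sum and product
  rules, what holds for the partial derivatives of the generators holds for those of every
  element.\<close>

lemma smooth_fun_alg:
  fixes B :: "('a::euclidean_space \<Rightarrow> real) set"
  assumes B: "\<And>f x. f \<in> B \<Longrightarrow> f differentiable (at x)"
    and B': "\<And>f b. f \<in> B \<Longrightarrow> b \<in> Basis \<Longrightarrow> alg_gen B (\<lambda>x. frechet_derivative f (at x) b)"
    and f: "alg_gen B f"
  shows "smooth_fun f"
proof -
  have step: "(\<forall>x. f differentiable (at x)) \<and> (\<forall>b\<in>Basis. alg_gen B (\<lambda>x. frechet_derivative f (at x) b))"
    if "alg_gen B f" for f
    using that
  proof (induction rule: alg_gen.induct)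
    case (alg_base f)
    then show ?case using B B' by blast
  next
    case (alg_const c)
    then show ?case by (auto intro: alg_gen.alg_const simp: frechet_derivative_const)
  next
    case (alg_add f g)
    then have d: "f differentiable (at x)" "g differentiable (at x)" for x by auto
    have "frechet_derivative (\<lambda>x. f x + g x) (at x) = (\<lambda>b. frechet_derivative f (at x) b + frechet_derivative g (at x) b)" for x
      using d[of x] by (intro frechet_derivative_at[symmetric] has_derivative_add) (auto simp: frechet_derivative_works)
    then show ?case using alg_add by (auto intro: alg_gen.alg_add)
  next
    case (alg_mult f g)
    then have d: "f differentiable (at x)" "g differentiable (at x)" for x by auto
    have "frechet_derivative (\<lambda>x. f x * g x) (at x) = (\<lambda>b. f x * frechet_derivative g (at x) b + frechet_derivative f (at x) b * g x)" for x
      using d[of x] by (intro frechet_derivative_at[symmetric] has_derivative_mult) (auto simp: frechet_derivative_works)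
    then show ?case using alg_mult d by (auto intro!: alg_gen.alg_add[of B "\<lambda>x. f x * _ x"] intro: alg_gen.alg_mult)
  qed
  show ?thesis using f
    by (coinduction arbitrary: f rule: smooth_fun.coinduct) (use step in blast)
qed

lemma alg_smooth: "alg_gen {f. smooth_fun f} f \<Longrightarrow> smooth_fun f"
  by (rule smooth_fun_alg) (auto intro: smooth_fun_differentiable alg_base smooth_fun_partial)

lemma smooth_fun_const: "smooth_fun (\<lambda>x. c)"
  by (intro alg_smooth alg_const)

lemma smooth_fun_add: "smooth_fun f \<Longrightarrow> smooth_fun g \<Longrightarrow> smooth_fun (\<lambda>x. f x + g x)"
  by (intro alg_smooth alg_add alg_base) auto

lemma smooth_fun_mult: "smooth_fun f \<Longrightarrow> smooth_fun g \<Longrightarrow> smooth_fun (\<lambda>x. f x * g x)"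
  by (intro alg_smooth alg_mult alg_base) auto

lemma smooth_fun_power: "smooth_fun f \<Longrightarrow> smooth_fun (\<lambda>x. f x ^ n)"
  by (induction n) (auto intro: smooth_fun_const smooth_fun_mult)

text \<open>By the chain rule the partial derivatives of f(Lx + c) are combinations, with constant
  coefficients, of partial derivatives of f at Lx + c, so such compositions form a suitable
  generating set.\<close>

lemma smooth_fun_affine:
  fixes f :: "'b::euclidean_space \<Rightarrow> real" and L :: "'a::euclidean_space \<Rightarrow> 'b"
  assumes f: "smooth_fun f" and L: "linear L"
  shows "smooth_fun (\<lambda>x. f (L x + c))"
proof -
  let ?B = "{\<lambda>x. f (L x + c) | f. smooth_fun f}"
  have d: "((\<lambda>x. f (L x + c)) has_derivative (\<lambda>b. frechet_derivative f (at (L x + c)) (L b))) (at x)"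
    if "smooth_fun f" for f x
  proof -
    have "((\<lambda>x. L x + c) has_derivative L) (at x)"
      using L by (auto intro!: derivative_eq_intros linear_imp_has_derivative)
    then show ?thesis using smooth_fun_has_derivative[OF that, of "L x + c"]
      by (rule has_derivative_compose)
  qed
  show ?thesis
  proof (rule smooth_fun_alg[of ?B])
    show "alg_gen ?B (\<lambda>x. f (L x + c))" using f by (intro alg_base) auto
    fix g assume "g \<in> ?B"
    then obtain f where f: "smooth_fun f" and g: "g = (\<lambda>x. f (L x + c))" by auto
    show "g differentiable (at x)" for x
      using d[OF f] unfolding g differentiable_def by blast
    fix b :: 'a
    have "frechet_derivative g (at x) b = (\<Sum>i\<in>Basis. (L b \<bullet> i) * frechet_derivative f (at (L x + c)) i)" for x
    proof -
      have lin: "linear (frechet_derivative f (at (L x + c)))"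
        by (rule has_derivative_linear[OF smooth_fun_has_derivative[OF f]])
      have "frechet_derivative g (at x) b = frechet_derivative f (at (L x + c)) (L b)"
        unfolding g by (simp flip: frechet_derivative_at[OF d[OF f, of x]])
      also have "\<dots> = frechet_derivative f (at (L x + c)) (\<Sum>i\<in>Basis. (L b \<bullet> i) *\<^sub>R i)"
        by (simp add: euclidean_representation)
      also have "\<dots> = (\<Sum>i\<in>Basis. (L b \<bullet> i) * frechet_derivative f (at (L x + c)) i)"
        by (simp add: linear_sum[OF lin] linear_scale[OF lin])
      finally show ?thesis .
    qed
    moreover have "alg_gen ?B (\<lambda>x. \<Sum>i\<in>Basis. (L b \<bullet> i) * frechet_derivative f (at (L x + c)) i)"
      by (intro alg_sum alg_mult alg_const alg_base) (auto intro!: smooth_fun_partial f exI[of _ "\<lambda>x. frechet_derivative f (at x) _"])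
    ultimately show "alg_gen ?B (\<lambda>x. frechet_derivative g (at x) b)" by simp
  qed
qed

text \<open>Differentiation shifts the phase by pi/2, so the cosines with all phases b form a family
  closed up to constant factors.\<close>

lemma smooth_fun_cos:
  fixes a :: "'a::euclidean_space"
  shows "smooth_fun (\<lambda>x. cos (a \<bullet> x + b))"
proof (rule smooth_fun_alg[of "{\<lambda>x. cos (a \<bullet> x + b) | b. True}"])
  let ?B = "{\<lambda>x. cos (a \<bullet> x + b) | b. True}"
  show "alg_gen ?B (\<lambda>x. cos (a \<bullet> x + b))" by (intro alg_base) auto
  fix g assume "g \<in> ?B"
  then obtain b where g: "g = (\<lambda>x. cos (a \<bullet> x + b))" by auto
  have d: "(g has_derivative (\<lambda>i. (a \<bullet> i) * cos (a \<bullet> x + (b + pi/2)))) (at x)" for x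
  proof -
    have "cos (a \<bullet> x + (b + pi/2)) = - sin (a \<bullet> x + b)"
      using minus_sin_cos_eq[of "a \<bullet> x + b"] by (simp add: add.assoc)
    then show ?thesis unfolding g by (auto intro!: derivative_eq_intros)
  qed
  show "g differentiable (at x)" for x using d differentiable_def by blast
  show "alg_gen ?B (\<lambda>x. frechet_derivative g (at x) i)" for i
    unfolding frechet_derivative_at[OF d, symmetric]
    by (intro alg_mult alg_const alg_base) auto
qed

lemma smooth_fun_continuous: "smooth_fun f \<Longrightarrow> continuous_on UNIV f"
  by (rule differentiable_imp_continuous_on) (simp add: differentiable_on_def smooth_fun_differentiable)

lemma smooth_fun_pdx: "smooth_fun f \<Longrightarrow> smooth_fun (pdx f i)"
  using smooth_fun_partial[of f "axis i 1"] by (simp add: pdx_def[abs_def])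

section \<open>Smooth functions of time with prescribed support\<close>

lemma has_real_derivative_imp_frechet:
  "(f has_real_derivative D) (at x) \<Longrightarrow> frechet_derivative f (at x) h = D * h"
  using frechet_derivative_at[of f "(*) D" x] by (simp add: has_field_derivative_def)

lemma smooth_fun_real:
  assumes "\<And>x. (f has_real_derivative f' x) (at x)" "smooth_fun f'"
  shows "smooth_fun f"
  by (rule smooth_fun.intros)
     (use assms in \<open>auto simp: has_real_derivative_imp_frechet[OF assms(1)] real_differentiable_def\<close>)

\<comment> \<open>A family whose derivatives are again linear combinations of its members; k = 0 is the usual flat function.\<close>
definition flat :: "nat \<Rightarrow> real \<Rightarrow> real" where
  "flat k x = (if x \<le> 0 then 0 else (1/x)^k * exp (- (1/x)))"

text \<open>Only the origin needs a limit: with y = 1/h the difference quotient from the right is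
  y^(k+1) / exp y, which tends to 0 as y grows.\<close>

lemma flat_deriv: "(flat k has_real_derivative (- real k) * flat (Suc k) x + flat (Suc (Suc k)) x) (at x)"
proof -
  consider "x < 0" | "x > 0" | "x = 0" by linarith
  then show ?thesis
  proof cases
    case 1
    have "((\<lambda>x. 0) has_real_derivative 0) (at x)" by simp
    then have "(flat k has_real_derivative 0) (at x)"
      by (rule has_field_derivative_transform_within_open[of _ _ _ "{..<0}"]) (use 1 in \<open>auto simp: flat_def\<close>)
    then show ?thesis using 1 by (simp add: flat_def)
  next
    case 2
    have d: "((\<lambda>x. (1/x)^k * exp (- (1/x))) has_real_derivative
       real k * (1/x)^(k - 1) * (- (1 / x\<^sup>2)) * exp (- (1/x)) + (1/x)^k * (exp (- (1/x)) * (1 / x\<^sup>2))) (at x)"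
    proof -
      have i: "((\<lambda>x. 1/x) has_real_derivative - (1 / x\<^sup>2)) (at x)"
        using 2 by (auto intro!: derivative_eq_intros simp: power2_eq_square)
      show ?thesis
        using DERIV_mult[OF DERIV_power[OF i, of k] DERIV_chain2[OF DERIV_exp DERIV_minus[OF i]]]
        by (simp add: mult_ac)
    qed
    have "(flat k has_real_derivative
       real k * (1/x)^(k - 1) * (- (1 / x\<^sup>2)) * exp (- (1/x)) + (1/x)^k * (exp (- (1/x)) * (1 / x\<^sup>2))) (at x)"
      by (rule has_field_derivative_transform_within_open[OF d, of "{0<..}"]) (use 2 in \<open>auto simp: flat_def\<close>)
    moreover have "real k * (1/x)^(k - 1) * (- (1 / x\<^sup>2)) * exp (- (1/x)) + (1/x)^k * (exp (- (1/x)) * (1 / x\<^sup>2))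
       = (- real k) * flat (Suc k) x + flat (Suc (Suc k)) x"
      using 2 by (cases k) (simp_all add: flat_def power2_eq_square algebra_simps add_divide_distrib diff_divide_distrib)
    ultimately show ?thesis by simp
  next
    case 3
    have "((\<lambda>h. flat k h / h) \<longlongrightarrow> 0) (at_right 0)"
    proof -
      have "((\<lambda>y. y ^ Suc k / exp y) \<longlongrightarrow> 0) (at_top::real filter)" by (rule tendsto_power_div_exp_0)
      then have "((\<lambda>h::real. (inverse h) ^ Suc k / exp (inverse h)) \<longlongrightarrow> 0) (at_right 0)"
        by (rule filterlim_compose) (rule filterlim_inverse_at_top_right)
      then show ?thesis
        by (rule Lim_transform_eventually)
           (auto simp: eventually_at_filter flat_def exp_minus field_simps)
    qed
    moreover have "((\<lambda>h. flat k h / h) \<longlongrightarrow> 0) (at_left 0)"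
      by (rule Lim_transform_eventually[OF tendsto_const]) (auto simp: eventually_at_filter flat_def)
    ultimately have "((\<lambda>h. flat k h / h) \<longlongrightarrow> 0) (at 0)" by (simp add: filterlim_split_at)
    then have "(flat k has_real_derivative 0) (at 0)"
      by (simp add: has_field_derivative_iff flat_def[of k 0])
    then show ?thesis using 3 by (simp add: flat_def)
  qed
qed

lemma smooth_fun_flat: "smooth_fun (flat k)"
proof (rule smooth_fun_alg[of "range flat"])
  show "alg_gen (range flat) (flat k)" by (intro alg_base) auto
  fix g assume "g \<in> range flat"
  then obtain k where g: "g = flat k" by auto
  show "g differentiable (at x)" for x
    using flat_deriv unfolding g real_differentiable_def by blast
  show "alg_gen (range flat) (\<lambda>x. frechet_derivative g (at x) b)" for b
    unfolding g has_real_derivative_imp_frechet[OF flat_deriv]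
    by (intro alg_add alg_mult alg_const alg_base) auto
qed

lemma flat_pos: "x > 0 \<Longrightarrow> flat k x > 0" and flat_nonneg: "flat k x \<ge> 0"
  by (auto simp: flat_def)

definition bump :: "real \<Rightarrow> real \<Rightarrow> real \<Rightarrow> real" where
  "bump a b s = flat 0 (s - a) * flat 0 (b - s)"

lemma smooth_fun_bump: "smooth_fun (bump a b)"
proof -
  have "smooth_fun (\<lambda>s. flat 0 (s + (- a)))" by (rule smooth_fun_affine[OF smooth_fun_flat linear_id[unfolded id_def]])
  moreover have "smooth_fun (\<lambda>s. flat 0 (- s + b))"
    by (rule smooth_fun_affine[OF smooth_fun_flat]) (auto intro!: linearI)
  ultimately have "smooth_fun (\<lambda>s. flat 0 (s + (- a)) * flat 0 (- s + b))" by (rule smooth_fun_mult)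
  moreover have "bump a b = (\<lambda>s. flat 0 (s + (- a)) * flat 0 (- s + b))" by (auto simp: bump_def)
  ultimately show ?thesis by simp
qed

lemma bump_nonneg: "bump a b s \<ge> 0" by (simp add: bump_def flat_nonneg)
lemma bump_pos: "a < s \<Longrightarrow> s < b \<Longrightarrow> bump a b s > 0" by (simp add: bump_def flat_pos)
lemma bump_0: "s \<le> a \<or> b \<le> s \<Longrightarrow> bump a b s = 0" by (auto simp: bump_def flat_def)

text \<open>The antiderivative is normalised to vanish at late times rather than early ones, so that
  it is an admissible time factor in the weak formulation while its derivative is a bump.\<close>

lemma bump_antiderivative:
  assumes "a < b"
  obtains F where "\<And>s. (F has_real_derivative bump a b s) (at s)" "\<And>s. b \<le> s \<Longrightarrow> F s = 0"
proof -
  \<comment> \<open>The lower limit a - 1 lies to the left of the support, so every s \<ge> a is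
    interior to {a - 1..s + 1} and the derivative there is two-sided.\<close>
  define F where "F = (\<lambda>s. integral {a - 1..s} (bump a b))"
  have c: "continuous_on S (bump a b)" for S
    by (rule continuous_on_subset[OF smooth_fun_continuous[OF smooth_fun_bump]]) simp
  have d: "(F has_real_derivative bump a b s) (at s)" for s
  proof (cases "s < a")
    case True
    have "((\<lambda>s. 0) has_real_derivative 0) (at s)" by simp
    then have "(F has_real_derivative 0) (at s)"
    proof (rule has_field_derivative_transform_within_open[of _ _ _ "{..<a}"])
      fix x assume "x \<in> {..<a}"
      then have "integral {a - 1..x} (bump a b) = integral {a - 1..x} (\<lambda>x. 0)"
        by (intro integral_cong) (auto intro!: bump_0)
      then show "0 = F x" by (simp add: F_def)
    qed (use True in auto)
    then show ?thesis using True bump_0[of s a b] by simp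
  next
    case False
    have "(F has_real_derivative bump a b s) (at s within {a - 1..s + 1})"
      unfolding F_def using False by (intro integral_has_real_derivative c) auto
    moreover have "at s within {a - 1..s + 1} = at s"
      using False by (intro at_within_interior) auto
    ultimately show ?thesis by simp
  qed
  have z: "F s = F b" if "b \<le> s" for s
  proof -
    have "F s = integral {a - 1..b} (bump a b) + integral {b..s} (bump a b)"
      unfolding F_def using that assms
      by (intro Henstock_Kurzweil_Integration.integral_combine[symmetric] integrable_continuous_interval c) auto
    also have "integral {b..s} (bump a b) = integral {b..s} (\<lambda>x. 0)"
      by (intro integral_cong) (auto intro!: bump_0)
    finally show ?thesis by (simp add: F_def)
  qed
  show ?thesis
  proof (rule that[of "\<lambda>s. F s - F b"])
    show "((\<lambda>s. F s - F b) has_real_derivative bump a b s) (at s)" for s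
      using DERIV_diff[OF d[of s] DERIV_const[of "F b"]] by simp
    show "F s - F b = 0" if "b \<le> s" for s using z[OF that] by simp
  qed
qed

text \<open>Fundamental lemma of the calculus of variations: near a point where H is nonzero it
  keeps its sign, and a bump supported there would have a nonzero integral against it. Continuity
  adds the endpoints.\<close>

lemma weak_time_zero:
  fixes H :: "real \<Rightarrow> real"
  assumes T: "0 < T" and H: "continuous_on {0..T} H"
    and int: "\<And>a b. 0 < a \<Longrightarrow> a < b \<Longrightarrow> b < T \<Longrightarrow> integral {0..T} (\<lambda>s. bump a b s * H s) = 0"
    and t: "t \<in> {0..T}"
  shows "H t = 0"
proof -
  have int0: "H c = 0" if c: "c \<in> {0<..<T}" for c
  proof (rule ccontr)
    assume nz: "H c \<noteq> 0"
    have "isCont H c"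
      using continuous_on_interior[OF H] c by auto
    \<comment> \<open>The product with the constant H c is positive near c whatever the sign of H c,
      which avoids two cases.\<close>
    then have "((\<lambda>x. H x * H c) \<longlongrightarrow> H c * H c) (at c)"
      by (auto simp: isCont_def intro!: tendsto_intros)
    moreover have "H c * H c > 0" using nz not_real_square_gt_zero by blast
    ultimately have "eventually (\<lambda>x. H x * H c > 0) (at c)" by (rule order_tendstoD)
    then obtain d where d: "d > 0" "\<And>x. x \<noteq> c \<Longrightarrow> dist x c < d \<Longrightarrow> H x * H c > 0"
      unfolding eventually_at by auto
    define r where "r = min (d/2) (min (c/2) ((T - c)/2))"
    have r: "r > 0" "r < d" "c - r > 0" "c + r < T" using c d(1) by (auto simp: r_def min_def field_simps)
    let ?g = "\<lambda>s. bump (c - r) (c + r) s * (H s * H c)"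
    have cg: "continuous_on {0..T} ?g"
      by (intro continuous_intros H continuous_on_subset[OF smooth_fun_continuous[OF smooth_fun_bump]]) auto
    have "integral {0..T} ?g = integral {0..T} (\<lambda>s. bump (c - r) (c + r) s * H s) * H c"
      by (simp add: mult.assoc[symmetric])
    also have "\<dots> = 0" using int[of "c - r" "c + r"] r by simp
    finally have i0: "(?g has_integral 0) {0..T}"
      using integrable_continuous_interval[OF cg] integrable_integral by metis
    have "?g c = 0"
    proof (rule has_integral_0_cbox_imp_0[of 0 T ?g c])
      show "0 \<le> ?g s" for s
      proof (cases "c - r < s \<and> s < c + r")
        case True
        then have "H s * H c \<ge> 0" using d(2)[of s] r by (cases "s = c") (auto simp: dist_real_def abs_less_iff)
        then show ?thesis by (simp add: bump_nonneg)
      qed (auto simp: bump_0 not_less)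
    qed (use cg i0 c in auto)
    then show False using nz bump_pos[of "c - r" c "c + r"] r by auto
  qed
  have "closure {0<..<T} = {0..T}" using T by simp
  then show ?thesis using H int0 t by (intro continuous_constant_on_closure[of "{0<..<T}" H 0 t]) auto
qed

text \<open>A du Bois-Reymond argument. The time factor is the antiderivative F of a bump, so the
  identity pairs the bump with m. Integrating F h by parts through the primitive \<open>P\<close> of
  h turns it into a pairing of the bump with m - m0 - P, which must vanish; the value m0 enters
  through the total integral -F(0) of the bump.\<close>

lemma weak_time:
  fixes m h :: "real \<Rightarrow> real"
  assumes T: "0 < T" and m: "continuous_on {0..T} m" and h: "continuous_on {0..T} h"
    and w: "\<And>a a'. smooth_fun a \<Longrightarrow> (\<And>s. (a has_real_derivative a' s) (at s)) \<Longrightarrow> smooth_fun a' \<Longrightarrow>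
         (\<exists>T'<T. \<forall>s\<ge>T'. a s = 0) \<Longrightarrow>
        - a 0 * m0 - integral {0..T} (\<lambda>s. a' s * m s) = integral {0..T} (\<lambda>s. a s * h s)"
    and t: "t \<in> {0..T}"
  shows "m t = m0 + integral {0..t} h"
proof -
  define P where "P = (\<lambda>t. integral {0..t} h)"
  have P: "(P has_real_derivative h s) (at s within {0..T})" if "s \<in> {0..T}" for s
    unfolding P_def using that by (intro integral_has_real_derivative h) auto
  have cP: "continuous_on {0..T} P"
    by (rule DERIV_continuous_on[OF P])
  have "m t - m0 - P t = 0"
  proof (rule weak_time_zero[OF T _ _ t])
    show "continuous_on {0..T} (\<lambda>t. m t - m0 - P t)" by (intro continuous_intros m cP)
    fix a b :: real assume ab: "0 < a" "a < b" "b < T"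
    obtain F where F: "\<And>s. (F has_real_derivative bump a b s) (at s)" "\<And>s. b \<le> s \<Longrightarrow> F s = 0"
      using bump_antiderivative[OF ab(2)] by blast
    have cb: "continuous_on S (bump a b)" for S
      by (rule continuous_on_subset[OF smooth_fun_continuous[OF smooth_fun_bump]]) simp
    have cF: "continuous_on S F" for S
      by (rule DERIV_continuous_on[OF has_field_derivative_at_within[OF F(1)]])
    have 1: "- F 0 * m0 - integral {0..T} (\<lambda>s. bump a b s * m s) = integral {0..T} (\<lambda>s. F s * h s)"
      using ab F by (intro w smooth_fun_real[OF F(1)] smooth_fun_bump) auto
    \<comment> \<open>The product rule for F P; the boundary terms vanish because F is zero at T and
      P is zero at 0.\<close>
    have "((\<lambda>s. bump a b s * P s + F s * h s) has_integral F T * P T - F 0 * P 0) {0..T}"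
    proof (rule fundamental_theorem_of_calculus)
      fix s assume s: "s \<in> {0..T}"
      have "((\<lambda>s. F s * P s) has_real_derivative bump a b s * P s + F s * h s) (at s within {0..T})"
        by (rule derivative_eq_intros P[OF s] has_field_derivative_at_within[OF F(1)] refl)+ (simp add: mult.commute)
      then show "((\<lambda>s. F s * P s) has_vector_derivative bump a b s * P s + F s * h s) (at s within {0..T})"
        by (simp add: has_real_derivative_iff_has_vector_derivative)
    qed (use T in auto)
    moreover have "F T * P T - F 0 * P 0 = 0" using F(2)[of T] ab by (simp add: P_def)
    ultimately have "integral {0..T} (\<lambda>s. bump a b s * P s + F s * h s) = 0" by (metis integral_unique)
    then have 2: "integral {0..T} (\<lambda>s. bump a b s * P s) + integral {0..T} (\<lambda>s. F s * h s) = 0"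
      by (subst (asm) integral_add) (auto intro!: integrable_continuous_interval continuous_intros cb cP cF h)
    have "(bump a b has_integral F T - F 0) {0..T}"
      using T F(1) by (intro fundamental_theorem_of_calculus)
        (auto simp flip: has_real_derivative_iff_has_vector_derivative intro: has_field_derivative_at_within)
    then have 3: "integral {0..T} (bump a b) = - F 0" using F(2)[of T] ab by (simp add: integral_unique)
    have "integral {0..T} (\<lambda>s. bump a b s * (m s - m0 - P s)) = integral {0..T} (\<lambda>s. bump a b s * m s - bump a b s * m0 - bump a b s * P s)"
      by (simp add: algebra_simps)
    also have "\<dots> = integral {0..T} (\<lambda>s. bump a b s * m s) - integral {0..T} (\<lambda>s. bump a b s * m0) - integral {0..T} (\<lambda>s. bump a b s * P s)"
    proof -
      have "(\<lambda>s. bump a b s * m s) integrable_on {0..T}" "(\<lambda>s. bump a b s * m0) integrable_on {0..T}"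
        "(\<lambda>s. bump a b s * P s) integrable_on {0..T}"
        by (intro integrable_continuous_interval continuous_intros cb cP m)+
      then show ?thesis by (simp add: integral_diff integrable_diff)
    qed
    also have "\<dots> = 0" using 1 2 3 by simp
    finally show "integral {0..T} (\<lambda>s. bump a b s * (m s - m0 - P s)) = 0" .
  qed
  then show ?thesis by (simp add: P_def)
qed

section \<open>The weak formulation tested against products\<close>

lemma trig_poly_smooth: "trig_poly f \<Longrightarrow> smooth_fun (\<lambda>x. Re (f x))"
proof (induction rule: trig_poly.induct)
  case (trig_poly_ek k c)
  \<comment> \<open>The sine is written as a cosine with phase -pi/2, so that
    \<open>smooth_fun_cos\<close> covers both terms.\<close>
  have "Re (c * ek k x) = Re c * cos ((2 * pi) *\<^sub>R k \<bullet> x + 0) + (- Im c) * cos ((2 * pi) *\<^sub>R k \<bullet> x + (- (pi/2)))" for x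
    by (simp add: ek_def cos_add cos_diff)
  then show ?case
    by (simp only:) (intro smooth_fun_add smooth_fun_mult smooth_fun_const smooth_fun_cos)
next
  case (trig_poly_add f g)
  then show ?case by (auto intro: smooth_fun_add)
qed

lemma conv_trig_poly_ek:
  assumes "continuous_on UNIV u"
  shows "avg (\<lambda>y. (c * ek k (x - y)) * u y) = (c * avg (\<lambda>y. u y * ek (- k) y)) * ek k x"
proof -
  have "avg (\<lambda>y. (c * ek k (x - y)) * u y) = avg (\<lambda>y. (c * ek k x) * (u y * ek (- k) y))"
    by (simp add: ek_diff_right ek_minus mult_ac)
  also have "\<dots> = (c * ek k x) * avg (\<lambda>y. u y * ek (- k) y)" by simp
  finally show ?thesis by (simp add: mult_ac)
qed

text \<open>Each exponential in K picks out a single Fourier coefficient of u, so the convolution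
  has the frequencies of K even if u is merely continuous.\<close>

lemma conv_trig_poly:
  assumes K: "trig_poly K" and u: "continuous_on UNIV u"
  shows "trig_poly (\<lambda>x. avg (\<lambda>y. K (x - y) * u y))"
  using K
proof (induction rule: trig_poly.induct)
  case (trig_poly_ek k c)
  then show ?case unfolding conv_trig_poly_ek[OF u] by (rule trig_poly.trig_poly_ek)
next
  case (trig_poly_add f g)
  have "continuous_on UNIV f" "continuous_on UNIV g" using trig_poly_add trig_poly_cper cper_cont by auto
  note fg = cont_UNIV_compose[OF this(1)] cont_UNIV_compose[OF this(2)]
  have "avg (\<lambda>y. (f (x - y) + g (x - y)) * u y) = avg (\<lambda>y. f (x - y) * u y) + avg (\<lambda>y. g (x - y) * u y)" for x
    unfolding distrib_right
    by (intro integral_add integrable_cube continuous_intros u fg)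
  then show ?case using trig_poly_add.IH by (simp add: trig_poly.trig_poly_add)
qed

lemma conv_of_real:
  fixes u :: "real^3 \<Rightarrow> real"
  assumes u: "continuous_on UNIV u"
  shows "avg (\<lambda>y. complex_of_real (ker m (x - y)) * complex_of_real (u y)) = complex_of_real (conv (ker m) u x)"
proof -
  have "(\<lambda>y. ker m (x - y) * u y) integrable_on cube"
    by (intro integrable_cube continuous_intros u)
  from integral_linear[OF this bounded_linear_of_real[where 'a=complex]]
  show ?thesis by (simp add: conv_def o_def)
qed

lemma trig_poly_conv_ker:
  fixes u :: "real^3 \<Rightarrow> real"
  assumes u: "cper u"
  shows "trig_poly (\<lambda>x. complex_of_real (conv (ker m) u x))"
  using conv_trig_poly[OF ker_trig_poly[of m], of "\<lambda>y. complex_of_real (u y)"] cper_cont[OF u]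
  by (simp add: conv_of_real continuous_on_of_real)

lemma smooth_conv_ker:
  fixes u :: "real^3 \<Rightarrow> real"
  assumes u: "cper u"
  shows "smooth_fun (conv (ker m) u)" and cper_conv_ker: "cper (conv (ker m) u)"
  using trig_poly_smooth[OF trig_poly_conv_ker[OF u, of m]] trig_poly_of_real_cper[OF trig_poly_conv_ker[OF u, of m]] by auto

lemma smooth_ker: "smooth_fun (ker m)"
  using trig_poly_smooth[OF ker_trig_poly[of m]] by simp

lemma smooth_axis_deriv:
  assumes "smooth_fun f"
  shows "((\<lambda>h. f (x + h *\<^sub>R axis j 1)) has_real_derivative pdx f j (x + h *\<^sub>R axis j 1)) (at h)"
proof -
  have 1: "((\<lambda>h. x + h *\<^sub>R axis j 1) has_derivative (\<lambda>h. h *\<^sub>R axis j 1)) (at h)"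
    by (auto intro!: derivative_eq_intros)
  note 2 = smooth_fun_has_derivative[OF assms, of "x + h *\<^sub>R axis j 1"]
  have lin: "linear (frechet_derivative f (at (x + h *\<^sub>R axis j 1)))" by (rule has_derivative_linear[OF 2])
  have "((\<lambda>h. f (x + h *\<^sub>R axis j 1)) has_derivative (\<lambda>r. frechet_derivative f (at (x + h *\<^sub>R axis j 1)) (r *\<^sub>R axis j 1))) (at h)"
    by (rule has_derivative_compose[OF 1 2])
  then show ?thesis
    unfolding has_field_derivative_def pdx_def linear_scale[OF lin]
    by (rule has_derivative_eq_rhs) (auto simp: mult.commute)
qed

lemma pdx_eqI:
  assumes "smooth_fun f" "((\<lambda>h. f (x + h *\<^sub>R axis j 1)) has_real_derivative D) (at 0)"
  shows "pdx f j x = D"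
  using smooth_axis_deriv[OF assms(1), of x j 0] assms(2) DERIV_unique by fastforce

lemma smooth_ker_shift: "smooth_fun (\<lambda>y. ker m (y - x))"
  using smooth_fun_affine[OF smooth_ker linear_id[unfolded id_def], of m "- x"] by simp

lemma pdx_ker_shift: "pdx (\<lambda>y. ker m (y - x)) j y = dker m j (y - x)"
  using ker_deriv[of m "y - x" j 0] by (intro pdx_eqI smooth_ker_shift) (simp add: algebra_simps)

lemma periodic_ker_shift: "periodic3 (\<lambda>y. ker m (y - x))"
  using cper_shift[OF cper_ker[of m], of "- x"] by (simp add: cper_def)

lemma pdx_conv_ker:
  fixes u :: "real^3 \<Rightarrow> real"
  assumes u: "cper u"
  shows "pdx (conv (ker m) u) j x = conv (dker m j) u x"
proof (rule pdx_eqI[OF smooth_conv_ker(1)[OF u]])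
  have cu: "continuous_on UNIV u" using u by (rule cper_cont)
  have "((\<lambda>h. avg (\<lambda>y. ker m (x + h *\<^sub>R axis j 1 - y) * u y)) has_vector_derivative
     avg (\<lambda>y. dker m j (x + 0 *\<^sub>R axis j 1 - y) * u y)) (at 0 within UNIV)"
    unfolding cube_def
  proof (rule leibniz_rule_vector_derivative)
    fix h :: real and y :: "real^3"
    have "((\<lambda>h. ker m ((x - y) + h *\<^sub>R axis j 1) * u y) has_real_derivative dker m j ((x - y) + h *\<^sub>R axis j 1) * u y) (at h)"
      by (rule DERIV_cmult_right[OF ker_deriv])
    then show "((\<lambda>h. ker m (x + h *\<^sub>R axis j 1 - y) * u y) has_vector_derivative dker m j (x + h *\<^sub>R axis j 1 - y) * u y) (at h within UNIV)"
      by (simp add: has_real_derivative_iff_has_vector_derivative algebra_simps)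
    show "(\<lambda>y. ker m (x + h *\<^sub>R axis j 1 - y) * u y) integrable_on cbox 0 One"
      by (intro integrable_continuous continuous_intros cont_UNIV_compose[OF cu])
  next
    show "continuous_on (UNIV \<times> cbox 0 One) (\<lambda>(h, y). dker m j (x + h *\<^sub>R axis j 1 - y) * u y)"
      unfolding case_prod_beta by (intro continuous_intros cont_UNIV_compose[OF cu])
  qed auto
  then show "((\<lambda>h. conv (ker m) u (x + h *\<^sub>R axis j 1)) has_real_derivative conv (dker m j) u x) (at 0)"
    by (simp add: conv_def has_real_derivative_iff_has_vector_derivative)
qed

lemma space_time_derivative:
  fixes \<psi> :: "real^3 \<Rightarrow> 'b::real_normed_vector"
  assumes a: "(a has_real_derivative a') (at s)" and \<psi>: "(\<psi> has_derivative D) (at x)"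
  shows "((\<lambda>(s', x'). a s' *\<^sub>R \<psi> x') has_derivative (\<lambda>(h, k). h *\<^sub>R (a' *\<^sub>R \<psi> x) + a s *\<^sub>R D k)) (at (s, x))"
proof -
  have a': "(a has_derivative (\<lambda>h. h * a')) (at (fst (s, x)))"
    using a[unfolded has_field_derivative_def] unfolding fst_conv
    by (rule has_derivative_eq_rhs) (auto simp: mult.commute)
  have \<psi>': "(\<psi> has_derivative D) (at (snd (s, x)))" using \<psi> by simp
  have "((\<lambda>p. a (fst p) *\<^sub>R \<psi> (snd p)) has_derivative (\<lambda>p. a (fst (s, x)) *\<^sub>R D (snd p) + (fst p * a') *\<^sub>R \<psi> (snd (s, x)))) (at (s, x))"
    by (intro has_derivative_scaleR has_derivative_compose[of fst fst _ _ a, OF _ a']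
          has_derivative_compose[of snd snd _ _ \<psi>, OF _ \<psi>'] bounded_linear_imp_has_derivative
          bounded_linear_fst bounded_linear_snd)
  then show ?thesis by (simp add: case_prod_beta' add.commute)
qed

lemma pdt_st_prod:
  fixes \<psi> :: "real^3 \<Rightarrow> 'b::real_normed_vector"
  assumes "(a has_real_derivative a') (at s)" "(\<psi> has_derivative D) (at x)"
  shows "pdt_st (\<lambda>s x. a s *\<^sub>R \<psi> x) s x = a' *\<^sub>R \<psi> x"
    and "pdx_st (\<lambda>s x. a s *\<^sub>R \<psi> x) j s x = a s *\<^sub>R D (axis j 1)"
  using frechet_derivative_at[OF space_time_derivative[OF assms], symmetric]
    linear_0[OF has_derivative_linear[OF assms(2)]]
  by (simp_all add: pdt_st_def pdx_st_def)

lemma smooth_st_prod: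
  assumes "smooth_fun a" "smooth_fun (\<psi>::real^3 \<Rightarrow> real)"
  shows "smooth_fun (\<lambda>(s::real, x). a s * \<psi> x)"
proof -
  have "smooth_fun (\<lambda>p::real \<times> (real^3). a (fst p + 0))" "smooth_fun (\<lambda>p::real \<times> (real^3). \<psi> (snd p + 0))"
    by (rule smooth_fun_affine[OF assms(1) linear_fst], rule smooth_fun_affine[OF assms(2) linear_snd])
  from smooth_fun_mult[OF this] show ?thesis by (simp add: case_prod_beta')
qed

definition weak_div_free :: "(real^3 \<Rightarrow> real^3) \<Rightarrow> bool" where
  "weak_div_free V \<longleftrightarrow> (\<forall>\<psi>. smooth_fun \<psi> \<and> periodic3 \<psi> \<longrightarrow> avg (\<lambda>x. \<Sum>i\<in>UNIV. V x $ i * pdx \<psi> i x) = 0)"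

section \<open>The weak formulation for test functions that do not depend on time\<close>

locale boussinesq =
  fixes T :: real and vin :: "real^3 \<Rightarrow> real^3" and \<theta>in :: "real^3 \<Rightarrow> real"
    and v :: "real \<Rightarrow> real^3 \<Rightarrow> real^3" and \<theta> :: "real \<Rightarrow> real^3 \<Rightarrow> real"
  assumes T: "0 < T" and ws: "weak_solution T vin \<theta>in v \<theta>"
begin

lemma cont_v: "continuous_on ({0..T} \<times> UNIV) (\<lambda>p. v (fst p) (snd p))"
  and cont_\<theta>: "continuous_on ({0..T} \<times> UNIV) (\<lambda>p. \<theta> (fst p) (snd p))"
  using ws unfolding weak_solution_def case_prod_beta by auto

lemma cont_v': "continuous_on S f \<Longrightarrow> continuous_on S g \<Longrightarrow> f ` S \<subseteq> {0..T} \<Longrightarrow> continuous_on S (\<lambda>x. v (f x) (g x))"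
  by (rule continuous_on_compose2[OF cont_v, of S "\<lambda>x. (f x, g x)", simplified]) (auto intro!: continuous_intros)

lemma cont_\<theta>': "continuous_on S f \<Longrightarrow> continuous_on S g \<Longrightarrow> f ` S \<subseteq> {0..T} \<Longrightarrow> continuous_on S (\<lambda>x. \<theta> (f x) (g x))"
  by (rule continuous_on_compose2[OF cont_\<theta>, of S "\<lambda>x. (f x, g x)", simplified]) (auto intro!: continuous_intros)

lemma cper_v: "t \<in> {0..T} \<Longrightarrow> cper (v t)" and cper_\<theta>: "t \<in> {0..T} \<Longrightarrow> cper (\<theta> t)"
  using ws unfolding weak_solution_def cper_def by (auto intro!: cont_v' cont_\<theta>' continuous_intros)

lemma cper_\<theta>in: "cper \<theta>in"
  using ws unfolding weak_solution_def cper_def by (auto intro: smooth_fun_continuous)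

lemma smooth_vin: "smooth_fun (\<lambda>x. vin x $ i)"
  using ws unfolding weak_solution_def smooth_vec3_def by auto

lemma cper_vin: "cper vin"
proof -
  have "continuous_on UNIV (\<lambda>x. \<chi> i. vin x $ i)"
    by (intro continuous_on_vec_lambda smooth_fun_continuous smooth_vin)
  then show ?thesis using ws unfolding weak_solution_def cper_def by simp
qed

text \<open>For fixed \<psi> the pairing is continuous in t. Its zero set is closed and has full
  measure in (0, T), hence contains that interval and its closure.\<close>

lemma weak_div_free_v: assumes t: "t \<in> {0..T}" shows "weak_div_free (v t)"
  unfolding weak_div_free_def
proof (intro allI impI, elim conjE)
  fix \<psi> :: "real^3 \<Rightarrow> real" assume \<psi>: "smooth_fun \<psi>" "periodic3 \<psi>"
  define f where "f = (\<lambda>t. avg (\<lambda>x. \<Sum>i\<in>UNIV. v t x $ i * pdx \<psi> i x))"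
  have c: "continuous_on {0..T} f" unfolding f_def
    by (intro cont_integral_cube continuous_intros cont_v' cont_UNIV_compose[OF smooth_fun_continuous[OF smooth_fun_pdx[OF \<psi>(1)]]]) auto
  have "AE t in lebesgue_on {0..T}. f t = 0"
    using ws \<psi> unfolding weak_solution_def f_def by (auto elim: eventually_mono)
  then have "AE t in lebesgue. t \<in> {0..T} \<longrightarrow> f t = 0"
    by (subst (asm) AE_restrict_space_iff) auto
  then have "AE t\<in>{0<..<T} in lebesgue. t \<in> {t\<in>{0..T}. f t \<in> {0}}" by (auto elim: eventually_mono)
  moreover have "closed {t\<in>{0..T}. f t \<in> {0}}"
    using continuous_closed_preimage[OF c, of "{0}"] by (simp add: vimage_def Int_def)
  ultimately have z: "f s = 0" if "s \<in> {0<..<T}" for s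
    using mem_closed_if_AE_lebesgue_open[of "{0<..<T}" "{t\<in>{0..T}. f t \<in> {0}}" s] that by auto
  have "closure {0<..<T} = {0..T}" using T by simp
  then have "f t = 0" using c z t by (intro continuous_constant_on_closure[of "{0<..<T}" f 0 t]) auto
  then show "avg (\<lambda>x. \<Sum>i\<in>UNIV. v t x $ i * pdx \<psi> i x) = 0" by (simp add: f_def)
qed

text \<open>The derivative of vin_i \<psi> in direction i has mean zero; summed over i, this
  converts the classical divergence into the weak one.\<close>

lemma weak_div_free_vin: "weak_div_free vin"
  unfolding weak_div_free_def
proof (intro allI impI, elim conjE)
  fix \<psi> :: "real^3 \<Rightarrow> real" assume \<psi>: "smooth_fun \<psi>" "periodic3 \<psi>"
  have c\<psi>: "cper \<psi>" using \<psi> by (auto simp: cper_def intro: smooth_fun_continuous)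
  have c1: "continuous_on UNIV (\<lambda>x. vin x $ i)" "continuous_on UNIV (pdx (\<lambda>y. vin y $ i) i)"
    "continuous_on UNIV \<psi>" "continuous_on UNIV (pdx \<psi> i)" for i
    by (intro smooth_fun_continuous smooth_fun_pdx smooth_vin \<psi>)+
  have "avg (\<lambda>x. vin x $ i * pdx \<psi> i x + pdx (\<lambda>y. vin y $ i) i x * \<psi> x) = 0" for i
  proof (rule integral_cube_deriv_axis[where f="\<lambda>x. vin x $ i * \<psi> x"])
    show "cper (\<lambda>x. vin x $ i * \<psi> x)" by (intro cper_mult cper_vec_nth cper_vin c\<psi>)
    show "((\<lambda>h. vin (x + h *\<^sub>R axis i 1) $ i * \<psi> (x + h *\<^sub>R axis i 1)) has_real_derivative
        vin x $ i * pdx \<psi> i x + pdx (\<lambda>y. vin y $ i) i x * \<psi> x) (at 0)" for x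
      using DERIV_mult[OF smooth_axis_deriv[OF smooth_vin[of i], of x i 0] smooth_axis_deriv[OF \<psi>(1), of x i 0]]
      by (simp add: algebra_simps)
  qed (intro continuous_intros c1)
  then have "0 = (\<Sum>i\<in>UNIV. avg (\<lambda>x. vin x $ i * pdx \<psi> i x + pdx (\<lambda>y. vin y $ i) i x * \<psi> x))" by simp
  also have "\<dots> = (\<Sum>i\<in>UNIV. avg (\<lambda>x. vin x $ i * pdx \<psi> i x) + avg (\<lambda>x. pdx (\<lambda>y. vin y $ i) i x * \<psi> x))"
    by (intro sum.cong refl integral_add integrable_cube continuous_intros c1)
  also have "\<dots> = avg (\<lambda>x. \<Sum>i\<in>UNIV. vin x $ i * pdx \<psi> i x) + avg (\<lambda>x. \<Sum>i\<in>UNIV. pdx (\<lambda>y. vin y $ i) i x * \<psi> x)"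
    unfolding sum.distrib
    by (subst (1 2) integral_sum) (auto intro!: integrable_cube continuous_intros c1)
  also have "(\<lambda>x. \<Sum>i\<in>UNIV. pdx (\<lambda>y. vin y $ i) i x * \<psi> x) = (\<lambda>x. 0)"
    using ws unfolding weak_solution_def div_free_smooth_def by (simp add: sum_distrib_right[symmetric])
  finally show "avg (\<lambda>x. \<Sum>i\<in>UNIV. vin x $ i * pdx \<psi> i x) = 0" by simp
qed

lemma weak_vec: "test_vec T \<phi> \<Longrightarrow>
         - avg (\<lambda>x. vin x \<bullet> \<phi> 0 x)
         - integral {0..T} (\<lambda>s. avg (\<lambda>x. pdt_st \<phi> s x \<bullet> v s x))
         = integral {0..T} (\<lambda>s. avg (\<lambda>x.
              (\<Sum>i\<in>UNIV. \<Sum>j\<in>UNIV. pdx_st (\<lambda>s' x'. \<phi> s' x' $ i) j s x * v s x $ i * v s x $ j)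
              + \<theta> s x * \<phi> s x $ 3))"
  and weak_scal: "test_scal T \<phi>' \<Longrightarrow>
         - avg (\<lambda>x. \<theta>in x * \<phi>' 0 x)
         - integral {0..T} (\<lambda>s. avg (\<lambda>x. pdt_st \<phi>' s x * \<theta> s x))
         = integral {0..T} (\<lambda>s. avg (\<lambda>x.
              (\<Sum>j\<in>UNIV. v s x $ j * pdx_st \<phi>' j s x) * \<theta> s x))"
  using ws unfolding weak_solution_def by blast+

text \<open>For the product a(s) \<psi>(x) the space integrals become scalar functions of time and
  the equation takes the form required by \<open>weak_time\<close>.\<close>

lemma \<theta>_weak:
  assumes \<psi>: "smooth_fun \<psi>" "periodic3 \<psi>" and t: "t \<in> {0..T}"
  shows "avg (\<lambda>x. \<theta> t x * \<psi> x) = avg (\<lambda>x. \<theta>in x * \<psi> x)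
     + integral {0..t} (\<lambda>s. avg (\<lambda>x. (\<Sum>j\<in>UNIV. v s x $ j * pdx \<psi> j x) * \<theta> s x))"
proof (rule weak_time[OF T _ _ _ t, where m="\<lambda>t. avg (\<lambda>x. \<theta> t x * \<psi> x)"])
  note c\<psi> = cont_UNIV_compose[OF smooth_fun_continuous[OF smooth_fun_pdx[OF \<psi>(1)]]] cont_UNIV_compose[OF smooth_fun_continuous[OF \<psi>(1)]]
  show "continuous_on {0..T} (\<lambda>t. avg (\<lambda>x. \<theta> t x * \<psi> x))"
    by (intro cont_integral_cube continuous_intros cont_\<theta>' c\<psi>) auto
  show "continuous_on {0..T} (\<lambda>s. avg (\<lambda>x. (\<Sum>j\<in>UNIV. v s x $ j * pdx \<psi> j x) * \<theta> s x))"
    by (intro cont_integral_cube continuous_intros cont_\<theta>' cont_v' c\<psi>) auto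
  fix a a' assume a: "smooth_fun a" "\<And>s. (a has_real_derivative a' s) (at s)" "\<exists>T'<T. \<forall>s\<ge>T'. a s = 0"
  have "test_scal T (\<lambda>s x. a s * \<psi> x)"
    unfolding test_scal_def using a(3) \<psi> smooth_st_prod[OF a(1) \<psi>(1)] by (auto simp: periodic3_def)
  note wk = weak_scal[OF this]
  have "pdt_st (\<lambda>s x. a s * \<psi> x) s x = a' s * \<psi> x" "pdx_st (\<lambda>s x. a s * \<psi> x) j s x = a s * pdx \<psi> j x" for s x j
    using pdt_st_prod(1)[OF a(2)[of s] smooth_fun_has_derivative[OF \<psi>(1), of x]]
      pdt_st_prod(2)[OF a(2)[of s] smooth_fun_has_derivative[OF \<psi>(1), of x], of j] by (simp_all add: pdx_def)
  note pd = this
  have "- avg (\<lambda>x. \<theta>in x * (a 0 * \<psi> x)) - integral {0..T} (\<lambda>s. avg (\<lambda>x. a' s * \<psi> x * \<theta> s x))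
    = integral {0..T} (\<lambda>s. avg (\<lambda>x. (\<Sum>j\<in>UNIV. v s x $ j * (a s * pdx \<psi> j x)) * \<theta> s x))"
    using wk unfolding pd .
  moreover have "avg (\<lambda>x. \<theta>in x * (a 0 * \<psi> x)) = a 0 * avg (\<lambda>x. \<theta>in x * \<psi> x)"
    by (simp add: mult.left_commute[of _ "a 0"])
  moreover have "avg (\<lambda>x. a' s * \<psi> x * \<theta> s x) = a' s * avg (\<lambda>x. \<theta> s x * \<psi> x)" for s
    by (simp add: mult.assoc mult.commute[of "\<psi> _"])
  moreover have "avg (\<lambda>x. (\<Sum>j\<in>UNIV. v s x $ j * (a s * pdx \<psi> j x)) * \<theta> s x)
     = a s * avg (\<lambda>x. (\<Sum>j\<in>UNIV. v s x $ j * pdx \<psi> j x) * \<theta> s x)" for s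
    by (simp add: mult.left_commute[of _ "a s"] sum_distrib_left[symmetric] mult.assoc)
  ultimately show "- a 0 * avg (\<lambda>x. \<theta>in x * \<psi> x) - integral {0..T} (\<lambda>s. a' s * avg (\<lambda>x. \<theta> s x * \<psi> x))
    = integral {0..T} (\<lambda>s. a s * avg (\<lambda>x. (\<Sum>j\<in>UNIV. v s x $ j * pdx \<psi> j x) * \<theta> s x))"
    by simp
qed

text \<open>Incompressibility of \<psi> makes a(s) \<psi>(x) an admissible test field for every time
  factor a.\<close>

lemma v_weak:
  assumes \<psi>: "\<And>i. smooth_fun (\<lambda>x. \<psi> x $ i)" "periodic3 \<psi>" "\<And>x. (\<Sum>i\<in>UNIV. pdx (\<lambda>y. \<psi> y $ i) i x) = 0" and t: "t \<in> {0..T}"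
  shows "avg (\<lambda>x. v t x \<bullet> \<psi> x) = avg (\<lambda>x. vin x \<bullet> \<psi> x)
     + integral {0..t} (\<lambda>s. avg (\<lambda>x. (\<Sum>i\<in>UNIV. \<Sum>j\<in>UNIV. pdx (\<lambda>y. \<psi> y $ i) j x * v s x $ i * v s x $ j) + \<theta> s x * \<psi> x $ 3))"
proof (rule weak_time[OF T _ _ _ t, where m="\<lambda>t. avg (\<lambda>x. v t x \<bullet> \<psi> x)"])
  have \<psi>c: "continuous_on UNIV \<psi>"
    using continuous_on_vec_lambda[of UNIV "\<lambda>i x. \<psi> x $ i", OF smooth_fun_continuous[OF \<psi>(1)]] by simp
  note c\<psi> = cont_UNIV_compose[OF smooth_fun_continuous[OF smooth_fun_pdx[OF \<psi>(1)]]] cont_UNIV_compose[OF \<psi>c]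
  show "continuous_on {0..T} (\<lambda>t. avg (\<lambda>x. v t x \<bullet> \<psi> x))"
    by (intro cont_integral_cube continuous_intros cont_v' c\<psi>) auto
  show "continuous_on {0..T} (\<lambda>s. avg (\<lambda>x. (\<Sum>i\<in>UNIV. \<Sum>j\<in>UNIV. pdx (\<lambda>y. \<psi> y $ i) j x * v s x $ i * v s x $ j) + \<theta> s x * \<psi> x $ 3))"
    by (intro cont_integral_cube continuous_intros cont_\<theta>' cont_v' c\<psi>) auto
  fix a a' assume a: "smooth_fun a" "\<And>s. (a has_real_derivative a' s) (at s)" "\<exists>T'<T. \<forall>s\<ge>T'. a s = 0"
  \<comment> \<open>Smoothness is given for the components only, so the derivative of \<psi> is
    assembled from theirs.\<close>
  define D where "D = (\<lambda>x h. \<chi> i. frechet_derivative (\<lambda>y. \<psi> y $ i) (at x) h)"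
  have D: "(\<psi> has_derivative D x) (at x)" for x
    unfolding has_derivative_componentwise_within[of \<psi>]
    using smooth_fun_has_derivative[OF \<psi>(1)] by (auto simp: Basis_vec_def inner_axis D_def)
  have ci: "pdx_st (\<lambda>s x. (a s *\<^sub>R \<psi> x) $ i) j s x = a s * pdx (\<lambda>y. \<psi> y $ i) j x" for i j s x
    using pdt_st_prod(2)[OF a(2)[of s] smooth_fun_has_derivative[OF \<psi>(1)[of i], of x], of j] by (simp add: pdx_def)
  have "test_vec T (\<lambda>s x. a s *\<^sub>R \<psi> x)"
    unfolding test_vec_def ci sum_distrib_left[symmetric] \<psi>(3)
    using a(3) \<psi> smooth_st_prod[OF a(1) \<psi>(1)] by (auto simp: periodic3_def)
  note wk = weak_vec[OF this]
  have "pdt_st (\<lambda>s x. a s *\<^sub>R \<psi> x) s x = a' s *\<^sub>R \<psi> x" for s x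
    using pdt_st_prod[OF a(2)[of s] D[of x]] by simp
  note pd = this
  have "- avg (\<lambda>x. vin x \<bullet> (a 0 *\<^sub>R \<psi> x)) - integral {0..T} (\<lambda>s. avg (\<lambda>x. (a' s *\<^sub>R \<psi> x) \<bullet> v s x))
    = integral {0..T} (\<lambda>s. avg (\<lambda>x. (\<Sum>i\<in>UNIV. \<Sum>j\<in>UNIV. a s * pdx (\<lambda>y. \<psi> y $ i) j x * v s x $ i * v s x $ j) + \<theta> s x * (a s *\<^sub>R \<psi> x) $ 3))"
    using wk unfolding pd ci .
  moreover have "avg (\<lambda>x. (\<Sum>i\<in>UNIV. \<Sum>j\<in>UNIV. a s * pdx (\<lambda>y. \<psi> y $ i) j x * v s x $ i * v s x $ j) + \<theta> s x * (a s *\<^sub>R \<psi> x) $ 3)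
     = a s * avg (\<lambda>x. (\<Sum>i\<in>UNIV. \<Sum>j\<in>UNIV. pdx (\<lambda>y. \<psi> y $ i) j x * v s x $ i * v s x $ j) + \<theta> s x * \<psi> x $ 3)" for s
    by (subst integral_mult_right[symmetric]) (simp add: distrib_left sum_distrib_left mult_ac)
  ultimately show "- a 0 * avg (\<lambda>x. vin x \<bullet> \<psi> x) - integral {0..T} (\<lambda>s. a' s * avg (\<lambda>x. v s x \<bullet> \<psi> x))
    = integral {0..T} (\<lambda>s. a s * avg (\<lambda>x. (\<Sum>i\<in>UNIV. \<Sum>j\<in>UNIV. pdx (\<lambda>y. \<psi> y $ i) j x * v s x $ i * v s x $ j) + \<theta> s x * \<psi> x $ 3))"
    by (simp add: inner_commute)
qed

end

section \<open>Bernstein inequality and Littlewood-Paley blocks\<close>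

text \<open>In contrast to \<open>trig_poly\<close>, frequencies and coefficients are kept explicit,
  as Parseval and Bernstein require.\<close>

definition trig_sum :: "(real^3) set \<Rightarrow> (real^3 \<Rightarrow> complex) \<Rightarrow> real^3 \<Rightarrow> complex" where
  "trig_sum F c x = (\<Sum>k\<in>F. c k * ek k x)"

lemma continuous_on_trig_sum [continuous_intros]:
  "continuous_on S f \<Longrightarrow> continuous_on S (\<lambda>x. trig_sum F c (f x))"
  unfolding trig_sum_def by (intro continuous_intros)

lemma cper_trig_sum: "F \<subseteq> Zvecs \<Longrightarrow> cper (trig_sum F c)"
  by (auto simp: cper_def periodic3_def trig_sum_def ek_add_right ek_Zvecs subset_iff intro!: continuous_intros sum.cong)

lemma trig_sum_shift: "trig_sum F c (x + z) = trig_sum F (\<lambda>k. c k * ek k z) x"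
  by (simp add: trig_sum_def ek_add_right mult_ac)

lemma trig_sum_diff: "trig_sum F c x - trig_sum F d x = trig_sum F (\<lambda>k. c k - d k) x"
  by (simp add: trig_sum_def left_diff_distrib sum_subtractf)

lemma fourier_trig_sum:
  assumes F: "finite F" "F \<subseteq> Zvecs" and l: "l \<in> Zvecs"
  shows "avg (\<lambda>y. trig_sum F c y * ek (- l) y) = (if l \<in> F then c l else 0)"
proof -
  have "avg (\<lambda>y. trig_sum F c y * ek (- l) y) = avg (\<lambda>y. \<Sum>k\<in>F. c k * ek (k - l) y)"
    by (simp add: trig_sum_def sum_distrib_right ek_diff ek_minus mult.assoc)
  also have "\<dots> = (\<Sum>k\<in>F. c k * avg (ek (k - l)))"
    using F by (subst integral_sum) (auto intro!: integrable_cube continuous_intros)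
  also have "\<dots> = (\<Sum>k\<in>F. if k = l then c k else 0)"
    using F l by (intro sum.cong refl) (auto simp: integral_ek subset_iff)
  finally show ?thesis using F by (simp add: sum.delta)
qed

lemma parseval:
  assumes F: "finite F" "F \<subseteq> Zvecs"
  shows "avg (\<lambda>x. (norm (trig_sum F c x))\<^sup>2) = (\<Sum>k\<in>F. (norm (c k))\<^sup>2)"
proof -
  have cc: "continuous_on UNIV (trig_sum F c)" by (rule cper_cont[OF cper_trig_sum[OF F(2)]])
  have "complex_of_real (avg (\<lambda>x. (norm (trig_sum F c x))\<^sup>2)) = avg (\<lambda>x. complex_of_real ((norm (trig_sum F c x))\<^sup>2))"
    using integral_linear[of "\<lambda>x. (norm (trig_sum F c x))\<^sup>2" cube complex_of_real]
    by (simp add: o_def bounded_linear_of_real integrable_cube continuous_intros cc)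
  also have "\<dots> = avg (\<lambda>x. \<Sum>l\<in>F. cnj (c l) * (trig_sum F c x * ek (- l) x))"
  proof (rule integral_cube_cong)
    fix x
    have "complex_of_real ((norm (trig_sum F c x))\<^sup>2) = trig_sum F c x * cnj (trig_sum F c x)" by (rule complex_norm_square)
    also have "cnj (trig_sum F c x) = (\<Sum>l\<in>F. cnj (c l) * ek (- l) x)" by (simp add: trig_sum_def ek_minus)
    finally show "complex_of_real ((norm (trig_sum F c x))\<^sup>2) = (\<Sum>l\<in>F. cnj (c l) * (trig_sum F c x * ek (- l) x))"
      by (simp add: sum_distrib_left mult_ac)
  qed
  also have "\<dots> = (\<Sum>l\<in>F. cnj (c l) * avg (\<lambda>x. trig_sum F c x * ek (- l) x))"
    using F by (subst integral_sum) (auto intro!: integrable_cube continuous_intros cc)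
  also have "\<dots> = (\<Sum>l\<in>F. cnj (c l) * c l)"
    using F by (intro sum.cong refl) (auto simp: fourier_trig_sum subset_iff)
  also have "\<dots> = (\<Sum>l\<in>F. complex_of_real ((norm (c l))\<^sup>2))"
    by (intro sum.cong refl) (metis complex_norm_square mult.commute)
  also have "\<dots> = complex_of_real (\<Sum>k\<in>F. (norm (c k))\<^sup>2)" by simp
  finally show ?thesis using of_real_eq_iff by blast
qed

text \<open>Minkowski's inequality in L2, from Cauchy-Schwarz with weights B_n. Since a B_n may be
  zero, the weights are B_n + e, and e tends to 0 at the end.\<close>

lemma integral_norm2_sum_le:
  fixes f :: "nat \<Rightarrow> real^3 \<Rightarrow> complex"
  assumes c: "\<And>n. continuous_on UNIV (f n)" and le: "\<And>n. avg (\<lambda>x. (norm (f n x))\<^sup>2) \<le> (B n)\<^sup>2" and B: "\<And>n. 0 \<le> B n"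
  shows "avg (\<lambda>x. (norm (\<Sum>n<N. f n x))\<^sup>2) \<le> (\<Sum>n<N. B n)\<^sup>2"
proof -
  have "avg (\<lambda>x. (norm (\<Sum>n<N. f n x))\<^sup>2) \<le> (\<Sum>n<N. B n + e)\<^sup>2" if e: "e > 0" for e
  proof -
    let ?B = "\<lambda>n. B n + e"
    have Bp: "?B n > 0" for n using B[of n] e by simp
    have "avg (\<lambda>x. (norm (\<Sum>n<N. f n x))\<^sup>2) \<le> avg (\<lambda>x. (\<Sum>n<N. ?B n) * (\<Sum>n<N. (norm (f n x))\<^sup>2 / ?B n))"
    proof (rule integral_le)
      show "(\<lambda>x. (norm (\<Sum>n<N. f n x))\<^sup>2) integrable_on cube"
        by (intro integrable_cube continuous_intros c)
      show "(\<lambda>x. (\<Sum>n<N. ?B n) * (\<Sum>n<N. (norm (f n x))\<^sup>2 / ?B n)) integrable_on cube"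
        using Bp by (intro integrable_cube continuous_intros c) (simp add: less_imp_neq[THEN not_sym])
      fix x
      have "(norm (\<Sum>n<N. f n x))\<^sup>2 \<le> (\<Sum>n<N. norm (f n x))\<^sup>2"
        by (intro power_mono norm_sum) auto
      also have "\<dots> = (\<Sum>n<N. sqrt (?B n) * (norm (f n x) / sqrt (?B n)))\<^sup>2"
        using Bp by (intro arg_cong[where f="\<lambda>x. x\<^sup>2"] sum.cong refl) (metis less_irrefl nonzero_mult_div_cancel_left real_sqrt_gt_0_iff times_divide_eq_right)
      also have "\<dots> \<le> (\<Sum>n<N. (sqrt (?B n))\<^sup>2) * (\<Sum>n<N. (norm (f n x) / sqrt (?B n))\<^sup>2)"
        by (rule Cauchy_Schwarz_ineq_sum)
      also have "\<dots> = (\<Sum>n<N. ?B n) * (\<Sum>n<N. (norm (f n x))\<^sup>2 / ?B n)"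
        using less_imp_le[OF Bp] by (simp add: power_divide)
      finally show "(norm (\<Sum>n<N. f n x))\<^sup>2 \<le> (\<Sum>n<N. ?B n) * (\<Sum>n<N. (norm (f n x))\<^sup>2 / ?B n)" .
    qed
    also have "\<dots> = (\<Sum>n<N. ?B n) * (\<Sum>n<N. avg (\<lambda>x. (norm (f n x))\<^sup>2) / ?B n)"
      by (subst integral_mult_right, subst integral_sum) (use Bp in \<open>auto intro!: integrable_cube continuous_intros c simp: less_imp_neq[THEN not_sym]\<close>)
    also have "\<dots> \<le> (\<Sum>n<N. ?B n) * (\<Sum>n<N. ?B n)"
    proof (intro mult_left_mono sum_mono sum_nonneg)
      fix n
      have "avg (\<lambda>x. (norm (f n x))\<^sup>2) \<le> (?B n)\<^sup>2"
        using le[of n] power_mono[of "B n" "?B n" 2] B[of n] e by linarith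
      then show "avg (\<lambda>x. (norm (f n x))\<^sup>2) / ?B n \<le> ?B n"
        using Bp[of n] by (simp add: pos_divide_le_eq power2_eq_square)
    qed (use Bp less_imp_le in blast)
    finally show ?thesis by (simp add: power2_eq_square)
  qed
  then have ev: "\<forall>\<^sub>F e in at_right 0. avg (\<lambda>x. (norm (\<Sum>n<N. f n x))\<^sup>2) \<le> (\<Sum>n<N. B n + e)\<^sup>2"
    by (auto simp: eventually_at_filter)
  have "((\<lambda>e. (\<Sum>n<N. B n + e)\<^sup>2) \<longlongrightarrow> (\<Sum>n<N. B n + 0)\<^sup>2) (at_right 0)"
    by (intro tendsto_intros)
  from tendsto_lowerbound[OF this ev] show ?thesis by simp
qed

text \<open>These counts are the triangular Fourier coefficients of the unnormalised Fejer
  kernel.\<close>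

lemma card_diff_pairs:
  assumes "d \<le> N"
  shows "card {p \<in> {..<N} \<times> {..<N}. fst p + d = snd p} = N - d"
proof -
  have "{p \<in> {..<N} \<times> {..<N}. fst p + d = snd p} = (\<lambda>a. (a, a + d)) ` {..<N - d}"
    by auto
  then show ?thesis by (simp add: card_image inj_on_def)
qed

text \<open>The Fejer kernel of order N modulated by sin (2 \<pi> N y_i) reproduces the derivative in
  direction i of trigonometric polynomials of degree at most N, and its L1 norm is of order N.\<close>

lemma fejer_coeff:
  fixes i :: 3 and N :: nat
  assumes N: "N > 0" and k: "k \<in> \<int>" "\<bar>k\<bar> \<le> real N"
  defines "e \<equiv> \<lambda>r. r *\<^sub>R (axis i 1 :: real^3)"
  defines "A \<equiv> \<lambda>y. \<Sum>p\<in>{..<N} \<times> {..<N}. ek (e (real (fst p) - real (snd p))) y"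
  shows "avg (\<lambda>y. ek (e (- k)) y * ((ek (e (real N)) y - ek (e (- real N)) y) * A y)) = complex_of_real k"
proof -
  have ead: "e a + e b = e (a + b)" for a b by (simp add: e_def scaleR_add_left)
  have e0: "e a = 0 \<longleftrightarrow> a = 0" for a by (simp add: e_def)
  have eZ: "e a \<in> Zvecs" if "a \<in> \<int>" for a using that by (auto simp: e_def Zvecs_def axis_def)
  obtain l :: int where l: "k = of_int l" using k(1) by (auto elim: Ints_cases)
  let ?P = "{..<N} \<times> {..<N}"
  have Ik: "avg (ek (e (of_int j))) = (if j = 0 then 1 else 0)" for j
    using integral_ek[OF eZ[of "of_int j"]] e0[of "of_int j"] by simp
  have cA: "continuous_on UNIV A" unfolding A_def by (intro continuous_intros)
  have S: "avg (\<lambda>y. ek (e (of_int j)) y * A y) = of_nat (card {p \<in> ?P. j + int (fst p) - int (snd p) = 0})" for j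
  proof -
    have "avg (\<lambda>y. ek (e (of_int j)) y * A y) = avg (\<lambda>y. \<Sum>p\<in>?P. ek (e (of_int (j + int (fst p) - int (snd p)))) y)"
      by (simp add: A_def sum_distrib_left ek_add[symmetric] ead algebra_simps)
    also have "\<dots> = (\<Sum>p\<in>?P. avg (ek (e (of_int (j + int (fst p) - int (snd p))))))"
      by (subst integral_sum) (auto intro!: integrable_cube continuous_intros)
    also have "\<dots> = (\<Sum>p\<in>?P. if j + int (fst p) - int (snd p) = 0 then 1 else 0)"
      by (simp only: Ik)
    also have "\<dots> = of_nat (card {p \<in> ?P. j + int (fst p) - int (snd p) = 0})"
      by (simp add: sum.If_cases Int_def)
    finally show ?thesis .
  qed
  have "avg (\<lambda>y. ek (e (- k)) y * ((ek (e (real N)) y - ek (e (- real N)) y) * A y))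
    = avg (\<lambda>y. ek (e (of_int (int N - l))) y * A y - ek (e (of_int (- int N - l))) y * A y)"
  proof (rule integral_cube_cong)
    fix y
    have "ek (e (of_int (int N - l))) y = ek (e (- k)) y * ek (e (real N)) y"
      "ek (e (of_int (- int N - l))) y = ek (e (- k)) y * ek (e (- real N)) y"
      using ek_add[of "e (- k)" "e (real N)" y] ek_add[of "e (- real N)" "e (- k)" y] by (simp_all add: l ead mult.commute)
    then show "ek (e (- k)) y * ((ek (e (real N)) y - ek (e (- real N)) y) * A y)
      = ek (e (of_int (int N - l))) y * A y - ek (e (of_int (- int N - l))) y * A y"
      by (simp only:) (simp add: algebra_simps)
  qed
  also have "\<dots> = avg (\<lambda>y. ek (e (of_int (int N - l))) y * A y) - avg (\<lambda>y. ek (e (of_int (- int N - l))) y * A y)"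
    by (intro integral_diff integrable_cube continuous_intros cA)
  also have "\<dots> = of_nat (card {p \<in> ?P. int N - l + int (fst p) - int (snd p) = 0}) - of_nat (card {p \<in> ?P. - int N - l + int (fst p) - int (snd p) = 0})"
    by (simp only: S)
  also have "\<dots> = complex_of_real k"
  \<comment> \<open>For l \<ge> 0 the first set consists of the pairs at distance N - l, and there
    are l of them, while the second would need a distance of at least N + l and is empty. For l < 0
    the roles change and the minus sign gives l again.\<close>
  proof (cases "l \<ge> 0")
    case True
    have lN: "l \<le> int N" using k(2) l True by simp
    have "{p \<in> ?P. int N - l + int (fst p) - int (snd p) = 0} = {p \<in> ?P. fst p + (N - nat l) = snd p}"
      using True lN by (auto simp: of_nat_diff)
    then have 1: "card {p \<in> ?P. int N - l + int (fst p) - int (snd p) = 0} = nat l"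
      using card_diff_pairs[of "N - nat l" N] True lN by simp
    have 2: "{p \<in> ?P. - int N - l + int (fst p) - int (snd p) = 0} = {}" using True by auto
    show ?thesis unfolding 1 2 using True by (simp add: l)
  next
    case False
    have lN: "- l \<le> int N" using k(2) l False by simp
    have 2: "{p \<in> ?P. int N - l + int (fst p) - int (snd p) = 0} = {}" using False by auto
    have "{p \<in> ?P. - int N - l + int (fst p) - int (snd p) = 0} = (\<lambda>p. (snd p, fst p)) ` {p \<in> ?P. fst p + (N - nat (- l)) = snd p}"
      using False lN by (auto simp: of_nat_diff image_iff)
    then have 1: "card {p \<in> ?P. - int N - l + int (fst p) - int (snd p) = 0} = nat (- l)"
      using card_diff_pairs[of "N - nat (- l)" N] False lN by (simp add: card_image inj_on_def)
    show ?thesis unfolding 1 2 using False by (simp add: l)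
  qed
  finally show ?thesis .
qed

text \<open>The one-variable Fejer argument inside the cube: y enters only through y_i, by a shift
  of x along axis i. The weight satisfies |W| \<le> 2 |g|^2, and |g|^2 has mean N by Parseval. The
  resulting factor 2N does not depend on how many frequencies F contains.\<close>

lemma bernstein_deriv:
  fixes i :: 3 and N :: nat
  assumes F: "finite F" "F \<subseteq> Zvecs" and N: "N > 0" "\<And>k. k \<in> F \<Longrightarrow> \<bar>k $ i\<bar> \<le> real N"
    and B: "\<And>x. norm (trig_sum F c x) \<le> B"
  shows "norm (trig_sum F (\<lambda>k. c k * complex_of_real (k $ i)) x) \<le> 2 * real N * B"
proof -
  define e where "e = (\<lambda>r. r *\<^sub>R (axis i 1 :: real^3))"
  define A where "A = (\<lambda>y. \<Sum>p\<in>{..<N} \<times> {..<N}. ek (e (real (fst p) - real (snd p))) y)"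
  define W where "W = (\<lambda>y. (ek (e (real N)) y - ek (e (- real N)) y) * A y)"
  define g where "g = (\<lambda>y. \<Sum>a<N. ek (e (real a)) y)"
  have cA: "continuous_on UNIV A" unfolding A_def by (intro continuous_intros)
  have cW: "continuous_on UNIV W" unfolding W_def by (intro continuous_intros cA)
  have eZ: "e a \<in> Zvecs" if "a \<in> \<int>" for a using that by (auto simp: e_def Zvecs_def axis_def)
  \<comment> \<open>The double sum is a square, so it is nonnegative and its L1 norm is simply its
    mean.\<close>
  have Ag: "A y = complex_of_real ((norm (g y))\<^sup>2)" for y
  proof -
    have "A y = (\<Sum>a<N. \<Sum>b<N. ek (e (real a)) y * cnj (ek (e (real b)) y))"
      by (simp add: A_def sum.cartesian_product case_prod_beta e_def scaleR_diff_left ek_diff)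
    also have "\<dots> = g y * cnj (g y)" by (simp add: g_def sum_product)
    finally show ?thesis by (simp only: complex_norm_square)
  qed
  have IA: "avg (\<lambda>y. (norm (g y))\<^sup>2) = real N"
  proof -
    have ge: "g = trig_sum (e ` (real ` {..<N})) (\<lambda>k. 1)"
      by (rule ext) (auto simp: g_def trig_sum_def e_def sum.reindex inj_on_def)
    have "avg (\<lambda>y. (norm (g y))\<^sup>2) = (\<Sum>k\<in>e ` (real ` {..<N}). (norm (1::complex))\<^sup>2)"
      unfolding ge by (rule parseval) (auto intro: eZ)
    also have "\<dots> = real (card (e ` (real ` {..<N})))" by simp
    also have "card (e ` (real ` {..<N})) = N" by (simp add: card_image inj_on_def e_def)
    finally show ?thesis .
  qed
  have Ek: "ek k (x - e (y $ i)) = ek k x * ek (e (- (k $ i))) y" for k y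
    by (simp add: e_def ek_def inner_diff_right inner_axis inner_axis' cis_mult algebra_simps)
  have "avg (\<lambda>y. trig_sum F c (x - e (y $ i)) * W y) = avg (\<lambda>y. \<Sum>k\<in>F. (c k * ek k x) * (ek (e (- (k $ i))) y * W y))"
    by (simp add: trig_sum_def sum_distrib_right Ek mult.assoc)
  also have "\<dots> = (\<Sum>k\<in>F. (c k * ek k x) * avg (\<lambda>y. ek (e (- (k $ i))) y * W y))"
    using F by (subst integral_sum) (auto intro!: integrable_cube continuous_intros cW)
  also have "\<dots> = (\<Sum>k\<in>F. (c k * ek k x) * complex_of_real (k $ i))"
  proof (intro sum.cong refl arg_cong2[where f="(*)"])
    fix k assume k: "k \<in> F"
    have "k $ i \<in> \<int>" using k F by (auto simp: Zvecs_def)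
    from fejer_coeff[OF N(1) this N(2)[OF k], of i]
    show "avg (\<lambda>y. ek (e (- (k $ i))) y * W y) = complex_of_real (k $ i)"
      by (simp add: e_def W_def A_def)
  qed
  also have "\<dots> = trig_sum F (\<lambda>k. c k * complex_of_real (k $ i)) x" by (simp add: trig_sum_def mult_ac)
  finally have eq: "trig_sum F (\<lambda>k. c k * complex_of_real (k $ i)) x = avg (\<lambda>y. trig_sum F c (x - e (y $ i)) * W y)" ..
  have "norm (avg (\<lambda>y. trig_sum F c (x - e (y $ i)) * W y)) \<le> avg (\<lambda>y. 2 * B * (norm (g y))\<^sup>2)"
  proof (rule integral_norm_bound_integral)
    show "(\<lambda>y. trig_sum F c (x - e (y $ i)) * W y) integrable_on cube"
      unfolding e_def by (intro integrable_cube continuous_intros cW)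
    show "(\<lambda>y. 2 * B * (norm (g y))\<^sup>2) integrable_on cube"
      unfolding g_def by (intro integrable_cube continuous_intros)
    fix y
    have "norm (W y) \<le> 2 * (norm (g y))\<^sup>2"
    proof -
      have "norm (ek (e (real N)) y - ek (e (- real N)) y) \<le> 2"
        using norm_triangle_ineq4[of "ek (e (real N)) y" "ek (e (- real N)) y"] by simp
      then show ?thesis unfolding W_def Ag norm_mult
        by (metis abs_of_nonneg mult_right_mono norm_of_real zero_le_power2)
    qed
    then have "norm (trig_sum F c (x - e (y $ i)) * W y) \<le> B * (2 * (norm (g y))\<^sup>2)"
      unfolding norm_mult using B[of "x - e (y $ i)"] order_trans[OF norm_ge_zero B] by (intro mult_mono) auto
    then show "norm (trig_sum F c (x - e (y $ i)) * W y) \<le> 2 * B * (norm (g y))\<^sup>2" by simp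
  qed
  also have "\<dots> = 2 * real N * B" by (simp add: IA)
  finally show ?thesis by (simp add: eq)
qed

lemma bernstein_axis:
  fixes i :: 3 and N :: nat
  assumes F: "finite F" "F \<subseteq> Zvecs" and N: "N > 0" "\<And>k. k \<in> F \<Longrightarrow> \<bar>k $ i\<bar> \<le> real N"
    and B: "\<And>x. norm (trig_sum F c x) \<le> B"
  shows "norm (trig_sum F c (x + t *\<^sub>R axis i 1) - trig_sum F c x) \<le> 4 * pi * real N * B * \<bar>t\<bar>"
proof -
  let ?D = "\<lambda>y. 2 * pi * \<i> * trig_sum F (\<lambda>k. c k * complex_of_real (k $ i)) y"
  have d1: "((\<lambda>h. ek k (x + h *\<^sub>R axis i 1)) has_vector_derivative (2 * pi * \<i> * complex_of_real (k $ i)) * ek k (x + h *\<^sub>R axis i 1)) (at h)" for k h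
  proof -
    have "((\<lambda>h. cis (2 * pi * (k \<bullet> (x + h *\<^sub>R axis i 1)))) has_vector_derivative (2 * pi * (k $ i)) *\<^sub>R (\<i> * cis (2 * pi * (k \<bullet> (x + h *\<^sub>R axis i 1))))) (at h)"
      unfolding inner_add_right inner_scaleR_right inner_axis cis_conv_exp
      by (rule has_vector_derivative_real_field derivative_eq_intros | simp add: scaleR_conv_of_real algebra_simps)+
    then show ?thesis by (simp add: ek_def scaleR_conv_of_real mult_ac)
  qed
  have d: "((\<lambda>h. trig_sum F c (x + h *\<^sub>R axis i 1)) has_vector_derivative ?D (x + h *\<^sub>R axis i 1)) (at h)" for h
  proof -
    have "((\<lambda>h. \<Sum>k\<in>F. c k * ek k (x + h *\<^sub>R axis i 1)) has_vector_derivative (\<Sum>k\<in>F. c k * ((2 * pi * \<i> * complex_of_real (k $ i)) * ek k (x + h *\<^sub>R axis i 1)))) (at h)"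
      by (intro has_vector_derivative_sum has_vector_derivative_mult_right d1)
    then show ?thesis by (simp add: trig_sum_def sum_distrib_left mult_ac)
  qed
  have "norm (trig_sum F c (x + t *\<^sub>R axis i 1) - trig_sum F c (x + 0 *\<^sub>R axis i 1)) \<le> (4 * pi * real N * B) * norm (t - 0)"
  proof (rule differentiable_bound[of UNIV "\<lambda>h. trig_sum F c (x + h *\<^sub>R axis i 1)" "\<lambda>h s. s *\<^sub>R ?D (x + h *\<^sub>R axis i 1)"])
    show "((\<lambda>h. trig_sum F c (x + h *\<^sub>R axis i 1)) has_derivative (\<lambda>s. s *\<^sub>R ?D (x + h *\<^sub>R axis i 1))) (at h within UNIV)" for h
      using d[of h] by (simp add: has_vector_derivative_def)
    fix h
    have "norm (?D (x + h *\<^sub>R axis i 1)) = 2 * pi * norm (trig_sum F (\<lambda>k. c k * complex_of_real (k $ i)) (x + h *\<^sub>R axis i 1))"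
      by (simp add: norm_mult)
    also have "\<dots> \<le> 2 * pi * (2 * real N * B)"
      by (intro mult_left_mono bernstein_deriv[OF F N B]) auto
    finally have "norm (?D (x + h *\<^sub>R axis i 1)) \<le> 4 * pi * real N * B" by simp
    then show "onorm (\<lambda>s. s *\<^sub>R ?D (x + h *\<^sub>R axis i 1)) \<le> 4 * pi * real N * B"
      by (intro onorm_le) (simp add: mult.commute mult_left_mono)
  qed auto
  then show ?thesis by simp
qed

text \<open>The increment is travelled along the three axes in turn, each costing 4 pi N B
  |z|.\<close>

lemma bernstein_diff:
  fixes N :: nat
  assumes F: "finite F" "F \<subseteq> Zvecs" and N: "N > 0" "\<And>k i. k \<in> F \<Longrightarrow> \<bar>k $ i\<bar> \<le> real N"
    and B: "\<And>x. norm (trig_sum F c x) \<le> B"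
  shows "norm (trig_sum F c (x + z) - trig_sum F c x) \<le> 12 * pi * real N * B * norm z"
proof -
  let ?p = "trig_sum F c" and ?K = "4 * pi * real N * B"
  have B0: "B \<ge> 0" using B order_trans norm_ge_zero by blast
  have a: "norm (?p (y + z $ i *\<^sub>R axis i 1) - ?p y) \<le> ?K * norm z" for y i
  proof -
    have "norm (?p (y + z $ i *\<^sub>R axis i 1) - ?p y) \<le> ?K * \<bar>z $ i\<bar>"
      by (rule bernstein_axis[OF F N B])
    also have "\<dots> \<le> ?K * norm z" using B0 by (intro mult_left_mono component_le_norm_cart) auto
    finally show ?thesis .
  qed
  have tri: "norm (a - d) \<le> norm (a - b) + norm (b - c) + norm (c - d)" for a b c d :: complex by norm
  have "x + z = ((x + z $ 1 *\<^sub>R axis 1 1) + z $ 2 *\<^sub>R axis 2 1) + z $ 3 *\<^sub>R axis 3 1"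
    using vec3_axis_sum[of z] by (simp add: add.assoc)
  then have "norm (?p (x + z) - ?p x) \<le> norm (?p (((x + z $ 1 *\<^sub>R axis 1 1) + z $ 2 *\<^sub>R axis 2 1) + z $ 3 *\<^sub>R axis 3 1) - ?p ((x + z $ 1 *\<^sub>R axis 1 1) + z $ 2 *\<^sub>R axis 2 1))
     + norm (?p ((x + z $ 1 *\<^sub>R axis 1 1) + z $ 2 *\<^sub>R axis 2 1) - ?p (x + z $ 1 *\<^sub>R axis 1 1)) + norm (?p (x + z $ 1 *\<^sub>R axis 1 1) - ?p x)"
    by (simp only: tri)
  also have "\<dots> \<le> ?K * norm z + ?K * norm z + ?K * norm z"
    by (intro add_mono a)
  finally show ?thesis by (simp add: mult_ac)
qed

section \<open>Littlewood-Paley blocks as finite trigonometric sums\<close>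

locale littlewood_paley =
  fixes \<kappa> \<phi> :: "real^3 \<Rightarrow> real"
  assumes LP: "LP_pair \<kappa> \<phi>"
begin

\<comment> \<open>The index n stands for the block j = n - 1.\<close>
definition lp_mult :: "nat \<Rightarrow> real^3 \<Rightarrow> real" where
  "lp_mult n k = (if n = 0 then \<kappa> k else \<phi> ((2 powr - real (n - 1)) *\<^sub>R k))"

text \<open>The outer radius of \<phi> scaled to block j = n - 1 is 8/3 * 2^(n-1) = 4/3 * 2^n; for n
  = 0 the same formula is the radius 4/3 of \<kappa>.\<close>

definition freqs :: "nat \<Rightarrow> (real^3) set" where
  "freqs n = {k \<in> Zvecs. norm k \<le> 4/3 * 2^n}"

definition fcoeff :: "(real^3 \<Rightarrow> real) \<Rightarrow> real^3 \<Rightarrow> complex" where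
  "fcoeff u k = avg (\<lambda>y. complex_of_real (u y) * ek (- k) y)"

definition block :: "nat \<Rightarrow> (real^3 \<Rightarrow> real) \<Rightarrow> real^3 \<Rightarrow> complex" where
  "block n u = trig_sum (freqs n) (\<lambda>k. complex_of_real (lp_mult n k) * fcoeff u k)"

lemma lp_mult_supp:
  assumes nz: "lp_mult n k \<noteq> 0" shows "norm k \<le> 4/3 * 2^n"
proof (cases n)
  case 0
  then have "\<kappa> k \<noteq> 0" using nz by (simp add: lp_mult_def)
  then have "k \<in> closure {\<xi>. \<kappa> \<xi> \<noteq> 0}" by (intro subsetD[OF closure_subset]) simp
  then have "k \<in> cball 0 (4/3)" using LP unfolding LP_pair_def by blast
  then show ?thesis using 0 by simp
next
  case (Suc m)
  then have "\<phi> ((2 powr - real m) *\<^sub>R k) \<noteq> 0" using nz by (simp add: lp_mult_def)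
  then have "(2 powr - real m) *\<^sub>R k \<in> closure {\<xi>. \<phi> \<xi> \<noteq> 0}" by (intro subsetD[OF closure_subset]) simp
  then have "norm ((2 powr - real m) *\<^sub>R k) \<le> 8/3" using LP unfolding LP_pair_def by blast
  then show ?thesis by (simp add: Suc powr_minus powr_realpow field_simps)
qed

lemma freqs_Zvecs: "freqs n \<subseteq> Zvecs" by (auto simp: freqs_def)

lemma finite_freqs: "finite (freqs n)"
proof -
  define M :: int where "M = \<lceil>4/3 * 2^n :: real\<rceil>"
  define G where "G = (\<lambda>f::3 \<Rightarrow> int. (\<chi> i. real_of_int (f i)) :: real^3) ` (UNIV \<rightarrow>\<^sub>E {-M..M})"
  have "finite G" unfolding G_def by (intro finite_imageI finite_PiE) auto
  moreover have "freqs n \<subseteq> G"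
  proof
    fix k assume k: "k \<in> freqs n"
    have ki: "k $ i = real_of_int \<lfloor>k $ i\<rfloor>" for i using k by (auto simp: freqs_def Zvecs_def)
    have "\<bar>k $ i\<bar> \<le> 4/3 * 2^n" for i using k component_le_norm_cart[of k i] by (simp add: freqs_def)
    then have "\<bar>real_of_int \<lfloor>k $ i\<rfloor>\<bar> \<le> real_of_int M" for i
      using ki[of i] le_of_int_ceiling[of "4/3 * 2^n :: real"] unfolding M_def by (metis order_trans)
    then have "\<bar>\<lfloor>k $ i\<rfloor>\<bar> \<le> M" for i by (metis of_int_abs of_int_le_iff)
    then have "\<lfloor>k $ i\<rfloor> \<in> {-M..M}" for i by (metis abs_le_D1 abs_le_D2 atLeastAtMost_iff minus_le_iff)
    then show "k \<in> G" unfolding G_def using ki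
      by (intro image_eqI[of _ _ "\<lambda>i. \<lfloor>k $ i\<rfloor>"]) (auto simp: vec_eq_iff)
  qed
  ultimately show ?thesis by (rule rev_finite_subset)
qed

lemma fourier_coeff_eq: "fourier_coeff (\<lambda>y. complex_of_real (u y)) k = fcoeff u k"
  unfolding fourier_coeff_def fcoeff_def ek_def cis_conv_exp
  by (simp add: mult_ac)

text \<open>The multiplier vanishes outside \<open>freqs n\<close>, a finite set, so the infinite
  lattice sum collapses to a finite one.\<close>

lemma LP_block_eq: "LP_block \<kappa> \<phi> (int n - 1) u = block n u"
proof
  fix x
  have e: "exp (2 * pi * \<i> * complex_of_real (k \<bullet> x)) = ek k x" for k
    by (simp add: ek_def cis_conv_exp mult_ac)
  have m: "(if int n - 1 = -1 then \<kappa> k else \<phi> ((2 powr - real_of_int (int n - 1)) *\<^sub>R k)) = lp_mult n k" for k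
    by (cases n) (auto simp: lp_mult_def)
  have "LP_block \<kappa> \<phi> (int n - 1) u x = infsum (\<lambda>k. complex_of_real (lp_mult n k) * fcoeff u k * ek k x) Zvecs"
    unfolding LP_block_def m fourier_coeff_eq e by simp
  also have "\<dots> = infsum (\<lambda>k. complex_of_real (lp_mult n k) * fcoeff u k * ek k x) (freqs n)"
    using lp_mult_supp[of n] by (intro infsum_cong_neutral) (auto simp: freqs_def)
  also have "\<dots> = block n u x" by (simp add: finite_freqs block_def trig_sum_def)
  finally show "LP_block \<kappa> \<phi> (int n - 1) u x = block n u x" .
qed

text \<open>At a fixed frequency the partition of unity is complete after finitely many terms:
  \<phi>(2^(-j) k) vanishes once 3/4 * 2^j exceeds |k|.\<close>

lemma lp_mult_sum: "\<exists>N0. \<forall>N\<ge>N0. (\<Sum>n<N. lp_mult n k) = 1"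
proof -
  obtain J :: nat where J: "norm k < 2 ^ J * (3/4)"
    using real_arch_pow[of 2 "norm k * 4 / 3"] by (auto simp: field_simps)
  have z: "\<phi> ((2 powr - real j) *\<^sub>R k) = 0" if "j \<ge> J" for j
  proof (rule ccontr)
    assume "\<phi> ((2 powr - real j) *\<^sub>R k) \<noteq> 0"
    then have "(2 powr - real j) *\<^sub>R k \<in> closure {\<xi>. \<phi> \<xi> \<noteq> 0}" by (intro subsetD[OF closure_subset]) simp
    then have "norm ((2 powr - real j) *\<^sub>R k) \<ge> 3/4" using LP unfolding LP_pair_def by blast
    then have "2 ^ j * (3/4) \<le> norm k" by (simp add: powr_minus powr_realpow field_simps)
    moreover have "(2::real) ^ J \<le> 2 ^ j" using that by simp
    ultimately show False using J by linarith
  qed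
  have "(\<Sum>n<N. lp_mult n k) = 1" if N: "N \<ge> Suc J" for N
  proof -
    obtain M where M: "N = Suc M" "M \<ge> J" using N by (cases N) auto
    have "(\<Sum>n<N. lp_mult n k) = \<kappa> k + (\<Sum>j<M. \<phi> ((2 powr - real j) *\<^sub>R k))"
      unfolding M(1) sum.lessThan_Suc_shift by (simp add: lp_mult_def)
    also have "(\<Sum>j<M. \<phi> ((2 powr - real j) *\<^sub>R k)) = (\<Sum>j. \<phi> ((2 powr - real j) *\<^sub>R k))"
      using z M by (intro suminf_finite[symmetric]) auto
    also have "\<kappa> k + \<dots> = 1" using LP unfolding LP_pair_def by blast
    finally show ?thesis .
  qed
  then show ?thesis by blast
qed

lemma cper_block: "cper (block n u)" unfolding block_def by (rule cper_trig_sum[OF freqs_Zvecs])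

lemma fourier_block: "k \<in> Zvecs \<Longrightarrow> avg (\<lambda>y. block n u y * ek (- k) y) = complex_of_real (lp_mult n k) * fcoeff u k"
  unfolding block_def using lp_mult_supp[of n k] by (subst fourier_trig_sum[OF finite_freqs freqs_Zvecs]) (auto simp: freqs_def)

text \<open>A trigonometric kernel sees finitely many frequencies, and at each of them finitely many
  blocks add up to one. The decomposition is therefore exact and raises no question of convergence.
  The threshold form lets two kernels be added by taking the larger threshold.\<close>

lemma conv_block_sum:
  assumes K: "trig_poly K" and u: "cper u"
  shows "\<exists>N0. \<forall>N\<ge>N0. \<forall>x. avg (\<lambda>y. K (x - y) * complex_of_real (u y)) = (\<Sum>n<N. avg (\<lambda>y. K (x - y) * block n u y))"
  using K
proof (induction rule: trig_poly.induct)
  case (trig_poly_ek k c)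
  obtain N0 where N0: "\<And>N. N \<ge> N0 \<Longrightarrow> (\<Sum>n<N. lp_mult n k) = 1" using lp_mult_sum by blast
  have cu: "continuous_on UNIV (\<lambda>y. complex_of_real (u y))" by (intro continuous_intros cper_cont[OF u])
  have cb: "continuous_on UNIV (block n u)" for n by (rule cper_cont[OF cper_block])
  have "avg (\<lambda>y. (c * ek k (x - y)) * complex_of_real (u y)) = (\<Sum>n<N. avg (\<lambda>y. (c * ek k (x - y)) * block n u y))"
    if "N \<ge> N0" for N x
  proof -
    have "(\<Sum>n<N. avg (\<lambda>y. (c * ek k (x - y)) * block n u y)) = (\<Sum>n<N. (c * fcoeff u k * ek k x) * complex_of_real (lp_mult n k))"
      unfolding conv_trig_poly_ek[OF cb] fourier_block[OF trig_poly_ek] by (simp add: mult_ac)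
    also have "\<dots> = (c * fcoeff u k * ek k x) * complex_of_real (\<Sum>n<N. lp_mult n k)"
      by (simp add: sum_distrib_left)
    also have "\<dots> = avg (\<lambda>y. (c * ek k (x - y)) * complex_of_real (u y))"
      by (simp add: N0[OF that] conv_trig_poly_ek[OF cu] fcoeff_def)
    finally show ?thesis ..
  qed
  then show ?case by blast
next
  case (trig_poly_add f g)
  then obtain N1 N2 where N:
    "\<And>N x. N \<ge> N1 \<Longrightarrow> avg (\<lambda>y. f (x - y) * complex_of_real (u y)) = (\<Sum>n<N. avg (\<lambda>y. f (x - y) * block n u y))"
    "\<And>N x. N \<ge> N2 \<Longrightarrow> avg (\<lambda>y. g (x - y) * complex_of_real (u y)) = (\<Sum>n<N. avg (\<lambda>y. g (x - y) * block n u y))"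
    by blast
  have fg: "continuous_on UNIV f" "continuous_on UNIV g" using trig_poly_add trig_poly_cper cper_cont by auto
  have spl: "avg (\<lambda>y. (f (x - y) + g (x - y)) * w y) = avg (\<lambda>y. f (x - y) * w y) + avg (\<lambda>y. g (x - y) * w y)"
    if "continuous_on UNIV w" for x w
    unfolding distrib_right
    by (intro integral_add integrable_cube continuous_intros that cont_UNIV_compose[OF fg(1)] cont_UNIV_compose[OF fg(2)])
  have "avg (\<lambda>y. (f (x - y) + g (x - y)) * complex_of_real (u y)) = (\<Sum>n<N. avg (\<lambda>y. (f (x - y) + g (x - y)) * block n u y))"
    if "N \<ge> max N1 N2" for N x
    using that N(1)[of N x] N(2)[of N x] by (simp add: spl cper_cont[OF u] cper_cont[OF cper_block] continuous_intros sum.distrib)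
  then show ?case by blast
qed

lemma conv_diff_sum:
  assumes u: "cper u"
  shows "\<exists>N. \<forall>x z. complex_of_real (conv (ker m) u (x + z) - conv (ker m) u x) = (\<Sum>n<N. conv (ker m) (\<lambda>y. block n u (y + z) - block n u y) x)"
proof -
  obtain N where N: "\<And>x. avg (\<lambda>y. complex_of_real (ker m (x - y)) * complex_of_real (u y)) = (\<Sum>n<N. avg (\<lambda>y. complex_of_real (ker m (x - y)) * block n u y))"
    using conv_block_sum[OF ker_trig_poly[of m] u] by blast
  then have N': "complex_of_real (conv (ker m) u x) = (\<Sum>n<N. conv (ker m) (block n u) x)" for x
    by (simp only: conv_of_real[OF cper_cont[OF u]] conv_def[of _ "block _ u"] scaleR_conv_of_real)
  have cb: "continuous_on UNIV (block n u)" for n by (rule cper_cont[OF cper_block])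
  have "conv (ker m) (block n u) (x + z) - conv (ker m) (block n u) x = conv (ker m) (\<lambda>y. block n u (y + z) - block n u y) x" for n x z
  proof -
    have "conv (ker m) (\<lambda>y. block n u (y + z) - block n u y) x = avg (\<lambda>w. ker m w *\<^sub>R block n u (x + w + z) - ker m w *\<^sub>R block n u (x + w))"
      by (subst conv_ker_shift) (auto intro!: cper_diff cper_shift[OF cper_block] cper_block simp: scaleR_right_diff_distrib)
    also have "\<dots> = avg (\<lambda>w. ker m w *\<^sub>R block n u (x + w + z)) - avg (\<lambda>w. ker m w *\<^sub>R block n u (x + w))"
      by (intro integral_diff integrable_cube continuous_intros cont_UNIV_compose[OF cb])
    finally show ?thesis by (simp add: conv_ker_shift[OF cper_block] add_ac)
  qed
  then show ?thesis by (intro exI[of _ N]) (simp add: N' sum_subtractf[symmetric])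
qed

text \<open>The frequencies have coordinates at most 4/3 * 2^n \<le> 2^(n+1), so Bernstein applies
  with N = 2^(n+1), and 12 pi N = 24 pi 2^n. For large increments the trivial bound 2a is better,
  hence the minimum.\<close>

lemma block_diff_sup:
  assumes "\<And>x. norm (block n u x) \<le> a"
  shows "norm (block n u (x + z) - block n u x) \<le> min 2 (24 * pi * 2^n * norm z) * a"
proof -
  have "a \<ge> 0" using assms order_trans norm_ge_zero by blast
  have "norm (block n u (x + z) - block n u x) \<le> 12 * pi * real (2^(n+1)) * a * norm z"
    unfolding block_def
  proof (rule bernstein_diff[OF finite_freqs freqs_Zvecs])
    fix k i assume "k \<in> freqs n"
    then have "\<bar>k $ i\<bar> \<le> 4/3 * 2^n" using component_le_norm_cart[of k i] by (simp add: freqs_def)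
    also have "4/3 * 2^n \<le> (2 * 2^n :: real)" by simp
    finally show "\<bar>k $ i\<bar> \<le> real (2^(n+1))" by simp
  qed (use assms in \<open>auto simp: block_def\<close>)
  moreover have "norm (block n u (x + z) - block n u x) \<le> 2 * a"
    using norm_triangle_ineq4[of "block n u (x + z)" "block n u x"] assms[of "x + z"] assms[of x] by linarith
  ultimately show ?thesis by (simp add: min_def mult_ac)
qed

lemma conv_diff_sup:
  assumes u: "cper u" and a: "\<And>n x. norm (block n u x) \<le> a n"
  shows "\<exists>N. \<forall>x. \<bar>conv (ker m) u (x + z) - conv (ker m) u x\<bar> \<le> (\<Sum>n<N. min 2 (24 * pi * 2^n * norm z) * a n)"
proof -
  obtain N where N: "\<And>x. complex_of_real (conv (ker m) u (x + z) - conv (ker m) u x) = (\<Sum>n<N. conv (ker m) (\<lambda>y. block n u (y + z) - block n u y) x)"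
    using conv_diff_sum[OF u, of m] by blast
  have "\<bar>conv (ker m) u (x + z) - conv (ker m) u x\<bar> \<le> (\<Sum>n<N. min 2 (24 * pi * 2^n * norm z) * a n)" for x
  proof -
    have "\<bar>conv (ker m) u (x + z) - conv (ker m) u x\<bar> = norm (\<Sum>n<N. conv (ker m) (\<lambda>y. block n u (y + z) - block n u y) x)"
      unfolding N[symmetric] norm_of_real ..
    also have "\<dots> \<le> (\<Sum>n<N. min 2 (24 * pi * 2^n * norm z) * a n)"
      by (intro sum_norm_le norm_conv_ker_le cper_diff cper_shift[OF cper_block] cper_block block_diff_sup a)
    finally show ?thesis .
  qed
  then show ?thesis by blast
qed

lemma norm_ek_minus_1: "norm (ek k z - 1) \<le> min 2 (2 * pi * norm k * norm z)"
proof -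
  have "norm (ek k z - 1) \<le> \<bar>2 * pi * (k \<bullet> z)\<bar>"
    unfolding ek_def cis_conv_exp dist_exp_i_1 using abs_sin_x_le_abs_x[of "2 * pi * (k \<bullet> z) / 2"] by simp
  also have "\<dots> \<le> 2 * pi * (norm k * norm z)"
    unfolding abs_mult using Cauchy_Schwarz_ineq2[of k z] by (simp add: mult_left_mono)
  finally show ?thesis using norm_triangle_ineq4[of "ek k z" 1] by (simp add: mult_ac)
qed

lemma norm_fourier_ker: "norm (avg (\<lambda>y. complex_of_real (ker m y) * ek k y)) \<le> 1"
  using norm_integral_ker_le[of "ek k" "\<lambda>_. 1" m] by (simp add: scaleR_conv_of_real continuous_intros)

text \<open>In L2 Parseval replaces Bernstein: shifting multiplies the coefficient at k by e_k(z) -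
  1, and mollifying multiplies it by a Fourier coefficient of the kernel, of modulus at most
  1.\<close>

lemma conv_diff_L2:
  assumes u: "cper u" and a: "\<And>n. avg (\<lambda>x. (norm (block n u x))\<^sup>2) \<le> (a n)\<^sup>2" and a0: "\<And>n. 0 \<le> a n"
  shows "\<exists>N. avg (\<lambda>x. (conv (ker m) u (x + z) - conv (ker m) u x)\<^sup>2) \<le> (\<Sum>n<N. min 2 (24 * pi * 2^n * norm z) * a n)\<^sup>2"
proof -
  obtain N where N: "\<And>x. complex_of_real (conv (ker m) u (x + z) - conv (ker m) u x) = (\<Sum>n<N. conv (ker m) (\<lambda>y. block n u (y + z) - block n u y) x)"
    using conv_diff_sum[OF u, of m] by blast
  define kh where "kh = (\<lambda>k. avg (\<lambda>y. complex_of_real (ker m y) * ek k y))"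
  define d where "d = (\<lambda>n k. complex_of_real (lp_mult n k) * fcoeff u k * (ek k z - 1) * kh k)"
  have eq: "conv (ker m) (\<lambda>y. block n u (y + z) - block n u y) x = trig_sum (freqs n) (d n) x" for n x
  proof -
    have "conv (ker m) (\<lambda>y. block n u (y + z) - block n u y) x = avg (\<lambda>w. complex_of_real (ker m w) * (block n u (x + w + z) - block n u (x + w)))"
      by (subst conv_ker_shift) (auto intro!: cper_diff cper_shift[OF cper_block] cper_block simp: scaleR_conv_of_real)
    also have "\<dots> = avg (\<lambda>w. \<Sum>k\<in>freqs n. (complex_of_real (lp_mult n k) * fcoeff u k * (ek k z - 1) * ek k x) * (complex_of_real (ker m w) * ek k w))"
      unfolding block_def trig_sum_shift trig_sum_diff trig_sum_def
      by (simp add: sum_distrib_left ek_add_right algebra_simps sum_subtractf)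
    also have "\<dots> = (\<Sum>k\<in>freqs n. (complex_of_real (lp_mult n k) * fcoeff u k * (ek k z - 1) * ek k x) * kh k)"
      unfolding kh_def by (subst integral_sum) (auto intro!: integrable_cube continuous_intros finite_freqs)
    finally show ?thesis by (simp add: trig_sum_def d_def mult_ac)
  qed
  have "avg (\<lambda>x. (norm (\<Sum>n<N. trig_sum (freqs n) (d n) x))\<^sup>2) \<le> (\<Sum>n<N. min 2 (24 * pi * 2^n * norm z) * a n)\<^sup>2"
  proof (rule integral_norm2_sum_le)
    fix n
    have "avg (\<lambda>x. (norm (trig_sum (freqs n) (d n) x))\<^sup>2) = (\<Sum>k\<in>freqs n. (norm (d n k))\<^sup>2)"
      by (rule parseval[OF finite_freqs freqs_Zvecs])
    also have "\<dots> \<le> (\<Sum>k\<in>freqs n. (min 2 (24 * pi * 2^n * norm z))\<^sup>2 * (norm (complex_of_real (lp_mult n k) * fcoeff u k))\<^sup>2)"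
    proof (rule sum_mono)
      fix k assume k: "k \<in> freqs n"
      have "norm (ek k z - 1) \<le> min 2 (2 * pi * norm k * norm z)" by (rule norm_ek_minus_1)
      \<comment> \<open>The constant is enlarged to that of the sup-norm estimate, so that one
        dyadic sum serves both.\<close>
      also have "\<dots> \<le> min 2 (24 * pi * 2^n * norm z)"
      proof (intro min.mono order_refl mult_right_mono)
        have "norm k \<le> 4/3 * 2^n" using k by (simp add: freqs_def)
        also have "\<dots> \<le> 12 * 2^n" by simp
        finally show "2 * pi * norm k \<le> 24 * pi * 2^n" using mult_left_mono[of "norm k" "12 * 2^n" "2 * pi"] by simp
      qed auto
      finally have "norm (ek k z - 1) * norm (kh k) \<le> min 2 (24 * pi * 2^n * norm z) * 1"
        using norm_fourier_ker[of m k] unfolding kh_def by (intro mult_mono) auto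
      then have "norm (d n k) \<le> min 2 (24 * pi * 2^n * norm z) * norm (complex_of_real (lp_mult n k) * fcoeff u k)"
        unfolding d_def norm_mult using mult_left_mono[of "cmod (ek k z - 1) * cmod (kh k)" "min 2 (24 * pi * 2^n * norm z) * 1" "norm (complex_of_real (lp_mult n k)) * norm (fcoeff u k)"]
        by (simp add: mult_ac del: min_less_iff_conj min.bounded_iff)
      then show "(norm (d n k))\<^sup>2 \<le> (min 2 (24 * pi * 2^n * norm z))\<^sup>2 * (norm (complex_of_real (lp_mult n k) * fcoeff u k))\<^sup>2"
        unfolding power_mult_distrib[symmetric] by (intro power_mono) auto
    qed
    also have "\<dots> = (min 2 (24 * pi * 2^n * norm z))\<^sup>2 * avg (\<lambda>x. (norm (block n u x))\<^sup>2)"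
      unfolding block_def by (simp only: parseval[OF finite_freqs freqs_Zvecs] sum_distrib_left)
    also have "\<dots> \<le> (min 2 (24 * pi * 2^n * norm z))\<^sup>2 * (a n)\<^sup>2" by (intro mult_left_mono a) auto
    finally show "avg (\<lambda>x. (norm (trig_sum (freqs n) (d n) x))\<^sup>2) \<le> (min 2 (24 * pi * 2^n * norm z) * a n)\<^sup>2"
      by (simp add: power_mult_distrib)
    show "continuous_on UNIV (trig_sum (freqs n) (d n))" by (rule cper_cont[OF cper_trig_sum[OF freqs_Zvecs]])
    show "0 \<le> min 2 (24 * pi * 2^n * norm z) * a n" using a0[of n] by simp
  qed
  moreover have "(norm (\<Sum>n<N. trig_sum (freqs n) (d n) x))\<^sup>2 = (conv (ker m) u (x + z) - conv (ker m) u x)\<^sup>2" for x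
    unfolding eq[symmetric] N[symmetric] norm_of_real by simp
  ultimately show ?thesis by (intro exI[of _ N]) simp
qed

end

section \<open>Hoelder bounds from block bounds\<close>

text \<open>The sum is split where 2^n h passes 1. Below, 2^n h 2^(-n/3) grows geometrically with
  ratio \<open>\<sigma>\<close> = 2^(2/3); above, 2^(-n/3) decays with ratio \<open>\<rho>\<close> =
  2^(-1/3). Either part is comparable to its term at the splitting index, which is of size
  h^(1/3).\<close>

lemma dyadic_sum:
  fixes C :: real assumes C: "C \<ge> 0"
  obtains D where "D > 0" "\<And>h N. h \<ge> 0 \<Longrightarrow> (\<Sum>n<N. min 2 (C * 2^n * h) * 2 powr (- (real n / 3))) \<le> D * h powr (1/3)"
proof -
  define r :: real where "r = 2 powr (1/3)"
  have r: "r > 1" by (simp add: r_def)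
  have r3: "r ^ 3 = 2" unfolding r_def by (simp add: powr_power)
  define \<rho> where "\<rho> = 1 / r"
  define \<sigma> where "\<sigma> = r\<^sup>2"
  have \<rho>: "0 < \<rho>" "\<rho> < 1" using r by (auto simp: \<rho>_def)
  have \<sigma>: "1 < \<sigma>" using r by (simp add: \<sigma>_def)
  have rn: "2 powr (- (real n / 3)) = \<rho> ^ n" for n
    unfolding \<rho>_def r_def by (simp add: powr_minus power_divide powr_power field_simps)
  have s1: "(\<Sum>n<N. if n < M then \<sigma> ^ n else 0) \<le> \<sigma> ^ min N M / (\<sigma> - 1)" for N M
  proof (induction N)
    case 0 then show ?case using \<sigma> by simp
  next
    case (Suc N)
    show ?case
    proof (cases "N < M")
      case True
      then have "(\<Sum>n<Suc N. if n < M then \<sigma> ^ n else 0) \<le> \<sigma> ^ N / (\<sigma> - 1) + \<sigma> ^ N" using Suc by (simp add: min_def)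
      also have "\<dots> = \<sigma> ^ Suc N / (\<sigma> - 1)" using \<sigma> by (simp add: field_simps)
      finally show ?thesis using True by (simp add: min_def)
    next
      case False
      then show ?thesis using Suc by (simp add: min_def split: if_splits)
    qed
  qed
  \<comment> \<open>The geometric tail is carried along on the left so that the induction closes;
    dropping it later gives the bound on the partial sum.\<close>
  have s2: "(\<Sum>n<N. if n < M then 0 else \<rho> ^ n) + \<rho> ^ max N M / (1 - \<rho>) \<le> \<rho> ^ M / (1 - \<rho>)" for N M
  proof (induction N)
    case 0 then show ?case by simp
  next
    case (Suc N)
    show ?case
    proof (cases "N < M")
      case True then show ?thesis using Suc by (simp add: max_def)
    next
      case False
      have "\<rho> ^ N + \<rho> ^ Suc N / (1 - \<rho>) = \<rho> ^ N / (1 - \<rho>)" using \<rho> by (simp add: field_simps)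
      then show ?thesis using Suc False by (simp add: max_def split: if_splits)
    qed
  qed
  define D where "D = C * \<sigma> / (\<sigma> - 1) + 2 / (1 - \<rho>)"
  have D: "D > 0" unfolding D_def using C \<sigma> \<rho> by (intro add_nonneg_pos) auto
  have "(\<Sum>n<N. min 2 (C * 2^n * h) * 2 powr (- (real n / 3))) \<le> D * h powr (1/3)" if h: "h \<ge> 0" for h N
  proof (cases "h = 0")
    case True then show ?thesis by simp
  next
    case False
    then have h: "h > 0" using h by simp
    define x where "x = h powr (1/3)"
    have x: "x > 0" using h by (simp add: x_def)
    have x3: "x ^ 3 = h" unfolding x_def using h by (simp add: powr_power)
    have ex: "\<exists>M. r ^ M * x > 1" using real_arch_pow[OF r, of "1 / x"] x by (auto simp: field_simps)
    \<comment> \<open>The first index with 2^M h > 1, expressed through the cube roots r and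
      x.\<close>
    define M where "M = (LEAST M. r ^ M * x > 1)"
    have M1: "r ^ M * x > 1" unfolding M_def using LeastI_ex[OF ex] .
    have M2: "r ^ n * x \<le> 1" if "n < M" for n using not_less_Least[of n "\<lambda>M. r ^ M * x > 1"] that by (simp add: M_def)
    have p2: "(2::real) ^ n * \<rho> ^ n = \<sigma> ^ n" for n
    proof -
      have "2 * \<rho> = \<sigma>" using r3 r by (simp add: \<rho>_def \<sigma>_def power2_eq_square power3_eq_cube field_simps)
      then show ?thesis by (simp add: power_mult_distrib[symmetric])
    qed
    have trm: "min 2 (C * 2^n * h) * \<rho> ^ n \<le> C * h * (if n < M then \<sigma> ^ n else 0) + 2 * (if n < M then 0 else \<rho> ^ n)" for n
    proof (cases "n < M")
      case True
      have "min 2 (C * 2^n * h) * \<rho> ^ n \<le> (C * 2^n * h) * \<rho> ^ n" using \<rho> by (intro mult_right_mono) auto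
      also have "\<dots> = C * h * \<sigma> ^ n" by (simp add: p2[symmetric])
      finally show ?thesis using True by simp
    next
      case False
      then show ?thesis using \<rho> by simp
    qed
    have "(\<Sum>n<N. min 2 (C * 2^n * h) * 2 powr (- (real n / 3))) \<le> (\<Sum>n<N. C * h * (if n < M then \<sigma> ^ n else 0) + 2 * (if n < M then 0 else \<rho> ^ n))"
      unfolding rn by (intro sum_mono trm)
    also have "\<dots> = C * h * (\<Sum>n<N. if n < M then \<sigma> ^ n else 0) + 2 * (\<Sum>n<N. if n < M then 0 else \<rho> ^ n)"
      by (simp add: sum.distrib sum_distrib_left)
    also have "\<dots> \<le> C * \<sigma> / (\<sigma> - 1) * x + 2 / (1 - \<rho>) * x"
    proof (intro add_mono)
      show "C * h * (\<Sum>n<N. if n < M then \<sigma> ^ n else 0) \<le> C * \<sigma> / (\<sigma> - 1) * x"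
      proof (cases "M = 0")
        case True then show ?thesis using C \<sigma> x by simp
      next
        case False
        have "r ^ M * x \<le> r"
          using M2[of "M - 1"] False r mult_left_mono[of "r ^ (M - 1) * x" 1 r] by (cases M) auto
        then have "(r ^ M * x)\<^sup>2 \<le> r\<^sup>2" using r x by (intro power_mono) auto
        then have a: "\<sigma> ^ M * x\<^sup>2 \<le> \<sigma>" by (simp add: \<sigma>_def power_mult_distrib power_mult[symmetric] mult.commute)
        have "(\<Sum>n<N. if n < M then \<sigma> ^ n else 0) \<le> \<sigma> ^ M / (\<sigma> - 1)"
          by (rule order_trans[OF s1]) (use \<sigma> in \<open>auto intro!: divide_right_mono power_increasing\<close>)
        then have "C * h * (\<Sum>n<N. if n < M then \<sigma> ^ n else 0) \<le> C * h * (\<sigma> ^ M / (\<sigma> - 1))"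
          using C h by (intro mult_left_mono) auto
        also have "\<dots> = C * x / (\<sigma> - 1) * (\<sigma> ^ M * x\<^sup>2)" by (simp add: x3[symmetric] power2_eq_square power3_eq_cube)
        also have "\<dots> \<le> C * x / (\<sigma> - 1) * \<sigma>" using a C x \<sigma> by (intro mult_left_mono) auto
        finally show ?thesis by (simp add: mult_ac)
      qed
      have "(\<Sum>n<N. if n < M then 0 else \<rho> ^ n) \<le> \<rho> ^ M / (1 - \<rho>)"
        using s2[of M N] \<rho> zero_le_power[of \<rho> "max N M"] by (smt (verit) divide_nonneg_pos)
      also have "\<dots> \<le> x / (1 - \<rho>)"
        using M1 \<rho> r by (intro divide_right_mono) (auto simp: \<rho>_def power_divide field_simps)
      finally show "2 * (\<Sum>n<N. if n < M then 0 else \<rho> ^ n) \<le> 2 / (1 - \<rho>) * x" by simp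
    qed
    also have "\<dots> = D * h powr (1/3)" by (simp add: D_def x_def distrib_right)
    finally show ?thesis .
  qed
  then show ?thesis using that D by blast
qed

text \<open>One absolute constant for the slope 24 pi of the block estimates, chosen once so that
  the later bounds can display their dependence on the data.\<close>

definition holder_const :: real where
  "holder_const = (SOME D. D > 0 \<and> (\<forall>h N. h \<ge> 0 \<longrightarrow> (\<Sum>n<N. min 2 (24 * pi * 2^n * h) * 2 powr (- (real n / 3))) \<le> D * h powr (1/3)))"

lemma holder_const: "holder_const > 0" "h \<ge> 0 \<Longrightarrow> (\<Sum>n<N. min 2 (24 * pi * 2^n * h) * 2 powr (- (real n / 3))) \<le> holder_const * h powr (1/3)"
proof -
  obtain D where "D > 0" "\<And>h N. h \<ge> 0 \<Longrightarrow> (\<Sum>n<N. min 2 (24 * pi * 2^n * h) * 2 powr (- (real n / 3))) \<le> D * h powr (1/3)"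
    using dyadic_sum[of "24 * pi"] by auto
  then have "\<exists>D. D > 0 \<and> (\<forall>h N. h \<ge> 0 \<longrightarrow> (\<Sum>n<N. min 2 (24 * pi * 2^n * h) * 2 powr (- (real n / 3))) \<le> D * h powr (1/3))" by blast
  from someI_ex[OF this] show "holder_const > 0" "h \<ge> 0 \<Longrightarrow> (\<Sum>n<N. min 2 (24 * pi * 2^n * h) * 2 powr (- (real n / 3))) \<le> holder_const * h powr (1/3)"
    unfolding holder_const_def by blast+
qed

lemma conv_ker_tendsto:
  fixes u :: "real^3 \<Rightarrow> 'b::banach"
  assumes "cper u" shows "(\<lambda>m. conv (ker m) u x) \<longlonglongrightarrow> u x"
  using tendsto_uniform_limitI[OF conv_ker_uniform_limit[OF assms]] by simp

context littlewood_paley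
begin

text \<open>The number of blocks needed varies with the kernel, but W bounds all partial sums, so
  the estimate for the mollified increments passes to the limit.\<close>

lemma holder_sup_gen:
  assumes u: "cper u" and a: "\<And>n x. norm (block n u x) \<le> a n"
    and W: "\<And>N. (\<Sum>n<N. min 2 (24 * pi * 2^n * norm z) * a n) \<le> W"
  shows "\<bar>u (x + z) - u x\<bar> \<le> W"
proof (rule tendsto_upperbound)
  show "(\<lambda>m. \<bar>conv (ker m) u (x + z) - conv (ker m) u x\<bar>) \<longlonglongrightarrow> \<bar>u (x + z) - u x\<bar>"
    by (intro tendsto_intros conv_ker_tendsto u)
  show "\<forall>\<^sub>F m in sequentially. \<bar>conv (ker m) u (x + z) - conv (ker m) u x\<bar> \<le> W"
    using conv_diff_sup[OF u a, of _ z] W order_trans by (intro always_eventually allI) blast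
qed auto

lemma holder_sup:
  assumes u: "cper u" and a: "\<And>n x. norm (block n u x) \<le> A * 2 powr (- (real n / 3))"
  shows "\<bar>u (x + z) - u x\<bar> \<le> holder_const * A * norm z powr (1/3)"
proof (rule holder_sup_gen[OF u a])
  have A: "A \<ge> 0" using order_trans[OF norm_ge_zero a[of 0 0]] by simp
  fix N
  have "(\<Sum>n<N. min 2 (24 * pi * 2^n * norm z) * (A * 2 powr (- (real n / 3)))) = A * (\<Sum>n<N. min 2 (24 * pi * 2^n * norm z) * 2 powr (- (real n / 3)))"
    by (simp add: sum_distrib_left mult_ac)
  also have "\<dots> \<le> A * (holder_const * norm z powr (1/3))" using A by (intro mult_left_mono holder_const) auto
  finally show "(\<Sum>n<N. min 2 (24 * pi * 2^n * norm z) * (A * 2 powr (- (real n / 3)))) \<le> holder_const * A * norm z powr (1/3)"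
    by (simp add: mult_ac)
qed

text \<open>Blocks from J on have coefficients at most e' and contribute at most half of e |z|^(1/3)
  by the dyadic sum. The finitely many blocks below J are Lipschitz with total constant
  \<open>G\<close>, and a linear bound is below the other half once |z| is small.\<close>

lemma holder_sup_little:
  assumes u: "cper u" and b: "\<And>n x. norm (block n u x) \<le> b n * 2 powr (- (real n / 3))" and b0: "b \<longlonglongrightarrow> 0"
    and e: "e > 0"
  obtains d where "d > 0" "\<And>x z. norm z < d \<Longrightarrow> \<bar>u (x + z) - u x\<bar> \<le> e * norm z powr (1/3)"
proof -
  define e' where "e' = e / (2 * holder_const)"
  have e': "e' > 0" using e holder_const by (simp add: e'_def)
  obtain J where J: "\<And>n. n \<ge> J \<Longrightarrow> b n \<le> e'"
    using order_tendstoD(2)[OF b0 e'] unfolding eventually_sequentially by (meson less_imp_le)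
  obtain B where B: "B > 0" "\<And>n. \<bar>b n\<bar> \<le> B"
    using Bseq_def[of b] convergent_imp_Bseq[of b] b0 by (auto simp: convergent_def)
  define G where "G = B * (24 * pi) * 2 ^ J"
  have G: "G > 0" using B by (simp add: G_def)
  \<comment> \<open>The solution of G d^(2/3) = e/2.\<close>
  define d where "d = (e / (2 * G)) powr (3/2)"
  have d: "d > 0" using e G by (simp add: d_def)
  have "\<bar>u (x + z) - u x\<bar> \<le> e * norm z powr (1/3)" if z: "norm z < d" for x z
  proof (rule holder_sup_gen[OF u b])
    fix N
    define h where "h = norm z"
    have h: "h \<ge> 0" "h < d" using z by (auto simp: h_def)
    have "(\<Sum>n<N. min 2 (24 * pi * 2^n * h) * (b n * 2 powr (- (real n / 3))))
      \<le> (\<Sum>n<N. e' * (min 2 (24 * pi * 2^n * h) * 2 powr (- (real n / 3))) + (if n < J then B * (24 * pi) * h * 2 ^ n else 0))"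
    proof (rule sum_mono)
      fix n
      have m0: "0 \<le> min 2 (24 * pi * 2^n * h)" using h by simp
      show "min 2 (24 * pi * 2^n * h) * (b n * 2 powr (- (real n / 3)))
        \<le> e' * (min 2 (24 * pi * 2^n * h) * 2 powr (- (real n / 3))) + (if n < J then B * (24 * pi) * h * 2 ^ n else 0)"
      proof (cases "n < J")
        case True
        have "min 2 (24 * pi * 2^n * h) * (b n * 2 powr (- (real n / 3))) \<le> (24 * pi * 2^n * h) * (B * 1)"
        proof (rule mult_mono)
          have "b n * 2 powr (- (real n / 3)) \<le> B * 2 powr (- (real n / 3))" using B(2)[of n] by (intro mult_right_mono) auto
          also have "\<dots> \<le> B * 1" using B(1) by (intro mult_left_mono) (use powr_mono[of "- (real n / 3)" 0 "2::real"] in auto)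
          finally show "b n * 2 powr (- (real n / 3)) \<le> B * 1" .
          show "0 \<le> b n * 2 powr (- (real n / 3))" using order_trans[OF norm_ge_zero b[of n 0]] .
        qed (use h in auto)
        moreover have "0 \<le> e' * (min 2 (24 * pi * 2^n * h) * 2 powr (- (real n / 3)))" using e' m0 by simp
        ultimately show ?thesis using True by (simp add: mult_ac)
      next
        case False
        then have "min 2 (24 * pi * 2^n * h) * (b n * 2 powr (- (real n / 3))) \<le> min 2 (24 * pi * 2^n * h) * (e' * 2 powr (- (real n / 3)))"
          using J[of n] m0 by (intro mult_left_mono mult_right_mono) auto
        then show ?thesis using False by (simp add: mult_ac)
      qed
    qed
    also have "\<dots> = e' * (\<Sum>n<N. min 2 (24 * pi * 2^n * h) * 2 powr (- (real n / 3))) + B * (24 * pi) * h * (\<Sum>n<N. if n < J then 2 ^ n else 0)"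
      unfolding sum.distrib sum_distrib_left by (intro arg_cong2[where f="(+)"] sum.cong refl) auto
    also have "\<dots> \<le> e' * (holder_const * h powr (1/3)) + B * (24 * pi) * h * 2 ^ J"
    proof (intro add_mono mult_left_mono holder_const)
      have "(\<Sum>n<N. if n < J then (2::real) ^ n else 0) = (\<Sum>n\<in>{..<N} \<inter> {..<J}. 2 ^ n)"
        by (subst sum.inter_restrict) auto
      also have "\<dots> \<le> (\<Sum>n<J. 2 ^ n)" by (intro sum_mono2) auto
      also have "\<dots> \<le> 2 ^ J" by (simp add: geometric_sum)
      finally show "(\<Sum>n<N. if n < J then (2::real) ^ n else 0) \<le> 2 ^ J" .
    qed (use e' h B in auto)
    also have "\<dots> = e/2 * h powr (1/3) + G * h" using holder_const(1) by (simp add: e'_def G_def)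
    also have "G * h \<le> e/2 * h powr (1/3)"
    proof (cases "h = 0")
      case False
      then have h0: "h > 0" using h by simp
      have "h powr (2/3) \<le> d powr (2/3)" using h by (intro powr_mono2) auto
      also have "d powr (2/3) = e / (2 * G)" using e G by (simp add: d_def powr_powr)
      finally have "G * h powr (2/3) \<le> e/2" using G by (simp add: field_simps)
      then have "(G * h powr (2/3)) * h powr (1/3) \<le> e/2 * h powr (1/3)" by (intro mult_right_mono) auto
      moreover have "h powr (2/3) * h powr (1/3) = h" using h0 by (simp add: powr_add[symmetric])
      ultimately show ?thesis by (simp add: mult.assoc)
    qed simp
    finally show "(\<Sum>n<N. min 2 (24 * pi * 2^n * norm z) * (b n * 2 powr (- (real n / 3)))) \<le> e * norm z powr (1/3)"
      by (simp add: h_def)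
  qed
  with d that show ?thesis by blast
qed

text \<open>The bound does not depend on m. Besides giving \<open>holder_L2\<close> in the limit, it
  is needed for the mollified function itself, whose increments enter the flux through the weight in
  the evolution of the moments.\<close>

lemma holder_L2_conv:
  assumes u: "cper u" and A: "A \<ge> 0" and a: "\<And>n. avg (\<lambda>x. (norm (block n u x))\<^sup>2) \<le> (A * 2 powr (- (real n / 3)))\<^sup>2"
  shows "avg (\<lambda>x. (conv (ker m) u (x + z) - conv (ker m) u x)\<^sup>2) \<le> (holder_const * A)\<^sup>2 * norm z powr (2/3)"
proof -
  obtain N where N: "avg (\<lambda>x. (conv (ker m) u (x + z) - conv (ker m) u x)\<^sup>2) \<le> (\<Sum>n<N. min 2 (24 * pi * 2^n * norm z) * (A * 2 powr (- (real n / 3))))\<^sup>2"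
    using conv_diff_L2[OF u a, of m z] A by auto
  have "(\<Sum>n<N. min 2 (24 * pi * 2^n * norm z) * (A * 2 powr (- (real n / 3)))) = A * (\<Sum>n<N. min 2 (24 * pi * 2^n * norm z) * 2 powr (- (real n / 3)))"
    by (simp add: sum_distrib_left mult_ac)
  also have "\<dots> \<le> A * (holder_const * norm z powr (1/3))" using A by (intro mult_left_mono holder_const) auto
  finally have "(\<Sum>n<N. min 2 (24 * pi * 2^n * norm z) * (A * 2 powr (- (real n / 3))))\<^sup>2 \<le> (A * (holder_const * norm z powr (1/3)))\<^sup>2"
    using A by (intro power_mono sum_nonneg) auto
  also have "\<dots> = (holder_const * A)\<^sup>2 * norm z powr (2/3)"
    by (simp add: power_mult_distrib) (simp add: power2_eq_square flip: powr_add)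
  finally show ?thesis using N by linarith
qed

lemma holder_L2:
  assumes u: "cper u" and A: "A \<ge> 0" and a: "\<And>n. avg (\<lambda>x. (norm (block n u x))\<^sup>2) \<le> (A * 2 powr (- (real n / 3)))\<^sup>2"
  shows "avg (\<lambda>x. (u (x + z) - u x)\<^sup>2) \<le> (holder_const * A)\<^sup>2 * norm z powr (2/3)"
proof (rule tendsto_upperbound)
  note ul = conv_ker_uniform_limit[OF u]
  obtain M where M: "M > 0" "\<And>x. norm (u x) \<le> M" using cper_bounded[OF u] by blast
  have cb: "norm (conv (ker m) u x) \<le> M" for m x by (rule norm_conv_ker_le[OF u M(2)])
  have cc: "continuous_on UNIV (conv (ker m) u)" for m by (rule cper_cont[OF cper_conv_ker[OF u]])
  show "(\<lambda>m. avg (\<lambda>x. (conv (ker m) u (x + z) - conv (ker m) u x)\<^sup>2)) \<longlonglongrightarrow> avg (\<lambda>x. (u (x + z) - u x)\<^sup>2)"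
  proof (rule dominated_convergence(2)[where h="\<lambda>x. (2 * M)\<^sup>2"])
    show "(\<lambda>x. (conv (ker m) u (x + z) - conv (ker m) u x)\<^sup>2) integrable_on cube" for m
      by (intro integrable_cube continuous_intros cont_UNIV_compose[OF cc])
    show "(\<lambda>x::real^3. (2 * M)\<^sup>2) integrable_on cube" by (intro integrable_cube continuous_intros)
    show "norm ((conv (ker m) u (x + z) - conv (ker m) u x)\<^sup>2) \<le> (2 * M)\<^sup>2" for m x
    proof -
      have "\<bar>conv (ker m) u (x + z) - conv (ker m) u x\<bar> \<le> 2 * M" using cb[of m "x + z"] cb[of m x] by auto
      then show ?thesis using abs_le_square_iff[of "conv (ker m) u (x + z) - conv (ker m) u x" "2 * M"] M(1) by simp
    qed
    show "(\<lambda>m. (conv (ker m) u (x + z) - conv (ker m) u x)\<^sup>2) \<longlonglongrightarrow> (u (x + z) - u x)\<^sup>2" for x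
      by (intro tendsto_intros conv_ker_tendsto u)
  qed
  show "\<forall>\<^sub>F m in sequentially. avg (\<lambda>x. (conv (ker m) u (x + z) - conv (ker m) u x)\<^sup>2) \<le> (holder_const * A)\<^sup>2 * norm z powr (2/3)"
    using holder_L2_conv[OF u A a] by simp
qed auto

end

section \<open>The flux\<close>

definition flux_kernel :: "nat \<Rightarrow> (real^3 \<Rightarrow> real^3) \<Rightarrow> real^3 \<Rightarrow> real^3 \<Rightarrow> real" where
  "flux_kernel m V x y = (\<Sum>j\<in>UNIV. dker m j (x - y) * V x $ j)"

text \<open>The J of the overview for K = \<open>ker m\<close>; the velocity is taken at the outer
  variable x.\<close>

definition flux :: "nat \<Rightarrow> (real^3 \<Rightarrow> real^3) \<Rightarrow> (real^3 \<Rightarrow> real) \<Rightarrow> (real^3 \<Rightarrow> real) \<Rightarrow> real" where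
  "flux m V f g = avg (\<lambda>x. avg (\<lambda>y. flux_kernel m V x y * (f x * g y)))"

lemma cont_flux_kernel:
  assumes V: "continuous_on UNIV V" and "continuous_on S a" "continuous_on S b"
  shows "continuous_on (S::'a::t2_space set) (\<lambda>p. flux_kernel m V (a p) (b p))"
  unfolding flux_kernel_def by (intro continuous_intros cont_UNIV_compose[OF V] assms)

lemma integral_flux_kernel_right:
  assumes V: "cper V" shows "avg (flux_kernel m V x) = 0"
proof -
  have "avg (\<lambda>y. dker m j (x - y)) = 0" for j
  proof -
    have "avg (\<lambda>y. dker m j (x - y)) = avg (\<lambda>y. - dker m j (y + (- x)))"
      using dker_minus[of m j] by (intro integral_cube_cong) (metis add_uminus_conv_diff minus_diff_eq)
    also have "\<dots> = 0" using integral_cube_shift[OF cper_dker[of m j], of "- x"] by (simp add: integral_dker)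
    finally show ?thesis .
  qed
  then show ?thesis unfolding flux_kernel_def
    by (subst integral_sum) (auto intro!: integrable_cube continuous_intros)
qed

text \<open>As a function of x the kernel is V . grad of x \<mapsto> K(x - y), a smooth periodic
  test function.\<close>

lemma integral_flux_kernel_left:
  assumes "weak_div_free V" shows "avg (\<lambda>x. flux_kernel m V x y) = 0"
proof -
  have "avg (\<lambda>x. \<Sum>i\<in>UNIV. V x $ i * pdx (\<lambda>x. ker m (x - y)) i x) = 0"
    using assms smooth_ker_shift periodic_ker_shift unfolding weak_div_free_def by blast
  then show ?thesis by (simp add: pdx_ker_shift flux_kernel_def mult.commute)
qed

text \<open>Of the four terms of the expanded product, f(x) g(x) disappears on integrating the flux
  kernel in y, f(y) g(y) on integrating it in x, and the cross terms are the two fluxes. Since the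
  gradient of the kernel is odd, V(x) - V(y) in place of V(x) doubles the integral.\<close>

lemma flux_symmetrized:
  assumes V: "cper V" "weak_div_free V" and f: "cper f" and g: "cper g"
  shows "avg (\<lambda>x. avg (\<lambda>y. (\<Sum>j\<in>UNIV. dker m j (x - y) * (V x $ j - V y $ j)) * ((f x - f y) * (g x - g y))))
     = - 2 * (flux m V f g + flux m V g f)"
proof -
  note cE = cont_flux_kernel[OF cper_cont[OF V(1)]]
  note cf = cont_UNIV_compose[OF cper_cont[OF f]] and cg = cont_UNIV_compose[OF cper_cont[OF g]]
  define b where "b = (\<lambda>x y. (f x - f y) * (g x - g y))"
  define P where "P = (\<lambda>x y. flux_kernel m V x y * b x y)"
  have cb: "continuous_on S (\<lambda>p. b (p1 p) (p2 p))" if "continuous_on S p1" "continuous_on S p2" for S :: "'a::t2_space set" and p1 p2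
    unfolding b_def by (intro continuous_intros cf cg that)
  have cP: "continuous_on S (\<lambda>p. P (p1 p) (p2 p))" if "continuous_on S p1" "continuous_on S p2" for S :: "'a::t2_space set" and p1 p2
    unfolding P_def by (intro continuous_intros cE cb that)
  have ci: "continuous_on UNIV (\<lambda>x. avg (F x))" if "continuous_on UNIV (\<lambda>p. F (fst p) (snd p))" for F :: "real^3 \<Rightarrow> real^3 \<Rightarrow> real"
    by (rule cont_integral_cube) (use that in simp)
  have sw: "avg (\<lambda>x. avg (\<lambda>y. P y x)) = avg (\<lambda>x. avg (P x))"
    by (rule integral_cube_swap) (intro cP continuous_intros)
  have eq: "(\<Sum>j\<in>UNIV. dker m j (x - y) * (V x $ j - V y $ j)) * ((f x - f y) * (g x - g y)) = P x y + P y x" for x y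
  proof -
    have "dker m j (y - x) = - dker m j (x - y)" for j using dker_minus[of m j "x - y"] by simp
    then have "(\<Sum>j\<in>UNIV. dker m j (x - y) * (V x $ j - V y $ j)) = flux_kernel m V x y + flux_kernel m V y x"
      by (simp add: flux_kernel_def right_diff_distrib sum_subtractf sum_negf)
    then show ?thesis by (simp add: P_def b_def algebra_simps)
  qed
  have "avg (\<lambda>x. avg (\<lambda>y. P x y + P y x)) = avg (\<lambda>x. avg (P x) + avg (\<lambda>y. P y x))"
    by (intro integral_cube_cong integral_add integrable_cube cP continuous_intros)
  also have "\<dots> = avg (\<lambda>x. avg (P x)) + avg (\<lambda>x. avg (\<lambda>y. P y x))"
    by (intro integral_add integrable_cube ci cP continuous_intros)
  also have "\<dots> = 2 * avg (\<lambda>x. avg (P x))" by (simp add: sw)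
  also have "avg (\<lambda>x. avg (P x)) = - (flux m V f g + flux m V g f)"
  proof -
    let ?E = "flux_kernel m V"
    have "avg (P x) = (f x * g x) * avg (?E x) - avg (\<lambda>y. ?E x y * (f x * g y))
       - avg (\<lambda>y. ?E x y * (g x * f y)) + avg (\<lambda>y. ?E x y * (f y * g y))" for x
    proof -
      have "P x = (\<lambda>y. (f x * g x) * ?E x y - ?E x y * (f x * g y) - ?E x y * (g x * f y) + ?E x y * (f y * g y))"
        by (auto simp: P_def b_def algebra_simps)
      moreover have "(\<lambda>y. (f x * g x) * ?E x y) integrable_on cube" "(\<lambda>y. ?E x y * (f x * g y)) integrable_on cube"
        "(\<lambda>y. ?E x y * (g x * f y)) integrable_on cube" "(\<lambda>y. ?E x y * (f y * g y)) integrable_on cube"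
        by (intro integrable_cube continuous_intros cE cf cg)+
      ultimately show ?thesis by (simp add: integral_add integral_diff integrable_diff integrable_add)
    qed
    then have "avg (\<lambda>x. avg (P x)) = avg (\<lambda>x. - avg (\<lambda>y. ?E x y * (f x * g y))
       - avg (\<lambda>y. ?E x y * (g x * f y)) + avg (\<lambda>y. ?E x y * (f y * g y)))"
      by (simp add: integral_flux_kernel_right[OF V(1)])
    also have "\<dots> = - flux m V f g - flux m V g f + avg (\<lambda>x. avg (\<lambda>y. ?E x y * (f y * g y)))"
    proof -
      have "(\<lambda>x. avg (\<lambda>y. ?E x y * (f x * g y))) integrable_on cube" "(\<lambda>x. avg (\<lambda>y. ?E x y * (g x * f y))) integrable_on cube"
        "(\<lambda>x. avg (\<lambda>y. ?E x y * (f y * g y))) integrable_on cube"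
        by (intro integrable_cube ci continuous_intros cE cf cg)+
      then show ?thesis by (simp add: flux_def integral_add integral_diff integrable_diff integrable_add integrable_neg)
    qed
    also have "avg (\<lambda>x. avg (\<lambda>y. ?E x y * (f y * g y))) = avg (\<lambda>y. avg (\<lambda>x. ?E x y * (f y * g y)))"
      by (intro integral_cube_swap continuous_intros cE cf cg)
    also have "\<dots> = 0" by (simp add: integral_flux_kernel_left[OF V(2)])
    finally show ?thesis by simp
  qed
  finally show ?thesis by (simp add: eq)
qed

text \<open>The factor m + 1 of the gradient bound cancels the 2m + 2 in both kernel moments, so the
  term in e stays bounded and the term in M decays like 1/m. The constants 36 and 324 are halved at
  the end by the factor 2 of \<open>flux_symmetrized\<close>.\<close>

lemma flux_bound:
  assumes V: "cper V" "weak_div_free V" and f: "cper f" and g: "cper g" and m: "m \<ge> 1" and M: "M \<ge> 0" and e: "e \<ge> 0"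
    and H: "\<And>z j. avg (\<lambda>x. \<bar>V (x + z) $ j - V x $ j\<bar> * (\<bar>f (x + z) - f x\<bar> * \<bar>g (x + z) - g x\<bar>)) \<le> sqrt (sin_sq z) * (e + M * sin_sq z)"
  shows "\<bar>flux (Suc m) V f g + flux (Suc m) V g f\<bar> \<le> 18 * pi * e + 162 * pi * M / (2 * real m + 4)"
proof -
  note cV = cont_UNIV_compose[OF cper_cont[OF V(1)]]
  note cf = cont_UNIV_compose[OF cper_cont[OF f]] and cg = cont_UNIV_compose[OF cper_cont[OF g]]
  define R where "R = (\<lambda>x y. (\<Sum>j\<in>UNIV. dker (Suc m) j (x - y) * (V x $ j - V y $ j)) * ((f x - f y) * (g x - g y)))"
  have cR: "continuous_on S (\<lambda>p. R (p1 p) (p2 p))" if "continuous_on S p1" "continuous_on S p2" for S :: "'a::t2_space set" and p1 p2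
    unfolding R_def by (intro continuous_intros cV cf cg that)
  have perR: "cper (R x)" for x
  proof -
    have "dker (Suc m) j (x - (y + k)) = dker (Suc m) j (x - y)" if "k \<in> Zvecs" for y k j
      using cper_dker[of "Suc m" j] that unfolding cper_def periodic3_def
      by (metis diff_diff_eq diff_add_cancel)
    then have "periodic3 (R x)" using V f g unfolding cper_def periodic3_def R_def by simp
    then show ?thesis using cR[of UNIV "\<lambda>_. x" "\<lambda>y. y"] by (simp add: cper_def continuous_intros)
  qed
  \<comment> \<open>Substituting y = x + z and exchanging the integrals leaves, for each z, the mean
    over x that \<open>H\<close> controls.\<close>
  have "avg (\<lambda>x. avg (R x)) = avg (\<lambda>x. avg (\<lambda>z. R x (x + z)))"
  proof (rule integral_cube_cong)
    show "avg (R x) = avg (\<lambda>z. R x (x + z))" for x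
      using integral_cube_shift[OF perR, of x x] by (simp add: add.commute)
  qed
  also have "\<dots> = avg (\<lambda>z. avg (\<lambda>x. R x (x + z)))"
    by (intro integral_cube_swap cR continuous_intros)
  also have "\<bar>\<dots>\<bar> \<le> avg (\<lambda>z. 24 * pi * real (Suc m) * (ker m z * sin_sq z) * (e + M * sin_sq z))"
    unfolding real_norm_def[symmetric]
  proof (rule integral_norm_bound_integral)
    show "(\<lambda>z. avg (\<lambda>x. R x (x + z))) integrable_on cube"
      by (intro integrable_cube cont_integral_cube cR continuous_intros)
    show "(\<lambda>z. 24 * pi * real (Suc m) * (ker m z * sin_sq z) * (e + M * sin_sq z)) integrable_on cube"
      by (intro integrable_cube continuous_intros)
    fix z
    let ?h = "\<lambda>j x. \<bar>V (x + z) $ j - V x $ j\<bar> * (\<bar>f (x + z) - f x\<bar> * \<bar>g (x + z) - g x\<bar>)"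
    have ch: "continuous_on UNIV (?h j)" for j by (intro continuous_intros cV cf cg)
    have "norm (avg (\<lambda>x. R x (x + z))) \<le> avg (\<lambda>x. \<Sum>j\<in>UNIV. \<bar>dker (Suc m) j z\<bar> * ?h j x)"
    proof (rule integral_norm_bound_integral)
      show "(\<lambda>x. R x (x + z)) integrable_on cube" by (intro integrable_cube cR continuous_intros)
      show "(\<lambda>x. \<Sum>j\<in>UNIV. \<bar>dker (Suc m) j z\<bar> * ?h j x) integrable_on cube" by (intro integrable_cube continuous_intros ch)
      fix x
      have "\<bar>R x (x + z)\<bar> \<le> (\<Sum>j\<in>UNIV. \<bar>dker (Suc m) j z * (V x $ j - V (x + z) $ j)\<bar>) * (\<bar>f (x + z) - f x\<bar> * \<bar>g (x + z) - g x\<bar>)"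
        unfolding R_def abs_mult[of "sum _ _"] abs_mult[of "f _ - _"]
        by (intro mult_mono order_trans[OF sum_abs]) (auto simp: dker_minus abs_mult abs_minus_commute intro!: sum_nonneg)
      then show "norm (R x (x + z)) \<le> (\<Sum>j\<in>UNIV. \<bar>dker (Suc m) j z\<bar> * ?h j x)"
        by (simp add: sum_distrib_left abs_mult abs_minus_commute mult_ac)
    qed
    also have "\<dots> = (\<Sum>j\<in>UNIV. \<bar>dker (Suc m) j z\<bar> * avg (?h j))"
      by (subst integral_sum) (auto intro!: integrable_cube continuous_intros ch)
    also have "\<dots> \<le> (\<Sum>j\<in>UNIV. \<bar>dker (Suc m) j z\<bar> * (sqrt (sin_sq z) * (e + M * sin_sq z)))"
      by (intro sum_mono mult_left_mono H) auto
    also have "\<dots> \<le> (\<Sum>j\<in>(UNIV::3 set). 8 * pi * real (Suc m) * (ker m z * sin_sq z) * (e + M * sin_sq z))"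
    proof (rule sum_mono)
      fix j
      show "\<bar>dker (Suc m) j z\<bar> * (sqrt (sin_sq z) * (e + M * sin_sq z)) \<le> 8 * pi * real (Suc m) * (ker m z * sin_sq z) * (e + M * sin_sq z)"
        using mult_right_mono[OF dker_bound[OF m, of j z], of "e + M * sin_sq z"] e M by (simp add: mult.assoc)
    qed
    finally show "norm (avg (\<lambda>x. R x (x + z))) \<le> 24 * pi * real (Suc m) * (ker m z * sin_sq z) * (e + M * sin_sq z)"
      by simp
  qed
  also have "\<dots> = avg (\<lambda>z. (24 * pi * real (Suc m) * e) * (ker m z * sin_sq z) + (24 * pi * real (Suc m) * M) * (ker m z * (sin_sq z)\<^sup>2))"
    by (intro integral_cube_cong) (simp add: algebra_simps power2_eq_square)
  also have "\<dots> = (24 * pi * real (Suc m) * e) * avg (\<lambda>z. ker m z * sin_sq z) + (24 * pi * real (Suc m) * M) * avg (\<lambda>z. ker m z * (sin_sq z)\<^sup>2)"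
    by (subst integral_add) (auto intro!: integrable_cube continuous_intros)
  also have "\<dots> \<le> (24 * pi * real (Suc m) * e) * (3 / (2 * real m + 2)) + (24 * pi * real (Suc m) * M) * (27 / ((2 * real m + 2) * (2 * real m + 4)))"
    using M e by (intro add_mono mult_left_mono ker_moment_sq2) (auto simp: ker_moment_sin_sq)
  also have "\<dots> = 36 * pi * e + 324 * pi * M / (2 * real m + 4)"
  proof -
    have g1: "(24 * pi * (q/2) * e) * (3 / q) = 36 * pi * e"
      and g2: "(24 * pi * (q/2) * M) * (27 / (q * w)) = 324 * pi * M / w"
      if "q \<noteq> 0" for q w :: real using that by simp_all
    have nz: "2 * real m + 2 \<noteq> 0" by linarith
    have "(24 * pi * ((2 * real m + 2) / 2) * e) * (3 / (2 * real m + 2)) = 36 * pi * e"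
      and "(24 * pi * ((2 * real m + 2) / 2) * M) * (27 / ((2 * real m + 2) * (2 * real m + 4))) = 324 * pi * M / (2 * real m + 4)"
      by (rule g1[OF nz], rule g2[OF nz])
    moreover have "(2 * real m + 2) / 2 = real (Suc m)" by simp
    ultimately have "(24 * pi * real (Suc m) * e) * (3 / (2 * real m + 2)) = 36 * pi * e"
      and "(24 * pi * real (Suc m) * M) * (27 / ((2 * real m + 2) * (2 * real m + 4))) = 324 * pi * M / (2 * real m + 4)"
      by (simp_all only:)
    then show ?thesis by simp
  qed
  finally have "\<bar>avg (\<lambda>x. avg (R x))\<bar> \<le> 36 * pi * e + 324 * pi * M / (2 * real m + 4)" .
  moreover have "avg (\<lambda>x. avg (R x)) = - 2 * (flux (Suc m) V f g + flux (Suc m) V g f)"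
    using flux_symmetrized[OF V f g, of "Suc m"] by (simp add: R_def)
  ultimately show ?thesis by simp
qed

text \<open>The powers 1/3 of the velocity and 2/3 of the pair f, g add up to one power of the
  distance. Below distance d the small constant e applies; beyond it A does, and there
  \<open>sin_sq z\<close> / d^2 \<ge> 1 moves the contribution into the quadratic term. Periodicity
  replaces z by a representative near the origin, since \<open>sin_sq\<close> measures the distance
  to the lattice.\<close>

lemma flux_holder:
  assumes V: "cper V" "weak_div_free V" and f: "cper f" and g: "cper g" and m: "m \<ge> 1"
    and A: "\<And>x z j. \<bar>V (x + z) $ j - V x $ j\<bar> \<le> A * norm z powr (1/3)" and d: "d > 0" and e: "e \<ge> 0"
    and L: "\<And>x z j. norm z < d \<Longrightarrow> \<bar>V (x + z) $ j - V x $ j\<bar> \<le> e * norm z powr (1/3)"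
    and E: "\<And>z. avg (\<lambda>x. \<bar>f (x + z) - f x\<bar> * \<bar>g (x + z) - g x\<bar>) \<le> E * norm z powr (2/3)" and E0: "E \<ge> 0" and A0: "A \<ge> 0"
  shows "\<bar>flux (Suc m) V f g + flux (Suc m) V g f\<bar> \<le> 18 * pi * (e * E) + 162 * pi * (A * E / d\<^sup>2) / (2 * real m + 4)"
proof (rule flux_bound[OF V f g m])
  fix z j
  note cV = cont_UNIV_compose[OF cper_cont[OF V(1)]]
  note cf = cont_UNIV_compose[OF cper_cont[OF f]] and cg = cont_UNIV_compose[OF cper_cont[OF g]]
  obtain k where k: "k \<in> Zvecs" "norm (z - k) \<le> sqrt (sin_sq z)" by (rule nearest_lattice)
  have per: "V (x + z) = V (x + (z - k))" "f (x + z) = f (x + (z - k))" "g (x + z) = g (x + (z - k))" for x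
    using V f g k(1) unfolding cper_def periodic3_def by (metis add_diff_eq diff_add_cancel)+
  have *: "avg (\<lambda>x. \<bar>V (x + z) $ j - V x $ j\<bar> * (\<bar>f (x + z) - f x\<bar> * \<bar>g (x + z) - g x\<bar>)) \<le> B * E * sqrt (sin_sq z)"
    if B: "\<And>x. \<bar>V (x + (z - k)) $ j - V x $ j\<bar> \<le> B * norm (z - k) powr (1/3)" "B \<ge> 0" for B
  proof -
    let ?n = "norm (z - k)"
    have "avg (\<lambda>x. \<bar>V (x + z) $ j - V x $ j\<bar> * (\<bar>f (x + z) - f x\<bar> * \<bar>g (x + z) - g x\<bar>))
      \<le> avg (\<lambda>x. (B * ?n powr (1/3)) * (\<bar>f (x + (z - k)) - f x\<bar> * \<bar>g (x + (z - k)) - g x\<bar>))"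
      unfolding per by (intro integral_le integrable_cube continuous_intros cV cf cg mult_right_mono B) auto
    also have "\<dots> = (B * ?n powr (1/3)) * avg (\<lambda>x. \<bar>f (x + (z - k)) - f x\<bar> * \<bar>g (x + (z - k)) - g x\<bar>)"
      by simp
    also have "\<dots> \<le> (B * ?n powr (1/3)) * (E * ?n powr (2/3))"
      using B by (intro mult_left_mono E) auto
    also have "\<dots> = B * E * (?n powr (1/3) * ?n powr (2/3))" by (simp add: mult_ac)
    also have "?n powr (1/3) * ?n powr (2/3) = ?n" by (simp flip: powr_add)
    also have "B * E * ?n \<le> B * E * sqrt (sin_sq z)" using k B E0 by (intro mult_left_mono) auto
    finally show ?thesis .
  qed
  show "avg (\<lambda>x. \<bar>V (x + z) $ j - V x $ j\<bar> * (\<bar>f (x + z) - f x\<bar> * \<bar>g (x + z) - g x\<bar>)) \<le> sqrt (sin_sq z) * (e * E + A * E / d\<^sup>2 * sin_sq z)"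
  proof (cases "sqrt (sin_sq z) < d")
    case True
    then have "avg (\<lambda>x. \<bar>V (x + z) $ j - V x $ j\<bar> * (\<bar>f (x + z) - f x\<bar> * \<bar>g (x + z) - g x\<bar>)) \<le> e * E * sqrt (sin_sq z)"
      using k e by (intro * L) auto
    also have "\<dots> \<le> sqrt (sin_sq z) * (e * E + A * E / d\<^sup>2 * sin_sq z)"
      using A0 E0 by (simp add: distrib_left mult.commute)
    finally show ?thesis .
  next
    case False
    then have "d\<^sup>2 \<le> sin_sq z" using d by (metis abs_of_pos linorder_not_le real_sqrt_abs real_sqrt_le_iff)
    then have "A * E \<le> A * E / d\<^sup>2 * sin_sq z"
      using A0 E0 d mult_left_mono[of "d\<^sup>2" "sin_sq z" "A * E"] by (simp add: pos_le_divide_eq)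
    then have a: "A * E \<le> e * E + A * E / d\<^sup>2 * sin_sq z" using e E0 by (metis add_increasing mult_nonneg_nonneg)
    have "avg (\<lambda>x. \<bar>V (x + z) $ j - V x $ j\<bar> * (\<bar>f (x + z) - f x\<bar> * \<bar>g (x + z) - g x\<bar>)) \<le> A * E * sqrt (sin_sq z)"
      by (intro * A A0)
    also have "\<dots> \<le> sqrt (sin_sq z) * (e * E + A * E / d\<^sup>2 * sin_sq z)"
      using mult_left_mono[OF a, of "sqrt (sin_sq z)"] by (simp add: mult.commute)
    finally show ?thesis .
  qed
qed (use E0 e A0 d in auto)

section \<open>Evolution of the mollified quantities\<close>

lemma power_lipschitz:
  fixes M :: real assumes M: "M \<ge> 0"
  shows "\<exists>L\<ge>0. \<forall>a b. \<bar>a\<bar> \<le> M \<and> \<bar>b\<bar> \<le> M \<longrightarrow> \<bar>a^k - b^k\<bar> \<le> L * \<bar>a - b\<bar>"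
proof (induction k)
  case 0 then show ?case by auto
next
  case (Suc k)
  then obtain L where L: "L \<ge> 0" "\<And>a b. \<bar>a\<bar> \<le> M \<Longrightarrow> \<bar>b\<bar> \<le> M \<Longrightarrow> \<bar>a^k - b^k\<bar> \<le> L * \<bar>a - b\<bar>" by blast
  have "\<bar>a^Suc k - b^Suc k\<bar> \<le> (M * L + M^k) * \<bar>a - b\<bar>" if ab: "\<bar>a\<bar> \<le> M" "\<bar>b\<bar> \<le> M" for a b
  proof -
    have "a^Suc k - b^Suc k = a * (a^k - b^k) + b^k * (a - b)" by (simp add: algebra_simps)
    then have "\<bar>a^Suc k - b^Suc k\<bar> \<le> \<bar>a\<bar> * \<bar>a^k - b^k\<bar> + \<bar>b\<bar>^k * \<bar>a - b\<bar>"
      using abs_triangle_ineq[of "a * (a^k - b^k)" "b^k * (a - b)"] by (simp add: abs_mult power_abs)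
    also have "\<dots> \<le> M * (L * \<bar>a - b\<bar>) + M^k * \<bar>a - b\<bar>"
      using ab L M by (intro add_mono mult_mono power_mono) auto
    finally show ?thesis by (simp add: algebra_simps)
  qed
  moreover have "M * L + M^k \<ge> 0" using M L by simp
  ultimately show ?case by blast
qed

text \<open>B is differentiable in its first argument with the second frozen, and symmetry transfers
  this to the second. Along the diagonal the chain rule then doubles F, although no derivative in t
  is assumed; uniform continuity of F controls the error.\<close>

lemma diagonal_ftc:
  fixes B F :: "real \<Rightarrow> real \<Rightarrow> real"
  assumes sym: "\<And>s t. s \<in> {0..T} \<Longrightarrow> t \<in> {0..T} \<Longrightarrow> B s t = B t s"
    and B: "\<And>s t. s \<in> {0..T} \<Longrightarrow> t \<in> {0..T} \<Longrightarrow> B s t = c t + integral {0..s} (\<lambda>r. F r t)"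
    and F: "continuous_on ({0..T} \<times> {0..T}) (\<lambda>p. F (fst p) (snd p))"
    and t: "t \<in> {0..T}"
  shows "B t t = B 0 0 + 2 * integral {0..t} (\<lambda>r. F r r)"
proof -
  have Fc: "continuous_on {0..T} (\<lambda>r. F (a r) (b r))" if "continuous_on {0..T} a" "continuous_on {0..T} b" "a ` {0..T} \<subseteq> {0..T}" "b ` {0..T} \<subseteq> {0..T}" for a b
    by (rule continuous_on_compose2[OF F, of "{0..T}" "\<lambda>r. (a r, b r)", simplified]) (use that in \<open>auto intro!: continuous_intros\<close>)
  have diff: "B u s - B r s = integral {r..u} (\<lambda>x. F x s)" if "r \<le> u" "r \<in> {0..T}" "u \<in> {0..T}" "s \<in> {0..T}" for r u s
  proof -
    have "(\<lambda>x. F x s) integrable_on {0..u}"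
      by (rule integrable_continuous_interval) (rule continuous_on_subset[OF Fc], use that in \<open>auto intro!: continuous_intros\<close>)
    then have "integral {0..r} (\<lambda>x. F x s) + integral {r..u} (\<lambda>x. F x s) = integral {0..u} (\<lambda>x. F x s)"
      using that by (intro Henstock_Kurzweil_Integration.integral_combine) auto
    then show ?thesis using B[of u s] B[of r s] that by simp
  qed
  define D where "D = (\<lambda>t. B t t - 2 * integral {0..t} (\<lambda>r. F r r))"
  have uc: "uniformly_continuous_on ({0..T} \<times> {0..T}) (\<lambda>p. F (fst p) (snd p))"
    by (intro compact_uniformly_continuous F compact_Times) auto
  have main: "\<exists>d>0. \<forall>r u. r \<in> {0..T} \<and> u \<in> {0..T} \<and> r \<le> u \<and> u - r < d \<longrightarrow> \<bar>D u - D r\<bar> \<le> e * (u - r)" if e: "e > 0" for e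
  proof -
    obtain d where d: "d > 0" "\<And>p q. p \<in> {0..T} \<times> {0..T} \<Longrightarrow> q \<in> {0..T} \<times> {0..T} \<Longrightarrow> dist q p < d \<Longrightarrow> dist (F (fst q) (snd q)) (F (fst p) (snd p)) < e/2"
      using uc[unfolded uniformly_continuous_on_def, rule_format, of "e/2"] e by auto
    have "\<bar>D u - D r\<bar> \<le> e * (u - r)" if ru: "r \<in> {0..T}" "u \<in> {0..T}" "r \<le> u" "u - r < d" for r u
    proof -
      have cs: "continuous_on {r..u} (\<lambda>x. F (a x) (b x))" if "continuous_on {0..T} a" "continuous_on {0..T} b" "a ` {0..T} \<subseteq> {0..T}" "b ` {0..T} \<subseteq> {0..T}" for a b
        by (rule continuous_on_subset[OF Fc[OF that]]) (use ru in auto)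
      have i: "(\<lambda>x. F x u) integrable_on {r..u}" "(\<lambda>x. F x r) integrable_on {r..u}" "(\<lambda>x. F x x) integrable_on {r..u}"
        by (intro integrable_continuous_interval cs continuous_intros; use ru in auto)+
      have "(\<lambda>x. F x x) integrable_on {0..u}"
        by (rule integrable_continuous_interval) (rule continuous_on_subset[OF Fc], use ru in \<open>auto intro!: continuous_intros\<close>)
      then have c3: "integral {0..r} (\<lambda>x. F x x) + integral {r..u} (\<lambda>x. F x x) = integral {0..u} (\<lambda>x. F x x)"
        using ru by (intro Henstock_Kurzweil_Integration.integral_combine) auto
      \<comment> \<open>The step from (r, r) to (u, u) goes through the mixed point; symmetry turns
        the change of the second argument into one of the first.\<close>
      have "D u - D r = (B u u - B r u) + (B u r - B r r) - 2 * integral {r..u} (\<lambda>x. F x x)"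
        using sym[of r u] ru c3 by (simp add: D_def)
      also have "\<dots> = integral {r..u} (\<lambda>x. F x u) + integral {r..u} (\<lambda>x. F x r) - 2 * integral {r..u} (\<lambda>x. F x x)"
        using diff[of r u u] diff[of r u r] ru by simp
      also have "\<dots> = integral {r..u} (\<lambda>x. F x u + F x r - 2 * F x x)"
        using i by (simp add: integral_add integral_diff integrable_add)
      finally have "norm (D u - D r) = norm (integral {r..u} (\<lambda>x. F x u + F x r - 2 * F x x))" by simp
      also have "\<dots> \<le> e * (u - r)"
      proof (rule integral_bound)
        show "continuous_on {r..u} (\<lambda>x. F x u + F x r - 2 * F x x)"
          by (intro continuous_intros cs; use ru in auto)
        show "norm (F x u + F x r - 2 * F x x) \<le> e" if x: "x \<in> {r..u}" for x
        proof -
          have "\<bar>F x u - F x x\<bar> < e/2" "\<bar>F x r - F x x\<bar> < e/2"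
            using d(2)[of "(x, x)" "(x, u)"] d(2)[of "(x, x)" "(x, r)"] x ru by (auto simp: dist_Pair_Pair dist_real_def)
          then show ?thesis unfolding real_norm_def by arith
        qed
      qed (use ru in auto)
      finally show ?thesis by simp
    qed
    with d(1) show ?thesis by blast
  qed
  have "(D has_real_derivative 0) (at s within {0..T})" if s: "s \<in> {0..T}" for s
    unfolding has_field_derivative_iff
  proof (rule tendstoI)
    fix e :: real assume e: "e > 0"
    then obtain d where d: "d > 0" "\<And>r u. r \<in> {0..T} \<Longrightarrow> u \<in> {0..T} \<Longrightarrow> r \<le> u \<Longrightarrow> u - r < d \<Longrightarrow> \<bar>D u - D r\<bar> \<le> (e/2) * (u - r)"
      using main[of "e/2"] by auto
    show "\<forall>\<^sub>F y in at s within {0..T}. dist ((D y - D s) / (y - s)) 0 < e"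
      unfolding eventually_at
    proof (intro exI[of _ d] conjI ballI impI d(1))
      fix y assume y: "y \<in> {0..T}" "y \<noteq> s \<and> dist y s < d"
      have "\<bar>D y - D s\<bar> \<le> (e/2) * \<bar>y - s\<bar>"
        using d(2)[of s y] d(2)[of y s] y s by (cases "s \<le> y") (auto simp: dist_real_def abs_minus_commute)
      also have "\<dots> < e * \<bar>y - s\<bar>" using y e by simp
      finally show "dist ((D y - D s) / (y - s)) 0 < e"
        using y by (simp add: dist_real_def pos_divide_less_eq)
    qed
  qed
  then have "\<exists>c. \<forall>x\<in>{0..T}. D x = c"
    by (intro has_field_derivative_zero_constant) auto
  then have "D t = D 0" using t by fastforce
  then show ?thesis by (simp add: D_def)
qed

section \<open>Moments of the mollified temperature\<close>

context boussinesq
begin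

lemma bounded_st:
  obtains M where "M > 0" "\<And>t x. t \<in> {0..T} \<Longrightarrow> \<bar>\<theta> t x\<bar> \<le> M" "\<And>t x. t \<in> {0..T} \<Longrightarrow> norm (v t x) \<le> M"
proof -
  have c: "compact ({0..T} \<times> cube)" by (intro compact_Times) auto
  have "bounded ((\<lambda>p. \<theta> (fst p) (snd p)) ` ({0..T} \<times> cube))"
    by (intro compact_imp_bounded compact_continuous_image c continuous_on_subset[OF cont_\<theta>]) auto
  then obtain M1 where M1: "\<And>t x. t \<in> {0..T} \<Longrightarrow> x \<in> cube \<Longrightarrow> norm (\<theta> t x) \<le> M1"
    unfolding bounded_iff by fastforce
  have "bounded ((\<lambda>p. v (fst p) (snd p)) ` ({0..T} \<times> cube))"
    by (intro compact_imp_bounded compact_continuous_image c continuous_on_subset[OF cont_v]) auto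
  then obtain M2 where M2: "\<And>t x. t \<in> {0..T} \<Longrightarrow> x \<in> cube \<Longrightarrow> norm (v t x) \<le> M2"
    unfolding bounded_iff by fastforce
  have red: "\<exists>y\<in>cube. \<theta> t x = \<theta> t y \<and> v t x = v t y" if "t \<in> {0..T}" for t x
  proof -
    obtain k where k: "k \<in> Zvecs" "x - k \<in> cube" by (rule periodic_in_cube)
    have "\<theta> t (x - k + k) = \<theta> t (x - k)" "v t (x - k + k) = v t (x - k)"
      using cper_\<theta>[OF that] cper_v[OF that] k(1) unfolding cper_def periodic3_def by blast+
    then show ?thesis using k(2) by (intro bexI[of _ "x - k"]) auto
  qed
  show ?thesis
  proof (rule that[of "max 1 (max M1 M2)"])
    show "\<bar>\<theta> t x\<bar> \<le> max 1 (max M1 M2)" if "t \<in> {0..T}" for t x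
      using red[OF that, of x] M1[OF that] by fastforce
    show "norm (v t x) \<le> max 1 (max M1 M2)" if "t \<in> {0..T}" for t x
      using red[OF that, of x] M2[OF that] by fastforce
  qed auto
qed

text \<open>The test function is the kernel centred at x, so the weak equation becomes an integral
  equation in time at each point.\<close>

lemma conv_\<theta>_weak:
  assumes t: "t \<in> {0..T}"
  shows "conv (ker m) (\<theta> t) x = conv (ker m) \<theta>in x + integral {0..t} (\<lambda>s. avg (\<lambda>y. flux_kernel m (v s) y x * \<theta> s y))"
proof -
  have e: "ker m (y - x) = ker m (x - y)" for y using ker_minus[of m "x - y"] by simp
  show ?thesis
    using \<theta>_weak[OF smooth_ker_shift[of m x] periodic_ker_shift t] unfolding pdx_ker_shift
    by (simp add: conv_def flux_kernel_def mult.commute e)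
qed

text \<open>At t = 0 the time integral is empty, so \<theta>(0) and the initial datum have the same
  mollification for every m, and the mollifications converge pointwise.\<close>

lemma \<theta>_0: "\<theta> 0 = \<theta>in"
proof
  fix x
  have "conv (ker m) (\<theta> 0) x = conv (ker m) \<theta>in x" for m using conv_\<theta>_weak[of 0 m x] T by simp
  then show "\<theta> 0 x = \<theta>in x"
    using conv_ker_tendsto[OF cper_\<theta>in, of x] conv_ker_tendsto[OF cper_\<theta>[of 0], of x] T LIMSEQ_unique by fastforce
qed

lemma cont_conv_\<theta>:
  assumes "continuous_on S a" "continuous_on S b" "a ` S \<subseteq> {0..T}"
  shows "continuous_on (S::'a::t2_space set) (\<lambda>p. conv (ker m) (\<theta> (a p)) (b p))"
  unfolding conv_def
  by (intro cont_integral_cube continuous_intros cont_\<theta>' continuous_on_compose2[OF assms(1)] continuous_on_compose2[OF assms(2)]) (use assms(3) in auto)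

text \<open>The derivative of y^n at y = K * \<theta>, the factor produced by differentiating the
  n-th moment. For n = 0 the truncated exponent is harmless because the prefactor is 0.\<close>

definition power_weight :: "nat \<Rightarrow> nat \<Rightarrow> real \<Rightarrow> real^3 \<Rightarrow> real" where
  "power_weight n m t x = real n * conv (ker m) (\<theta> t) x ^ (n - 1)"

lemma cper_power_weight: "t \<in> {0..T} \<Longrightarrow> cper (power_weight n m t)"
  unfolding power_weight_def by (intro cper_mult cper_const cper_compose[of "\<lambda>x. x ^ (n - 1)"] cper_conv_ker cper_\<theta> continuous_intros) auto

lemma cont_power_weight:
  assumes "continuous_on S a" "continuous_on S b" "a ` S \<subseteq> {0..T}"
  shows "continuous_on (S::'a::t2_space set) (\<lambda>p. power_weight n m (a p) (b p))"
  unfolding power_weight_def by (intro continuous_intros cont_conv_\<theta> assms)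

text \<open>In the evolution of K * \<theta> the velocity sits at the inner variable; exchanging the
  integrals moves it to the outer one, where \<open>flux\<close> expects it.\<close>

lemma flux_\<theta>_power_weight_eq:
  assumes t: "t \<in> {0..T}"
  shows "avg (\<lambda>x. power_weight n m t x * avg (\<lambda>y. flux_kernel m (v t) y x * \<theta> t y)) = flux m (v t) (\<theta> t) (power_weight n m t)"
proof -
  note cE = cont_flux_kernel[OF cper_cont[OF cper_v[OF t]]]
  note c\<theta> = cont_UNIV_compose[OF cper_cont[OF cper_\<theta>[OF t]]] and cb = cont_UNIV_compose[OF cper_cont[OF cper_power_weight[OF t]]]
  have "avg (\<lambda>x. power_weight n m t x * avg (\<lambda>y. flux_kernel m (v t) y x * \<theta> t y)) = avg (\<lambda>x. avg (\<lambda>y. flux_kernel m (v t) y x * (\<theta> t y * power_weight n m t x)))"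
    by (subst integral_mult_right[symmetric]) (simp add: mult_ac)
  also have "\<dots> = avg (\<lambda>y. avg (\<lambda>x. flux_kernel m (v t) y x * (\<theta> t y * power_weight n m t x)))"
    by (intro integral_cube_swap continuous_intros cE c\<theta> cb)
  finally show ?thesis by (simp add: flux_def)
qed

text \<open>The integrand \<open>h\<close> of the equation for K * \<theta> is continuous, so K *
  \<theta> is continuously differentiable in time at each x and its powers can be differentiated
  under the space integral.\<close>

lemma \<theta>_power_evolution:
  assumes t: "t \<in> {0..T}"
  shows "avg (\<lambda>x. conv (ker m) (\<theta> t) x ^ n) = avg (\<lambda>x. conv (ker m) (\<theta> 0) x ^ n)
     + integral {0..t} (\<lambda>s. flux m (v s) (\<theta> s) (power_weight n m s))"
proof -
  define h where "h = (\<lambda>s x. avg (\<lambda>y. flux_kernel m (v s) y x * \<theta> s y))"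
  have ch: "continuous_on (S::'a::t2_space set) (\<lambda>p. h (a p) (b p))" if "continuous_on S a" "continuous_on S b" "a ` S \<subseteq> {0..T}" for S a b
    unfolding h_def flux_kernel_def
    by (intro cont_integral_cube continuous_intros cont_\<theta>' cont_v' continuous_on_compose2[OF that(1)] continuous_on_compose2[OF that(2)]) (use that(3) in auto)
  have d\<Theta>: "((\<lambda>t. conv (ker m) (\<theta> t) x) has_real_derivative h s x) (at s within {0..T})" if s: "s \<in> {0..T}" for s x
  proof -
    have "((\<lambda>t. integral {0..t} (\<lambda>s. h s x)) has_real_derivative h s x) (at s within {0..T})"
      using s by (intro integral_has_real_derivative ch continuous_intros) auto
    then have "((\<lambda>t. conv (ker m) \<theta>in x + integral {0..t} (\<lambda>s. h s x)) has_real_derivative h s x) (at s within {0..T})"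
      using DERIV_add[OF DERIV_const] by fastforce
    then show ?thesis
      by (rule has_field_derivative_transform_within[of _ _ _ _ 1]) (use s in \<open>auto simp: conv_\<theta>_weak h_def\<close>)
  qed
  have dI: "((\<lambda>t. avg (\<lambda>x. conv (ker m) (\<theta> t) x ^ n)) has_vector_derivative avg (\<lambda>x. power_weight n m s x * h s x)) (at s within {0..T})" if s: "s \<in> {0..T}" for s
    unfolding cube_def
  proof (rule leibniz_rule_vector_derivative)
    show "((\<lambda>t. conv (ker m) (\<theta> t) x ^ n) has_vector_derivative power_weight n m t x * h t x) (at t within {0..T})" if "t \<in> {0..T}" for t x
      using DERIV_power[OF d\<Theta>[OF that, of x], of n]
      by (simp add: has_real_derivative_iff_has_vector_derivative power_weight_def mult_ac)
    show "(\<lambda>x. conv (ker m) (\<theta> t) x ^ n) integrable_on cbox 0 One" if "t \<in> {0..T}" for t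
      by (intro integrable_continuous continuous_intros cont_conv_\<theta>) (use that in auto)
    show "continuous_on ({0..T} \<times> cbox 0 One) (\<lambda>(t, x). power_weight n m t x * h t x)"
      unfolding case_prod_beta by (intro continuous_intros cont_power_weight ch) auto
  qed (use s in auto)
  have "((\<lambda>s. avg (\<lambda>x. power_weight n m s x * h s x)) has_integral
     avg (\<lambda>x. conv (ker m) (\<theta> t) x ^ n) - avg (\<lambda>x. conv (ker m) (\<theta> 0) x ^ n)) {0..t}"
    by (rule fundamental_theorem_of_calculus) (use t in \<open>auto intro!: has_vector_derivative_within_subset[OF dI]\<close>)
  then have "avg (\<lambda>x. conv (ker m) (\<theta> t) x ^ n) - avg (\<lambda>x. conv (ker m) (\<theta> 0) x ^ n)
     = integral {0..t} (\<lambda>s. avg (\<lambda>x. power_weight n m s x * h s x))" by (simp add: integral_unique)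
  also have "\<dots> = integral {0..t} (\<lambda>s. flux m (v s) (\<theta> s) (power_weight n m s))"
    by (intro integral_cong) (use t in \<open>auto simp: h_def flux_\<theta>_power_weight_eq\<close>)
  finally show ?thesis by simp
qed

lemma cont_flux_\<theta>: "continuous_on {0..T} (\<lambda>s. flux m (v s) (\<theta> s) (power_weight n m s))"
  unfolding flux_def flux_kernel_def
  by (intro cont_integral_cube continuous_intros cont_\<theta>' cont_v' cont_power_weight) auto

text \<open>In this order of arguments the gradient falls on K * \<theta>: the inner integral is v .
  grad of (K * \<theta>)^n, and weak incompressibility tested with that power gives zero.\<close>

lemma flux_power_weight_\<theta>:
  assumes t: "t \<in> {0..T}"
  shows "flux m (v t) (power_weight n m t) (\<theta> t) = 0"
proof -
  let ?\<Theta> = "conv (ker m) (\<theta> t)"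
  have sm: "smooth_fun ?\<Theta>" by (rule smooth_conv_ker(1)[OF cper_\<theta>[OF t]])
  have cpp: "periodic3 (\<lambda>x. ?\<Theta> x ^ n)" using cper_conv_ker[OF cper_\<theta>[OF t], of m] by (simp add: cper_def periodic3_def)
  have px: "pdx (\<lambda>x. ?\<Theta> x ^ n) j x = power_weight n m t x * conv (dker m j) (\<theta> t) x" for j x
  proof (rule pdx_eqI[OF smooth_fun_power[OF sm]])
    show "((\<lambda>h. ?\<Theta> (x + h *\<^sub>R axis j 1) ^ n) has_real_derivative power_weight n m t x * conv (dker m j) (\<theta> t) x) (at 0)"
      using DERIV_power[OF smooth_axis_deriv[OF sm, of x j 0], of n] by (simp add: power_weight_def pdx_conv_ker[OF cper_\<theta>[OF t]] mult_ac)
  qed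
  have "avg (\<lambda>y. flux_kernel m (v t) x y * (power_weight n m t x * \<theta> t y)) = (\<Sum>j\<in>UNIV. v t x $ j * pdx (\<lambda>x. ?\<Theta> x ^ n) j x)" for x
  proof -
    have "avg (\<lambda>y. flux_kernel m (v t) x y * (power_weight n m t x * \<theta> t y)) = avg (\<lambda>y. \<Sum>j\<in>UNIV. (v t x $ j * power_weight n m t x) * (dker m j (x - y) * \<theta> t y))"
      by (intro integral_cube_cong) (simp add: flux_kernel_def sum_distrib_right sum_distrib_left mult_ac)
    also have "\<dots> = (\<Sum>j\<in>UNIV. (v t x $ j * power_weight n m t x) * conv (dker m j) (\<theta> t) x)"
      unfolding conv_def by (subst integral_sum) (auto intro!: integrable_cube continuous_intros cont_UNIV_compose[OF cper_cont[OF cper_\<theta>[OF t]]])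
    finally show ?thesis by (simp add: px mult_ac)
  qed
  then show ?thesis using weak_div_free_v[OF t] smooth_fun_power[OF sm, of n] cpp unfolding flux_def weak_div_free_def by simp
qed

end

section \<open>The mollified velocity and its energy\<close>

definition mollify :: "nat \<Rightarrow> (real^3 \<Rightarrow> real^3) \<Rightarrow> real^3 \<Rightarrow> real^3" where
  "mollify m W x = (\<chi> i. conv (ker m) (\<lambda>y. W y $ i) x)"

lemma mollify_nth [simp]: "mollify m W x $ i = conv (ker m) (\<lambda>y. W y $ i) x" by (simp add: mollify_def)

lemma smooth_mollify: "cper W \<Longrightarrow> smooth_fun (\<lambda>x. mollify m W x $ i)"
  using smooth_conv_ker(1)[OF cper_vec_nth] by simp

lemma cper_mollify: assumes W: "cper W" shows "cper (mollify m W)"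
proof -
  have "cper (\<lambda>x. conv (ker m) (\<lambda>y. W y $ i) x)" for i using cper_conv_ker[OF cper_vec_nth[OF W]] .
  then show ?thesis unfolding cper_def periodic3_def mollify_def
    by (auto intro!: continuous_on_vec_lambda)
qed

lemma pdx_mollify: "cper W \<Longrightarrow> pdx (\<lambda>y. mollify m W y $ i) j x = conv (dker m j) (\<lambda>y. W y $ i) x"
  using pdx_conv_ker[OF cper_vec_nth] by simp

text \<open>The gradient of the kernel is odd, so the divergence at x is a pairing of W with the
  gradient of the kernel centred at x.\<close>

lemma div_free_mollify:
  assumes W: "cper W" "weak_div_free W"
  shows "(\<Sum>i\<in>UNIV. pdx (\<lambda>y. mollify m W y $ i) i x) = 0"
proof -
  have e: "dker m i (x - y) = - dker m i (y - x)" for i y using dker_minus[of m i "x - y"] by simp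
  have "(\<Sum>i\<in>UNIV. pdx (\<lambda>y. mollify m W y $ i) i x) = (\<Sum>i\<in>UNIV. avg (\<lambda>y. dker m i (x - y) * W y $ i))"
    unfolding pdx_mollify[OF W(1)] conv_def by simp
  also have "\<dots> = avg (\<lambda>y. \<Sum>i\<in>UNIV. dker m i (x - y) * W y $ i)"
    by (subst integral_sum) (auto intro!: integrable_cube continuous_intros cont_UNIV_compose[OF cper_cont[OF W(1)]])
  also have "\<dots> = avg (\<lambda>y. - flux_kernel m W y x)"
    by (intro integral_cube_cong) (simp add: flux_kernel_def e sum_negf)
  also have "\<dots> = 0" using integral_flux_kernel_left[OF W(2)] by simp
  finally show ?thesis .
qed

text \<open>The kernel is even, so convolution with it is self-adjoint; this is the symmetry
  required by \<open>diagonal_ftc\<close>.\<close>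

lemma mollify_sym:
  assumes U: "cper U" and W: "cper W"
  shows "avg (\<lambda>x. U x \<bullet> mollify m W x) = avg (\<lambda>x. W x \<bullet> mollify m U x)"
proof -
  note c = cont_UNIV_compose[OF cper_cont[OF U]] cont_UNIV_compose[OF cper_cont[OF W]]
  have e: "ker m (y - x) = ker m (x - y)" for x y using ker_minus[of m "x - y"] by simp
  have *: "U x \<bullet> mollify m W x = avg (\<lambda>y. ker m (x - y) * (U x \<bullet> W y))" if "cper W" for U W x
  proof -
    note c = cont_UNIV_compose[OF cper_cont[OF that]]
    have "U x \<bullet> mollify m W x = (\<Sum>i\<in>UNIV. U x $ i * avg (\<lambda>y. ker m (x - y) * W y $ i))"
      by (simp add: inner_vec_def conv_def)
    also have "\<dots> = avg (\<lambda>y. \<Sum>i\<in>UNIV. U x $ i * (ker m (x - y) * W y $ i))"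
      by (subst integral_sum) (auto intro!: integrable_cube continuous_intros c)
    also have "\<dots> = avg (\<lambda>y. ker m (x - y) * (U x \<bullet> W y))"
      by (intro integral_cube_cong) (simp add: inner_vec_def sum_distrib_left mult_ac)
    finally show ?thesis .
  qed
  have "avg (\<lambda>x. U x \<bullet> mollify m W x) = avg (\<lambda>x. avg (\<lambda>y. ker m (x - y) * (U x \<bullet> W y)))"
    unfolding *[OF W] ..
  also have "\<dots> = avg (\<lambda>y. avg (\<lambda>x. ker m (x - y) * (U x \<bullet> W y)))"
    by (intro integral_cube_swap continuous_intros c)
  also have "\<dots> = avg (\<lambda>x. W x \<bullet> mollify m U x)"
    unfolding *[OF U] by (simp add: e inner_commute)
  finally show ?thesis .
qed

lemma tendsto_integral_conv:
  fixes f g :: "real^3 \<Rightarrow> real"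
  assumes f: "cper f" and g: "cper g"
  shows "(\<lambda>m. avg (\<lambda>x. f x * conv (ker m) g x)) \<longlonglongrightarrow> avg (\<lambda>x. f x * g x)"
proof -
  obtain M where M: "M > 0" "\<And>x. norm (f x) \<le> M" using cper_bounded[OF f] by blast
  obtain N where N: "N > 0" "\<And>x. norm (g x) \<le> N" using cper_bounded[OF g] by blast
  show ?thesis
  proof (rule dominated_convergence(2)[where h="\<lambda>x. M * N"])
    show "(\<lambda>x. f x * conv (ker m) g x) integrable_on cube" for m
      by (intro integrable_cube continuous_intros cper_cont f cper_conv_ker g)
    show "(\<lambda>x::real^3. M * N) integrable_on cube" by (intro integrable_cube continuous_intros)
    show "norm (f x * conv (ker m) g x) \<le> M * N" for m x
      unfolding norm_mult using M N norm_conv_ker_le[OF g N(2), of m x] by (intro mult_mono) auto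
    show "(\<lambda>m. f x * conv (ker m) g x) \<longlonglongrightarrow> f x * g x" for x
      by (intro tendsto_intros conv_ker_tendsto g)
  qed
qed

lemma tendsto_integral_mollify:
  assumes W: "cper W"
  shows "(\<lambda>m. avg (\<lambda>x. W x \<bullet> mollify m W x)) \<longlonglongrightarrow> avg (\<lambda>x. W x \<bullet> W x)"
proof -
  note c = cper_cont[OF cper_vec_nth[OF W]] cper_cont[OF cper_conv_ker[OF cper_vec_nth[OF W]]]
  have "avg (\<lambda>x. W x \<bullet> mollify m W x) = (\<Sum>i\<in>UNIV. avg (\<lambda>x. W x $ i * conv (ker m) (\<lambda>y. W y $ i) x))" for m
    unfolding inner_vec_def mollify_nth inner_real_def by (intro integral_sum integrable_cube continuous_intros c) auto
  moreover have "avg (\<lambda>x. W x \<bullet> W x) = (\<Sum>i\<in>UNIV. avg (\<lambda>x. W x $ i * W x $ i))"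
    unfolding inner_vec_def inner_real_def by (intro integral_sum integrable_cube continuous_intros c) auto
  ultimately show ?thesis
    by (simp only:) (intro tendsto_sum tendsto_integral_conv cper_vec_nth W)
qed

context boussinesq
begin

lemma cont_conv_v:
  assumes "continuous_on S a" "continuous_on S b" "a ` S \<subseteq> {0..T}"
  shows "continuous_on (S::'a::t2_space set) (\<lambda>p. conv (ker m) (\<lambda>y. v (a p) y $ i) (b p))"
    and "continuous_on (S::'a::t2_space set) (\<lambda>p. conv (dker m j) (\<lambda>y. v (a p) y $ i) (b p))"
  unfolding conv_def
  by (intro cont_integral_cube continuous_intros cont_v' continuous_on_compose2[OF assms(1)] continuous_on_compose2[OF assms(2)]; use assms(3) in auto)+

lemma v_weak_mollify:
  assumes W: "cper W" "weak_div_free W" and t: "t \<in> {0..T}"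
  shows "avg (\<lambda>x. v t x \<bullet> mollify m W x) = avg (\<lambda>x. vin x \<bullet> mollify m W x)
     + integral {0..t} (\<lambda>s. avg (\<lambda>x. (\<Sum>i\<in>UNIV. \<Sum>j\<in>UNIV. conv (dker m j) (\<lambda>y. W y $ i) x * v s x $ i * v s x $ j) + \<theta> s x * conv (ker m) (\<lambda>y. W y $ 3) x))"
  using v_weak[OF smooth_mollify[OF W(1)] _ div_free_mollify[OF W] t, of m] cper_mollify[OF W(1), of m]
  unfolding pdx_mollify[OF W(1)] by (simp add: cper_def)

text \<open>The identity at t = 0 is tested with the mollification of v(0) and then with that of
  \<open>vin\<close>, and self-adjointness exchanges the two fields in between. No pointwise
  comparison of v(0) with \<open>vin\<close> is made.\<close>

lemma v_initial: "avg (\<lambda>x. v 0 x \<bullet> mollify m (v 0) x) = avg (\<lambda>x. vin x \<bullet> mollify m vin x)"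
proof -
  have 0: "0 \<in> {0..T}" using T by simp
  have "avg (\<lambda>x. v 0 x \<bullet> mollify m (v 0) x) = avg (\<lambda>x. vin x \<bullet> mollify m (v 0) x)"
    using v_weak_mollify[OF cper_v[OF 0] weak_div_free_v[OF 0] 0, of m] by simp
  also have "\<dots> = avg (\<lambda>x. v 0 x \<bullet> mollify m vin x)"
    by (rule mollify_sym[OF cper_vin cper_v[OF 0]])
  also have "\<dots> = avg (\<lambda>x. vin x \<bullet> mollify m vin x)"
    using v_weak_mollify[OF cper_vin weak_div_free_vin 0, of m] by simp
  finally show ?thesis .
qed

lemma v_energy_0: "avg (\<lambda>x. v 0 x \<bullet> v 0 x) = avg (\<lambda>x. vin x \<bullet> vin x)"
  using tendsto_integral_mollify[OF cper_v[of 0]] tendsto_integral_mollify[OF cper_vin] T LIMSEQ_unique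
  unfolding v_initial by auto

text \<open>The bilinear form is v(s) against the mollified v(t). On the diagonal its s-derivative
  regroups into one flux for each velocity component plus the work of buoyancy.\<close>

lemma v_energy_evolution:
  assumes t: "t \<in> {0..T}"
  shows "avg (\<lambda>x. v t x \<bullet> mollify m (v t) x) = avg (\<lambda>x. v 0 x \<bullet> mollify m (v 0) x)
    + 2 * integral {0..t} (\<lambda>s. (\<Sum>i\<in>UNIV. flux m (v s) (\<lambda>x. v s x $ i) (\<lambda>x. v s x $ i)) + avg (\<lambda>x. \<theta> s x * conv (ker m) (\<lambda>y. v s y $ 3) x))"
proof -
  define F where "F = (\<lambda>r t. avg (\<lambda>x. (\<Sum>i\<in>UNIV. \<Sum>j\<in>UNIV. conv (dker m j) (\<lambda>y. v t y $ i) x * v r x $ i * v r x $ j) + \<theta> r x * conv (ker m) (\<lambda>y. v t y $ 3) x))"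
  have "avg (\<lambda>x. v t x \<bullet> mollify m (v t) x) = avg (\<lambda>x. v 0 x \<bullet> mollify m (v 0) x) + 2 * integral {0..t} (\<lambda>r. F r r)"
  proof (rule diagonal_ftc[OF _ _ _ t, where B="\<lambda>s t. avg (\<lambda>x. v s x \<bullet> mollify m (v t) x)" and c="\<lambda>t. avg (\<lambda>x. vin x \<bullet> mollify m (v t) x)" and F=F])
    fix r s assume rs: "r \<in> {0..T}" "s \<in> {0..T}"
    show "avg (\<lambda>x. v r x \<bullet> mollify m (v s) x) = avg (\<lambda>x. v s x \<bullet> mollify m (v r) x)"
      by (intro mollify_sym cper_v rs)
    show "avg (\<lambda>x. v r x \<bullet> mollify m (v s) x) = avg (\<lambda>x. vin x \<bullet> mollify m (v s) x) + integral {0..r} (\<lambda>r. F r s)"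
      unfolding F_def by (intro v_weak_mollify cper_v weak_div_free_v rs)
  next
    show "continuous_on ({0..T} \<times> {0..T}) (\<lambda>p. F (fst p) (snd p))"
      unfolding F_def by (intro cont_integral_cube continuous_intros cont_v' cont_\<theta>' cont_conv_v) auto
  qed
  also have "integral {0..t} (\<lambda>r. F r r) = integral {0..t} (\<lambda>s. (\<Sum>i\<in>UNIV. flux m (v s) (\<lambda>x. v s x $ i) (\<lambda>x. v s x $ i)) + avg (\<lambda>x. \<theta> s x * conv (ker m) (\<lambda>y. v s y $ 3) x))"
  proof (rule integral_cong)
    fix s assume "s \<in> {0..t}"
    then have s: "s \<in> {0..T}" using t by auto
    note cv = cont_UNIV_compose[OF cper_cont[OF cper_v[OF s]]]
    have *: "avg (\<lambda>y. flux_kernel m (v s) x y * (v s x $ i * v s y $ i)) = (\<Sum>j\<in>UNIV. conv (dker m j) (\<lambda>y. v s y $ i) x * v s x $ i * v s x $ j)" for i x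
    proof -
      have "avg (\<lambda>y. flux_kernel m (v s) x y * (v s x $ i * v s y $ i)) = avg (\<lambda>y. \<Sum>j\<in>UNIV. (v s x $ i * v s x $ j) * (dker m j (x - y) * v s y $ i))"
        by (intro integral_cube_cong) (simp add: flux_kernel_def sum_distrib_left mult_ac)
      also have "\<dots> = (\<Sum>j\<in>UNIV. (v s x $ i * v s x $ j) * conv (dker m j) (\<lambda>y. v s y $ i) x)"
        unfolding conv_def by (subst integral_sum) (auto intro!: integrable_cube continuous_intros cv)
      finally show ?thesis by (simp add: mult_ac)
    qed
    have cc: "continuous_on UNIV (\<lambda>x. conv (ker m) (\<lambda>y. v s y $ i) x)" "continuous_on UNIV (\<lambda>x. conv (dker m j) (\<lambda>y. v s y $ i) x)" for i j
      by (intro cont_conv_v continuous_intros; use s in auto)+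
    have "F s s = avg (\<lambda>x. \<Sum>i\<in>UNIV. \<Sum>j\<in>UNIV. conv (dker m j) (\<lambda>y. v s y $ i) x * v s x $ i * v s x $ j) + avg (\<lambda>x. \<theta> s x * conv (ker m) (\<lambda>y. v s y $ 3) x)"
      unfolding F_def by (intro integral_add integrable_cube continuous_intros cv cc cper_cont cper_\<theta> s)
    also have "avg (\<lambda>x. \<Sum>i\<in>UNIV. \<Sum>j\<in>UNIV. conv (dker m j) (\<lambda>y. v s y $ i) x * v s x $ i * v s x $ j) = (\<Sum>i\<in>UNIV. flux m (v s) (\<lambda>x. v s x $ i) (\<lambda>x. v s x $ i))"
      unfolding flux_def * by (intro integral_sum integrable_cube continuous_intros cv cc) auto
    finally show "F s s = (\<Sum>i\<in>UNIV. flux m (v s) (\<lambda>x. v s x $ i) (\<lambda>x. v s x $ i)) + avg (\<lambda>x. \<theta> s x * conv (ker m) (\<lambda>y. v s y $ 3) x)" .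
  qed
  finally show ?thesis .
qed

lemma cont_flux_v: "continuous_on {0..T} (\<lambda>s. flux m (v s) (\<lambda>x. v s x $ i) (\<lambda>x. v s x $ i))"
  unfolding flux_def flux_kernel_def
  by (intro cont_integral_cube continuous_intros cont_v') auto

lemma cont_work: "continuous_on {0..T} (\<lambda>s. avg (\<lambda>x. \<theta> s x * conv (ker m) (\<lambda>y. v s y $ i) x))"
  by (intro cont_integral_cube continuous_intros cont_\<theta>' cont_conv_v) auto

end

section \<open>Besov hypotheses\<close>

lemma norm_le_Lp_inf:
  fixes f :: "real^3 \<Rightarrow> 'b::real_normed_vector"
  assumes f: "cper f" shows "norm (f x) \<le> Lp_norm \<infinity> f"
proof -
  obtain k where k: "k \<in> Zvecs" "x - k \<in> cube" by (rule periodic_in_cube)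
  have "f (x - k + k) = f (x - k)" using f k(1) unfolding cper_def periodic3_def by blast
  moreover have "bdd_above ((\<lambda>x. norm (f x)) ` cube)"
    using cper_bounded[OF f] by (metis bdd_aboveI2)
  then have "norm (f (x - k)) \<le> Sup ((\<lambda>x. norm (f x)) ` cube)"
    using k(2) by (intro cSup_upper) auto
  ultimately show ?thesis by (simp add: Lp_norm_def)
qed

lemma Lp_norm_nonneg:
  fixes f :: "real^3 \<Rightarrow> 'b::real_normed_vector"
  assumes "cper f" shows "0 \<le> Lp_norm q f"
  using order_trans[OF norm_ge_zero norm_le_Lp_inf[OF assms]] by (cases "q = \<infinity>") (auto simp: Lp_norm_def)

text \<open>Weighted arithmetic-geometric mean of y^r and 1, with weights 2/r and 1 - 2/r.\<close>

lemma square_le_powr_combination: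
  fixes y r :: real
  assumes "0 \<le> y" "2 \<le> r" shows "y\<^sup>2 \<le> (1 - 2/r) + (2/r) * y powr r"
proof (cases "y = 0")
  case True then show ?thesis using assms by simp
next
  case False
  then have y: "y > 0" using assms by simp
  have "(y powr r) powr (2/r) * 1 powr (1 - 2/r) \<le> (2/r) * (y powr r) + (1 - 2/r) * 1"
    using assms y by (intro Youngs_inequality_0) auto
  moreover have "(y powr r) powr (2/r) = y\<^sup>2" using assms y by (simp add: powr_powr powr_numeral)
  ultimately show ?thesis by simp
qed

text \<open>Jensen on a space of mass one: the convex combination above, applied to |f|/L, is
  integrated. L exceeds the norm by e > 0 so that the division makes sense even if the norm is
  zero.\<close>

lemma L2_le_Lp:
  fixes f :: "real^3 \<Rightarrow> 'b::real_normed_vector"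
  assumes f: "cper f" and q: "2 \<le> q"
  shows "avg (\<lambda>x. (norm (f x))\<^sup>2) \<le> (Lp_norm q f)\<^sup>2"
proof (cases "q = \<infinity>")
  case True
  have "avg (\<lambda>x. (norm (f x))\<^sup>2) \<le> avg (\<lambda>x. (Lp_norm \<infinity> f)\<^sup>2)"
    by (intro integral_le integrable_cube continuous_intros cper_cont f power_mono norm_le_Lp_inf) auto
  then show ?thesis using True by simp
next
  case False
  define r where "r = real_of_ereal q"
  have qr: "q = ereal r" using q False by (cases q) (auto simp: r_def)
  have r: "r \<ge> 2" using q by (simp add: qr)
  define I where "I = avg (\<lambda>x. norm (f x) powr r)"
  have cont: "continuous_on UNIV (\<lambda>x. norm (f x) powr r)"
    by (rule continuous_on_powr') (use r in \<open>auto intro!: continuous_on_norm[OF cper_cont[OF f]]\<close>)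
  have I: "I \<ge> 0" unfolding I_def by (intro integral_nonneg integrable_cube cont) auto
  have N: "Lp_norm q f = I powr (1/r)" using False by (simp add: Lp_norm_def I_def r_def)
  have "avg (\<lambda>x. (norm (f x))\<^sup>2) \<le> (Lp_norm q f + e)\<^sup>2" if e: "e > 0" for e
  proof -
    define L where "L = Lp_norm q f + e"
    have L: "L > 0" using e Lp_norm_nonneg[OF f, of q] by (simp add: L_def)
    have "I = (Lp_norm q f) powr r" using I r by (simp add: N powr_powr)
    also have "\<dots> \<le> L powr r" using e r Lp_norm_nonneg[OF f, of q] by (intro powr_mono2) (auto simp: L_def)
    finally have IL: "I / L powr r \<le> 1" using L by (simp add: divide_le_eq)
    have "avg (\<lambda>x. (norm (f x))\<^sup>2) \<le> avg (\<lambda>x. L\<^sup>2 * (1 - 2/r) + (L\<^sup>2 * (2/r) / L powr r) * norm (f x) powr r)"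
    proof (intro integral_le integrable_cube continuous_on_add continuous_on_mult continuous_on_const
        continuous_on_power continuous_on_norm cper_cont[OF f] cont)
      fix x
      have "(norm (f x) / L)\<^sup>2 \<le> (1 - 2/r) + (2/r) * (norm (f x) / L) powr r"
        using L r by (intro square_le_powr_combination) auto
      then have "L\<^sup>2 * (norm (f x) / L)\<^sup>2 \<le> L\<^sup>2 * ((1 - 2/r) + (2/r) * (norm (f x) / L) powr r)"
        by (intro mult_left_mono) auto
      then show "(norm (f x))\<^sup>2 \<le> L\<^sup>2 * (1 - 2/r) + (L\<^sup>2 * (2/r) / L powr r) * norm (f x) powr r"
        using L by (simp add: power_divide powr_divide distrib_left)
    qed
    also have "\<dots> = L\<^sup>2 * (1 - 2/r) + (L\<^sup>2 * (2/r) / L powr r) * I"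
      unfolding I_def
      by (subst integral_add, (intro integrable_cube continuous_on_mult continuous_on_const cont)+) simp
    also have "\<dots> = L\<^sup>2 * ((1 - 2/r) + (2/r) * (I / L powr r))" by (simp add: algebra_simps)
    also have "\<dots> \<le> L\<^sup>2 * ((1 - 2/r) + (2/r) * 1)"
      using IL r by (intro mult_left_mono add_left_mono) auto
    finally show ?thesis by (simp add: L_def)
  qed
  then have ev: "\<forall>\<^sub>F e in at_right 0. avg (\<lambda>x. (norm (f x))\<^sup>2) \<le> (Lp_norm q f + e)\<^sup>2"
    by (auto simp: eventually_at_filter)
  have "((\<lambda>e. (Lp_norm q f + e)\<^sup>2) \<longlongrightarrow> (Lp_norm q f + 0)\<^sup>2) (at_right 0)"
    by (intro tendsto_intros)
  from tendsto_lowerbound[OF this ev] show ?thesis by simp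
qed

text \<open>The bound \<open>w\<close> and the almost-everywhere statements belong to Lebesgue
  measure on {0..T}, while the time integrals are gauge integrals up to t. Continuity of F and L in
  time identifies the two kinds of integral.\<close>

lemma time_dominated:
  fixes F :: "nat \<Rightarrow> real \<Rightarrow> real"
  assumes F: "\<And>m. continuous_on {0..T} (F m)" and L: "continuous_on {0..T} L" and t: "t \<in> {0..T}"
    and w: "integrable (lebesgue_on {0..T}) w"
    and lim: "AE s in lebesgue_on {0..T}. (\<lambda>m. F m s) \<longlonglongrightarrow> L s"
    and bd: "AE s in lebesgue_on {0..T}. \<forall>m. \<bar>F m s\<bar> \<le> w s"
  shows "(\<lambda>m. integral {0..t} (F m)) \<longlonglongrightarrow> integral {0..t} L"
proof -
  have sub: "{0..t} \<subseteq> {0..T}" using t by auto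
  have ae: "AE s in lebesgue_on {0..t}. P s" if "AE s in lebesgue_on {0..T}. P s" for P
  proof -
    have "AE s in lebesgue. s \<in> {0..T} \<longrightarrow> P s" using that by (subst (asm) AE_restrict_space_iff) auto
    then have "AE s in lebesgue. s \<in> {0..t} \<longrightarrow> P s" using sub by (auto elim!: eventually_mono)
    then show ?thesis by (subst AE_restrict_space_iff) auto
  qed
  have wt: "integrable (lebesgue_on {0..t}) w"
  proof -
    have "set_integrable lebesgue {0..T} w" using w unfolding set_integrable_def by (subst (asm) integrable_restrict_space) auto
    then have "set_integrable lebesgue {0..t} w" by (rule set_integrable_subset[OF _ _ sub]) auto
    then show ?thesis unfolding set_integrable_def by (subst integrable_restrict_space) auto
  qed
  have ci: "integrable (lebesgue_on {0..t}) f" if "continuous_on {0..T} f" for f :: "real \<Rightarrow> real"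
    using continuous_imp_integrable[of 0 t f] continuous_on_subset[OF that sub] by simp
  have eq: "integral\<^sup>L (lebesgue_on {0..t}) f = integral {0..t} f" if "continuous_on {0..T} f" for f :: "real \<Rightarrow> real"
    by (rule lebesgue_integral_eq_integral[OF ci[OF that]]) auto
  have "(\<lambda>m. integral\<^sup>L (lebesgue_on {0..t}) (F m)) \<longlonglongrightarrow> integral\<^sup>L (lebesgue_on {0..t}) L"
  proof (rule integral_dominated_convergence[OF _ _ wt])
    show "L \<in> borel_measurable (lebesgue_on {0..t})" using ci[OF L] by auto
    show "F m \<in> borel_measurable (lebesgue_on {0..t})" for m using ci[OF F] by auto
    show "AE s in lebesgue_on {0..t}. (\<lambda>m. F m s) \<longlonglongrightarrow> L s" by (rule ae[OF lim])
    show "AE s in lebesgue_on {0..t}. norm (F m s) \<le> w s" for m using ae[OF bd] by (auto elim: eventually_mono)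
  qed
  then show ?thesis by (simp add: eq F L)
qed

text \<open>The constant C may depend on e: with e fixed, m is sent to infinity. The denominator is
  that of \<open>flux_holder\<close> with \<open>Suc m\<close> in place of m.\<close>

lemma tendsto_zero_criterion:
  fixes F :: "nat \<Rightarrow> real"
  assumes K: "K \<ge> 0" and F: "\<And>e. e > 0 \<Longrightarrow> \<exists>C. \<forall>m. \<bar>F m\<bar> \<le> K * e + C / (2 * real (Suc m) + 4)"
  shows "F \<longlonglongrightarrow> 0"
proof (rule LIMSEQ_I)
  fix r :: real assume r: "r > 0"
  define e where "e = r / (2 * (K + 1))"
  have e: "e > 0" using r K by (simp add: e_def)
  have Ke: "K * e < r/2 + 0"
  proof -
    have "K * e < (K + 1) * e" using e by simp
    also have "\<dots> = r/2" using K by (simp add: e_def field_simps)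
    finally show ?thesis by simp
  qed
  obtain C where C: "\<And>m. \<bar>F m\<bar> \<le> K * e + C / (2 * real (Suc m) + 4)" using F[OF e] by blast
  have "(\<lambda>m. (\<bar>C\<bar>/2) * inverse (real (Suc m))) \<longlonglongrightarrow> 0"
    using tendsto_mult_right_zero[OF LIMSEQ_inverse_real_of_nat] by blast
  from order_tendstoD(2)[OF this, of "r/2"] r
  obtain N where N: "\<And>m. m \<ge> N \<Longrightarrow> (\<bar>C\<bar>/2) * inverse (real (Suc m)) < r/2"
    unfolding eventually_sequentially by auto
  have "norm (F m - 0) < r" if "m \<ge> N" for m
  proof -
    have "C / (2 * real (Suc m) + 4) \<le> \<bar>C\<bar> / (2 * real (Suc m))"
      by (intro frac_le) auto
    also have "\<dots> = (\<bar>C\<bar>/2) * inverse (real (Suc m))" by (simp add: field_simps)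
    finally show ?thesis using N[OF that] C[of m] Ke unfolding real_norm_def diff_0_right by linarith
  qed
  then show "\<exists>N. \<forall>m\<ge>N. norm (F m - 0) < r" by blast
qed

lemma powr_cancel: "2 powr x * (c * 2 powr (- x)) = c" "2 powr (- x) * (2 powr x * c) = c" for c x :: real
  by (simp_all add: powr_minus)

context littlewood_paley
begin

text \<open>The norm weights block j = n - 1 by 2^(j/3); rewriting the weight in n costs 2^(1/3),
  rounded up to 2.\<close>

lemma besov_block:
  assumes fin: "besov_norm \<kappa> \<phi> (1/3) q f < \<infinity>"
  shows "Lp_norm q (block n f) \<le> (2 * enn2real (besov_norm \<kappa> \<phi> (1/3) q f)) * 2 powr (- (real n / 3))"
proof -
  let ?B = "besov_norm \<kappa> \<phi> (1/3) q f"
  define j :: int where "j = int n - 1"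
  have "ennreal (2 powr (real_of_int j * (1/3)) * Lp_norm q (LP_block \<kappa> \<phi> j f)) \<le> ?B"
    unfolding besov_norm_def by (rule SUP_upper) simp
  also have "?B = ennreal (enn2real ?B)" using fin by simp
  finally have 1: "2 powr (real_of_int j * (1/3)) * Lp_norm q (block n f) \<le> enn2real ?B"
    unfolding j_def LP_block_eq by (simp add: ennreal_le_iff)
  have "Lp_norm q (block n f) = 2 powr (- (real_of_int j * (1/3))) * (2 powr (real_of_int j * (1/3)) * Lp_norm q (block n f))"
    by (simp add: powr_minus)
  also have "\<dots> \<le> 2 powr (- (real_of_int j * (1/3))) * enn2real ?B" using 1 by (intro mult_left_mono) auto
  also have "- (real_of_int j * (1/3)) = 1/3 + - (real n / 3)" by (simp add: j_def field_simps)
  also have "2 powr (1/3 + - (real n / 3)) = 2 powr (1/3) * 2 powr (- (real n / 3))" by (rule powr_add)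
  also have "\<dots> * enn2real ?B \<le> 2 * 2 powr (- (real n / 3)) * enn2real ?B"
    using powr_mono[of "1/3" 1 "2::real"] by (intro mult_right_mono) auto
  finally show ?thesis by (simp add: mult_ac)
qed

lemma besov_c_holder:
  assumes f: "cper f" and b: "besov_c \<kappa> \<phi> (1/3) \<infinity> f" and e: "e > 0"
  obtains d where "d > 0" "\<And>x z. norm z < d \<Longrightarrow> \<bar>f (x + z) - f x\<bar> \<le> e * norm z powr (1/3)"
proof -
  define b where "b = (\<lambda>n. 2 powr (real n / 3) * Lp_norm \<infinity> (block n f))"
  have "(\<lambda>j::nat. 2 powr (1/3) * (2 powr (real j * (1/3)) * Lp_norm \<infinity> (LP_block \<kappa> \<phi> (int j) f))) \<longlonglongrightarrow> 0"
    using b unfolding besov_c_def by (intro tendsto_mult_right_zero) auto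
  moreover have "2 powr (1/3) * (2 powr (real j * (1/3)) * Lp_norm \<infinity> (LP_block \<kappa> \<phi> (int j) f)) = b (Suc j)" for j
    using LP_block_eq[of "Suc j" f] by (simp add: b_def add_divide_distrib powr_add)
  ultimately have "(\<lambda>j. b (Suc j)) \<longlonglongrightarrow> 0" by (simp only:)
  then have b0: "b \<longlonglongrightarrow> 0" by (simp only: filterlim_sequentially_Suc)
  have "norm (block n f x) \<le> b n * 2 powr (- (real n / 3))" for n x
    using norm_le_Lp_inf[OF cper_block, of n f x] by (simp only: b_def mult.assoc powr_cancel)
  from holder_sup_little[OF f this b0 e] show ?thesis using that by blast
qed

lemma besov_holder:
  assumes f: "cper f" and b: "besov_norm \<kappa> \<phi> (1/3) \<infinity> f \<le> ennreal C" and C: "C \<ge> 0"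
  shows "\<bar>f (x + z) - f x\<bar> \<le> holder_const * (2 * C) * norm z powr (1/3)"
proof (rule holder_sup[OF f])
  fix n x
  have fin: "besov_norm \<kappa> \<phi> (1/3) \<infinity> f < \<infinity>" using b le_less_trans by fastforce
  have "enn2real (besov_norm \<kappa> \<phi> (1/3) \<infinity> f) \<le> C" using b C enn2real_leI by blast
  then have "(2 * enn2real (besov_norm \<kappa> \<phi> (1/3) \<infinity> f)) * 2 powr (- (real n / 3)) \<le> (2 * C) * 2 powr (- (real n / 3))"
    by (intro mult_right_mono) auto
  then show "norm (block n f x) \<le> (2 * C) * 2 powr (- (real n / 3))"
    using norm_le_Lp_inf[OF cper_block, of n f x] besov_block[OF fin, of n] by linarith
qed

text \<open>The norm of B^(1/3)_(2,\<infinity>) up to a factor 2^(1/3), which comes from using n = j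
  + 1 in the weight.\<close>

definition besov2 :: "(real^3 \<Rightarrow> real) \<Rightarrow> ennreal" where
  "besov2 f = (SUP n::nat. ennreal (2 powr (real n / 3) * sqrt (avg (\<lambda>x. (norm (block n f x))\<^sup>2))))"

lemma besov2_block:
  assumes "besov2 f < \<infinity>"
  shows "avg (\<lambda>x. (norm (block n f x))\<^sup>2) \<le> (enn2real (besov2 f) * 2 powr (- (real n / 3)))\<^sup>2"
proof -
  let ?I = "avg (\<lambda>x. (norm (block n f x))\<^sup>2)"
  have I: "?I \<ge> 0" by (intro integral_nonneg integrable_cube continuous_intros cper_cont cper_block) auto
  have "ennreal (2 powr (real n / 3) * sqrt ?I) \<le> besov2 f" unfolding besov2_def by (rule SUP_upper) simp
  also have "besov2 f = ennreal (enn2real (besov2 f))" using assms by simp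
  finally have "2 powr (real n / 3) * sqrt ?I \<le> enn2real (besov2 f)" by (simp add: ennreal_le_iff)
  then have "2 powr (- (real n / 3)) * (2 powr (real n / 3) * sqrt ?I) \<le> 2 powr (- (real n / 3)) * enn2real (besov2 f)"
    by (intro mult_left_mono) auto
  then have "sqrt ?I \<le> enn2real (besov2 f) * 2 powr (- (real n / 3))" unfolding powr_cancel(2) by (simp only: mult.commute)
  then have "(sqrt ?I)\<^sup>2 \<le> (enn2real (besov2 f) * 2 powr (- (real n / 3)))\<^sup>2" using I by (intro power_mono) auto
  then show ?thesis using I by simp
qed

lemma besov2_le_besov:
  assumes q: "2 \<le> q" and fin: "besov_norm \<kappa> \<phi> (1/3) q f < \<infinity>"
  shows "besov2 f \<le> ennreal (2 * enn2real (besov_norm \<kappa> \<phi> (1/3) q f))"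
  unfolding besov2_def
proof (rule SUP_least, rule ennreal_leI)
  fix n
  let ?B = "2 * enn2real (besov_norm \<kappa> \<phi> (1/3) q f)"
  have "sqrt (avg (\<lambda>x. (norm (block n f x))\<^sup>2)) \<le> Lp_norm q (block n f)"
    using L2_le_Lp[OF cper_block q, of n f] Lp_norm_nonneg[OF cper_block] by (intro real_le_lsqrt) auto
  also have "\<dots> \<le> ?B * 2 powr (- (real n / 3))" by (rule besov_block[OF fin])
  finally have "2 powr (real n / 3) * sqrt (avg (\<lambda>x. (norm (block n f x))\<^sup>2)) \<le> 2 powr (real n / 3) * (?B * 2 powr (- (real n / 3)))"
    by (intro mult_left_mono) auto
  then show "2 powr (real n / 3) * sqrt (avg (\<lambda>x. (norm (block n f x))\<^sup>2)) \<le> ?B"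
    by (simp only: powr_cancel)
qed

end

section \<open>Energy balance and conservation of moments\<close>

definition holder :: "real \<Rightarrow> (real^3 \<Rightarrow> real^3) \<Rightarrow> bool" where
  "holder C V \<longleftrightarrow> (\<forall>x z j. \<bar>V (x + z) $ j - V x $ j\<bar> \<le> C * norm z powr (1/3))"

definition small_holder :: "(real^3 \<Rightarrow> real^3) \<Rightarrow> bool" where
  "small_holder V \<longleftrightarrow> (\<forall>e>0. \<exists>d>0. \<forall>x z j. norm z < d \<longrightarrow> \<bar>V (x + z) $ j - V x $ j\<bar> \<le> e * norm z powr (1/3))"

locale boussinesq_lp = boussinesq T vin \<theta>in v \<theta> + littlewood_paley \<kappa> \<phi>
  for T vin \<theta>in v \<theta> \<kappa> \<phi>
begin

text \<open>By Parseval each term is the root of a finite sum of weighted squared Fourier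
  coefficients, continuous in time because \<theta> is, and the supremum is countable.\<close>

lemma besov2_measurable: "(\<lambda>s. besov2 (\<theta> s)) \<in> borel_measurable (lebesgue_on {0..T})"
  unfolding besov2_def
proof (intro borel_measurable_SUP measurable_compose[OF _ measurable_ennreal])
  fix n :: nat
  have "continuous_on {0..T} (\<lambda>s. 2 powr (real n / 3) * sqrt (avg (\<lambda>x. (norm (block n (\<theta> s) x))\<^sup>2)))"
    unfolding block_def parseval[OF finite_freqs freqs_Zvecs] fcoeff_def
    by (intro continuous_intros cont_integral_cube cont_\<theta>') auto
  then show "(\<lambda>s. 2 powr (real n / 3) * sqrt (avg (\<lambda>x. (norm (block n (\<theta> s) x))\<^sup>2))) \<in> borel_measurable (lebesgue_on {0..T})"
    by (rule continuous_imp_measurable_on_sets_lebesgue) auto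
qed auto

text \<open>The Besov norm in the hypothesis is not known to be measurable in time, but the integral of a
  nonnegative function is monotone regardless, and besov2 below it is measurable.\<close>

lemma besov2_square_integrable:
  assumes q: "2 \<le> q" and r: "2 \<le> r"
    and ae: "AE s in lebesgue_on {0..T}. besov_norm \<kappa> \<phi> (1/3) q (\<theta> s) < \<infinity>"
    and tm: "time_Lq r T (\<lambda>s. besov_norm \<kappa> \<phi> (1/3) q (\<theta> s))"
  shows "integrable (lebesgue_on {0..T}) (\<lambda>s. (enn2real (besov2 (\<theta> s)))\<^sup>2)"
    and "AE s in lebesgue_on {0..T}. besov2 (\<theta> s) < \<infinity>"
proof -
  let ?M = "lebesgue_on {0..T}"
  define \<beta> where "\<beta> = (\<lambda>s. enn2real (besov_norm \<kappa> \<phi> (1/3) q (\<theta> s)))"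
  \<comment> \<open>The half offsets the factor 2 of \<open>besov2_le_besov\<close>.\<close>
  define g where "g = (\<lambda>s. enn2real (besov2 (\<theta> s)) / 2)"
  have le: "AE s in ?M. besov2 (\<theta> s) \<le> ennreal (2 * \<beta> s)"
    using ae by eventually_elim (unfold \<beta>_def, rule besov2_le_besov[OF q])
  then show "AE s in ?M. besov2 (\<theta> s) < \<infinity>" by eventually_elim (auto intro: le_less_trans)
  have gle: "AE s in ?M. g s \<le> \<beta> s"
    using le
  proof eventually_elim
    case (elim s)
    then have "enn2real (besov2 (\<theta> s)) \<le> 2 * \<beta> s" by (intro enn2real_leI) (auto simp: \<beta>_def)
    then show ?case by (simp add: g_def)
  qed
  have gm: "g \<in> borel_measurable ?M" unfolding g_def using besov2_measurable by measurable
  have g0: "g s \<ge> 0" for s by (simp add: g_def)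
  have "integrable ?M (\<lambda>s. (g s)\<^sup>2)"
  proof (cases "r = \<infinity>")
    case True
    then obtain C where C: "AE s in ?M. besov_norm \<kappa> \<phi> (1/3) q (\<theta> s) \<le> ennreal C"
      using tm unfolding time_Lq_def by auto
    have "AE s in ?M. norm ((g s)\<^sup>2) \<le> norm ((max C 0)\<^sup>2)"
      using C gle
    proof eventually_elim
      case (elim s)
      have "\<beta> s \<le> max C 0" unfolding \<beta>_def
        by (intro enn2real_leI order_trans[OF elim(1)] ennreal_leI) auto
      then have "(g s)\<^sup>2 \<le> (max C 0)\<^sup>2" using elim(2) g0 by (intro power_mono) auto
      then show ?case by simp
    qed
    then show ?thesis
    proof (rule Bochner_Integration.integrable_bound[rotated 2])
      show "integrable ?M (\<lambda>_. (max C 0)\<^sup>2)" by (rule finite_measure.integrable_const[OF finite_measure_lebesgue_on]) simp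
      show "(\<lambda>s. (g s)\<^sup>2) \<in> borel_measurable ?M" using gm by measurable
    qed
  next
    case False
    define p where "p = real_of_ereal r"
    have p: "p \<ge> 2" "r = ereal p" using r False by (cases r; auto simp: p_def)+
    have fin: "(\<integral>\<^sup>+ s. ennreal (\<beta> s powr p) \<partial>?M) < \<infinity>"
      using tm False unfolding time_Lq_def by (auto simp: \<beta>_def p_def)
    have "(\<integral>\<^sup>+ s. ennreal (g s powr p) \<partial>?M) \<le> (\<integral>\<^sup>+ s. ennreal (\<beta> s powr p) \<partial>?M)"
    proof (rule nn_integral_mono_AE)
      show "AE s in ?M. ennreal (g s powr p) \<le> ennreal (\<beta> s powr p)"
        using gle by eventually_elim (use g0 p in \<open>auto intro!: ennreal_leI powr_mono2\<close>)
    qed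
    then have "(\<integral>\<^sup>+ s. ennreal (g s powr p) \<partial>?M) < \<infinity>" using fin by (rule le_less_trans)
    then have gp: "integrable ?M (\<lambda>s. g s powr p)"
      by (intro integrableI_nonneg) (use gm in auto)
    \<comment> \<open>Constants are integrable over the bounded time interval, so 1 + g^p can
      dominate g^2.\<close>
    have i1: "integrable ?M (\<lambda>s. 1 + g s powr p)"
      by (intro Bochner_Integration.integrable_add gp finite_measure.integrable_const[OF finite_measure_lebesgue_on]) simp
    show ?thesis
    proof (rule Bochner_Integration.integrable_bound[OF i1])
      show "(\<lambda>s. (g s)\<^sup>2) \<in> borel_measurable ?M" using gm by measurable
      have "(g s)\<^sup>2 \<le> 1 + g s powr p" for s
      proof -
        have "(g s)\<^sup>2 \<le> (1 - 2/p) + (2/p) * g s powr p" by (rule square_le_powr_combination[OF g0 p(1)])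
        also have "\<dots> \<le> 1 + 1 * g s powr p" using p by (intro add_mono mult_right_mono) auto
        finally show ?thesis by simp
      qed
      then show "AE s in ?M. norm ((g s)\<^sup>2) \<le> norm (1 + g s powr p)" using g0 by (simp add: abs_of_nonneg add_nonneg_nonneg)
    qed
  qed
  then have "integrable ?M (\<lambda>s. 4 * (g s)\<^sup>2)" by simp
  then show "integrable ?M (\<lambda>s. (enn2real (besov2 (\<theta> s)))\<^sup>2)" by (simp add: g_def power_divide)
qed

context
  fixes C :: real
  assumes C0: "C \<ge> 0"
    and v_holder: "AE s in lebesgue_on {0..T}. holder C (v s) \<and> small_holder (v s)"
begin

text \<open>The choice e = C, d = 1 gives a bound uniform in m, for use as a dominating function;
  the limit comes from sending m to infinity for fixed e and d. The kernel order starts at 2 because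
  \<open>flux_holder\<close> is applied with \<open>Suc m\<close> for its m, which must be at least
  1.\<close>

lemma flux_estimate:
  assumes s: "s \<in> {0..T}" and C: "holder C (v s)"
    and L: "small_holder (v s)"
    and f: "\<And>m. cper (f m)" and g: "\<And>m. cper (g m)" and E0: "E \<ge> 0"
    and E: "\<And>m z. avg (\<lambda>x. \<bar>f m (x + z) - f m x\<bar> * \<bar>g m (x + z) - g m x\<bar>) \<le> E * norm z powr (2/3)"
  shows "\<bar>flux (Suc (Suc m)) (v s) (f m) (g m) + flux (Suc (Suc m)) (v s) (g m) (f m)\<bar> \<le> 45 * pi * C * E"
    and "(\<lambda>m. flux (Suc (Suc m)) (v s) (f m) (g m) + flux (Suc (Suc m)) (v s) (g m) (f m)) \<longlonglongrightarrow> 0"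
proof -
  have est: "\<bar>flux (Suc (Suc m)) (v s) (f m) (g m) + flux (Suc (Suc m)) (v s) (g m) (f m)\<bar> \<le> 18 * pi * (e * E) + 162 * pi * (C * E / d\<^sup>2) / (2 * real (Suc m) + 4)"
    if "d > 0" "e \<ge> 0" "\<forall>x z j. norm z < d \<longrightarrow> \<bar>v s (x + z) $ j - v s x $ j\<bar> \<le> e * norm z powr (1/3)" for m d e
    using that C[unfolded holder_def] by (intro flux_holder[OF cper_v[OF s] weak_div_free_v[OF s] f g _ _ _ _ _ E E0 C0]) auto
  have "\<bar>flux (Suc (Suc m)) (v s) (f m) (g m) + flux (Suc (Suc m)) (v s) (g m) (f m)\<bar> \<le> 18 * pi * (C * E) + 162 * pi * (C * E / 1\<^sup>2) / (2 * real (Suc m) + 4)"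
    using C[unfolded holder_def] C0 by (intro est) auto
  \<comment> \<open>The denominator is at least 6 and 162/6 = 27, so the total constant is 18 + 27 =
    45.\<close>
  also have "162 * pi * (C * E / 1\<^sup>2) / (2 * real (Suc m) + 4) \<le> 162 * pi * (C * E) / 6"
    using C0 E0 by (simp only: power_one div_by_1) (intro divide_left_mono, auto)
  finally show "\<bar>flux (Suc (Suc m)) (v s) (f m) (g m) + flux (Suc (Suc m)) (v s) (g m) (f m)\<bar> \<le> 45 * pi * C * E" by (simp add: mult_ac)
  show "(\<lambda>m. flux (Suc (Suc m)) (v s) (f m) (g m) + flux (Suc (Suc m)) (v s) (g m) (f m)) \<longlonglongrightarrow> 0"
  proof (rule tendsto_zero_criterion[of "18 * pi * E"])
    fix e :: real assume e: "e > 0"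
    then obtain d where d: "d > 0" "\<forall>x z j. norm z < d \<longrightarrow> \<bar>v s (x + z) $ j - v s x $ j\<bar> \<le> e * norm z powr (1/3)" using L unfolding small_holder_def by blast
    show "\<exists>C'. \<forall>m. \<bar>flux (Suc (Suc m)) (v s) (f m) (g m) + flux (Suc (Suc m)) (v s) (g m) (f m)\<bar> \<le> 18 * pi * E * e + C' / (2 * real (Suc m) + 4)"
      using est[OF d(1) less_imp_le[OF e] d(2)] by (intro exI[of _ "162 * pi * (C * E / d\<^sup>2)"]) (simp add: mult_ac)
  qed (use E0 in auto)
qed

text \<open>With f = g = v_i the product of increments is at most C^2 |z|^(2/3) pointwise, so the
  fluxes are bounded by a constant in time; the work term is bounded because \<theta> and v
  are.\<close>

lemma energy_balance:
  assumes t: "t \<in> {0..T}"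
  shows "avg (\<lambda>x. v t x \<bullet> v t x) = avg (\<lambda>x. vin x \<bullet> vin x) + 2 * integral {0..t} (\<lambda>s. avg (\<lambda>x. \<theta> s x * v s x $ 3))"
proof -
  define F where "F = (\<lambda>m s. (\<Sum>i\<in>UNIV. flux (Suc (Suc m)) (v s) (\<lambda>x. v s x $ i) (\<lambda>x. v s x $ i)) + avg (\<lambda>x. \<theta> s x * conv (ker (Suc (Suc m))) (\<lambda>y. v s y $ 3) x))"
  obtain M where M: "M > 0" "\<And>t x. t \<in> {0..T} \<Longrightarrow> \<bar>\<theta> t x\<bar> \<le> M" "\<And>t x. t \<in> {0..T} \<Longrightarrow> norm (v t x) \<le> M"
    using bounded_st by blast
  have E: "avg (\<lambda>x. \<bar>v s (x + z) $ i - v s x $ i\<bar> * \<bar>v s (x + z) $ i - v s x $ i\<bar>) \<le> C\<^sup>2 * norm z powr (2/3)"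
    if s: "s \<in> {0..T}" and C: "holder C (v s)" for s z i
  proof -
    note cv = cont_UNIV_compose[OF cper_cont[OF cper_v[OF s]]]
    have "avg (\<lambda>x. \<bar>v s (x + z) $ i - v s x $ i\<bar> * \<bar>v s (x + z) $ i - v s x $ i\<bar>) \<le> avg (\<lambda>x::real^3. (C * norm z powr (1/3)) * (C * norm z powr (1/3)))"
      using C[unfolded holder_def] C0 by (intro integral_le integrable_cube continuous_intros cv mult_mono) auto
    also have "\<dots> = C\<^sup>2 * (norm z powr (1/3) * norm z powr (1/3))" by (simp add: power2_eq_square)
    also have "norm z powr (1/3) * norm z powr (1/3) = norm z powr (2/3)" by (simp flip: powr_add)
    finally show ?thesis .
  qed
  have wk: "\<bar>avg (\<lambda>x. \<theta> s x * conv (ker m) (\<lambda>y. v s y $ 3) x)\<bar> \<le> M * M" if s: "s \<in> {0..T}" for s m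
  proof -
    have "norm (avg (\<lambda>x. \<theta> s x * conv (ker m) (\<lambda>y. v s y $ 3) x)) \<le> avg (\<lambda>x::real^3. M * M)"
    proof (rule integral_norm_bound_integral)
      show "(\<lambda>x. \<theta> s x * conv (ker m) (\<lambda>y. v s y $ 3) x) integrable_on cube"
        by (intro integrable_cube continuous_intros cper_cont cper_\<theta> s cper_conv_ker cper_vec_nth cper_v)
      show "(\<lambda>x::real^3. M * M) integrable_on cube" by (intro integrable_cube continuous_intros)
      have "norm (v s y $ 3) \<le> M" for y using M(3)[OF s, of y] component_le_norm_cart[of "v s y" 3] by simp
      then have "norm (conv (ker m) (\<lambda>y. v s y $ 3) x) \<le> M" for x
        by (intro norm_conv_ker_le cper_vec_nth cper_v s)
      then show "norm (\<theta> s x * conv (ker m) (\<lambda>y. v s y $ 3) x) \<le> M * M" for x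
        unfolding norm_mult using M(1) M(2)[OF s, of x] by (intro mult_mono) auto
    qed
    then show ?thesis by simp
  qed
  have aux: "\<bar>x\<bar> \<le> B" if "\<bar>x + x\<bar> \<le> B" for x B :: real using that by arith
  have spc: "AE s in lebesgue_on {0..T}. s \<in> {0..T}" by (intro AE_I2) auto
  have "(\<lambda>m. integral {0..t} (F m)) \<longlonglongrightarrow> integral {0..t} (\<lambda>s. avg (\<lambda>x. \<theta> s x * v s x $ 3))"
  proof (rule time_dominated[OF _ _ t, where w="\<lambda>_. 3 * (45 * pi * C * C\<^sup>2) + M * M"])
    show "continuous_on {0..T} (F m)" for m
      unfolding F_def by (intro continuous_intros cont_flux_v cont_work)
    show "continuous_on {0..T} (\<lambda>s. avg (\<lambda>x. \<theta> s x * v s x $ 3))"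
      by (intro cont_integral_cube continuous_intros cont_\<theta>' cont_v') auto
    have "AE s in lebesgue_on {0..T}. (\<lambda>m. F m s) \<longlonglongrightarrow> avg (\<lambda>x. \<theta> s x * v s x $ 3) \<and>
        (\<forall>m. \<bar>F m s\<bar> \<le> 3 * (45 * pi * C * C\<^sup>2) + M * M)"
      using v_holder spc
    proof eventually_elim
      case (elim s)
      then have s: "s \<in> {0..T}" and C: "holder C (v s)" and L: "small_holder (v s)" by auto
      let ?J = "\<lambda>i m. flux (Suc (Suc m)) (v s) (\<lambda>x. v s x $ i) (\<lambda>x. v s x $ i)"
      note fl = flux_estimate[OF s C L, of "\<lambda>m x. v s x $ i" "\<lambda>m x. v s x $ i" for i,
          OF cper_vec_nth[OF cper_v[OF s]] cper_vec_nth[OF cper_v[OF s]] zero_le_power2 E[OF s C]]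
      \<comment> \<open>The estimate concerns a flux plus its mirror image; for f = g this is twice
        the flux.\<close>
      have "(\<lambda>m. (?J i m + ?J i m) / 2) \<longlonglongrightarrow> 0 / 2" for i
        using fl(2)[of i] by (intro tendsto_divide) auto
      then have J: "?J i \<longlonglongrightarrow> 0" for i by simp
      have w: "(\<lambda>m. avg (\<lambda>x. \<theta> s x * conv (ker (Suc (Suc m))) (\<lambda>y. v s y $ 3) x)) \<longlonglongrightarrow> avg (\<lambda>x. \<theta> s x * v s x $ 3)"
        using tendsto_integral_conv[OF cper_\<theta>[OF s] cper_vec_nth[OF cper_v[OF s]], of 3]
        by (intro LIMSEQ_Suc)
      have "(\<lambda>m. F m s) \<longlonglongrightarrow> (\<Sum>i\<in>(UNIV::3 set). 0) + avg (\<lambda>x. \<theta> s x * v s x $ 3)"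
        unfolding F_def by (intro tendsto_add tendsto_sum J w)
      moreover have "\<bar>F m s\<bar> \<le> 3 * (45 * pi * C * C\<^sup>2) + M * M" for m
      proof -
        have "\<bar>\<Sum>i\<in>(UNIV::3 set). ?J i m\<bar> \<le> (\<Sum>i\<in>(UNIV::3 set). 45 * pi * C * C\<^sup>2)"
          by (intro order_trans[OF sum_abs] sum_mono aux[OF fl(1)])
        also have "\<dots> = 3 * (45 * pi * C * C\<^sup>2)" by simp
        finally show ?thesis unfolding F_def using wk[OF s, of "Suc (Suc m)"] by linarith
      qed
      ultimately show ?case by simp
    qed
    then show "AE s in lebesgue_on {0..T}. (\<lambda>m. F m s) \<longlonglongrightarrow> avg (\<lambda>x. \<theta> s x * v s x $ 3)"
      "AE s in lebesgue_on {0..T}. \<forall>m. \<bar>F m s\<bar> \<le> 3 * (45 * pi * C * C\<^sup>2) + M * M"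
      by (auto elim: eventually_mono)
  qed auto
  then have lim: "(\<lambda>m. avg (\<lambda>x. v 0 x \<bullet> mollify (Suc (Suc m)) (v 0) x) + 2 * integral {0..t} (F m)) \<longlonglongrightarrow>
    avg (\<lambda>x. v 0 x \<bullet> v 0 x) + 2 * integral {0..t} (\<lambda>s. avg (\<lambda>x. \<theta> s x * v s x $ 3))"
    using LIMSEQ_Suc[OF LIMSEQ_Suc[OF tendsto_integral_mollify[OF cper_v[of 0]]]] T by (intro tendsto_intros) auto
  have "avg (\<lambda>x. v t x \<bullet> mollify (Suc (Suc m)) (v t) x) = avg (\<lambda>x. v 0 x \<bullet> mollify (Suc (Suc m)) (v 0) x) + 2 * integral {0..t} (F m)" for m
    unfolding F_def by (rule v_energy_evolution[OF t])
  then have "(\<lambda>m. avg (\<lambda>x. v t x \<bullet> mollify (Suc (Suc m)) (v t) x)) \<longlonglongrightarrow>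
    avg (\<lambda>x. v 0 x \<bullet> v 0 x) + 2 * integral {0..t} (\<lambda>s. avg (\<lambda>x. \<theta> s x * v s x $ 3))"
    using lim by simp
  then show ?thesis
    using LIMSEQ_unique[OF _ LIMSEQ_Suc[OF LIMSEQ_Suc[OF tendsto_integral_mollify[OF cper_v[OF t]]]]] v_energy_0 by simp
qed

text \<open>The increment of the weight is at most n L times that of K * \<theta>, where L is a
  Lipschitz constant of y^(n-1) on [-M, M]. Then 2ab \<le> a^2 + b^2 separates the increments of
  \<theta> and K * \<theta>, whose mean squares are both controlled by the square of
  \<open>besov2\<close>. This square is integrable in time and supplies the dominating
  function.\<close>

lemma power_conserved:
  assumes t: "t \<in> {0..T}"
    and g2: "integrable (lebesgue_on {0..T}) (\<lambda>s. (enn2real (besov2 (\<theta> s)))\<^sup>2)"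
    and gfin: "AE s in lebesgue_on {0..T}. besov2 (\<theta> s) < \<infinity>"
  shows "avg (\<lambda>x. \<theta> t x ^ n) = avg (\<lambda>x. \<theta>in x ^ n)"
proof -
  obtain M where M: "M > 0" "\<And>t x. t \<in> {0..T} \<Longrightarrow> \<bar>\<theta> t x\<bar> \<le> M" "\<And>t x. t \<in> {0..T} \<Longrightarrow> norm (v t x) \<le> M"
    using bounded_st by blast
  have cM: "\<bar>conv (ker m) (\<theta> s) x\<bar> \<le> M" if "s \<in> {0..T}" for s m x
    using norm_conv_ker_le[OF cper_\<theta>[OF that], of M m x] M(2)[OF that] by simp
  obtain L where L: "L \<ge> 0" "\<And>a b. \<bar>a\<bar> \<le> M \<Longrightarrow> \<bar>b\<bar> \<le> M \<Longrightarrow> \<bar>a^(n-1) - b^(n-1)\<bar> \<le> L * \<bar>a - b\<bar>"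
    using power_lipschitz[of M "n-1"] M(1) by auto
  define K where "K = real n * L * holder_const\<^sup>2"
  have K0: "K \<ge> 0" using L by (simp add: K_def)
  define g where "g = (\<lambda>s. enn2real (besov2 (\<theta> s)))"
  define F where "F = (\<lambda>m s. flux (Suc (Suc m)) (v s) (\<theta> s) (power_weight n (Suc (Suc m)) s))"
  have E: "avg (\<lambda>x. \<bar>\<theta> s (x + z) - \<theta> s x\<bar> * \<bar>power_weight n m s (x + z) - power_weight n m s x\<bar>) \<le> (K * (g s)\<^sup>2) * norm z powr (2/3)"
    if s: "s \<in> {0..T}" and fin: "besov2 (\<theta> s) < \<infinity>" for s z m
  proof -
    let ?c = "conv (ker m) (\<theta> s)"
    note c = cont_UNIV_compose[OF cper_cont[OF cper_\<theta>[OF s]]] cont_UNIV_compose[OF cper_cont[OF cper_power_weight[OF s]]]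
      cont_UNIV_compose[OF cper_cont[OF cper_conv_ker[OF cper_\<theta>[OF s]]]]
    have g0: "g s \<ge> 0" by (simp add: g_def)
    have block: "avg (\<lambda>x. (norm (block k (\<theta> s) x))\<^sup>2) \<le> (g s * 2 powr (- (real k / 3)))\<^sup>2" for k
      unfolding g_def by (rule besov2_block[OF fin])
    have "\<bar>\<theta> s (x + z) - \<theta> s x\<bar> * \<bar>power_weight n m s (x + z) - power_weight n m s x\<bar> \<le> (real n * L / 2) * ((\<theta> s (x + z) - \<theta> s x)\<^sup>2 + (?c (x + z) - ?c x)\<^sup>2)" for x
    proof -
      have "\<bar>power_weight n m s (x + z) - power_weight n m s x\<bar> = real n * \<bar>?c (x + z)^(n-1) - ?c x^(n-1)\<bar>"
        by (simp add: power_weight_def abs_mult flip: right_diff_distrib)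
      also have "\<dots> \<le> real n * (L * \<bar>?c (x + z) - ?c x\<bar>)" by (intro mult_left_mono L cM s) auto
      finally have "\<bar>\<theta> s (x + z) - \<theta> s x\<bar> * \<bar>power_weight n m s (x + z) - power_weight n m s x\<bar> \<le> \<bar>\<theta> s (x + z) - \<theta> s x\<bar> * (real n * (L * \<bar>?c (x + z) - ?c x\<bar>))"
        by (intro mult_left_mono) auto
      also have "\<dots> = (real n * L / 2) * (2 * \<bar>\<theta> s (x + z) - \<theta> s x\<bar> * \<bar>?c (x + z) - ?c x\<bar>)" by simp
      also have "\<dots> \<le> (real n * L / 2) * (\<bar>\<theta> s (x + z) - \<theta> s x\<bar>\<^sup>2 + \<bar>?c (x + z) - ?c x\<bar>\<^sup>2)"
        using L by (intro mult_left_mono sum_squares_bound) auto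
      finally show ?thesis by simp
    qed
    then have "avg (\<lambda>x. \<bar>\<theta> s (x + z) - \<theta> s x\<bar> * \<bar>power_weight n m s (x + z) - power_weight n m s x\<bar>)
      \<le> avg (\<lambda>x. (real n * L / 2) * ((\<theta> s (x + z) - \<theta> s x)\<^sup>2 + (?c (x + z) - ?c x)\<^sup>2))"
      by (intro integral_le integrable_cube continuous_intros c)
    also have "\<dots> = (real n * L / 2) * (avg (\<lambda>x. (\<theta> s (x + z) - \<theta> s x)\<^sup>2) + avg (\<lambda>x. (?c (x + z) - ?c x)\<^sup>2))"
      by (subst integral_mult_right, subst integral_add) (auto intro!: integrable_cube continuous_intros c)
    also have "\<dots> \<le> (real n * L / 2) * ((holder_const * g s)\<^sup>2 * norm z powr (2/3) + (holder_const * g s)\<^sup>2 * norm z powr (2/3))"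
      using L by (intro mult_left_mono add_mono holder_L2 holder_L2_conv cper_\<theta> s g0 block) auto
    also have "\<dots> = (K * (g s)\<^sup>2) * norm z powr (2/3)" by (simp add: K_def power_mult_distrib mult_ac)
    finally show ?thesis .
  qed
  have spc: "AE s in lebesgue_on {0..T}. s \<in> {0..T}" by (intro AE_I2) auto
  \<comment> \<open>The mirror flux is zero; adding it produces the symmetrised expression that
    \<open>flux_estimate\<close> controls.\<close>
  have F0: "F m s = flux (Suc (Suc m)) (v s) (\<theta> s) (power_weight n (Suc (Suc m)) s) + flux (Suc (Suc m)) (v s) (power_weight n (Suc (Suc m)) s) (\<theta> s)" if "s \<in> {0..T}" for m s
    using flux_power_weight_\<theta>[OF that] by (simp add: F_def)
  have "(\<lambda>m. integral {0..t} (F m)) \<longlonglongrightarrow> integral {0..t} (\<lambda>s. 0)"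
  proof (rule time_dominated[OF _ _ t, where w="\<lambda>s. (45 * pi * C * K) * (g s)\<^sup>2"])
    show "continuous_on {0..T} (F m)" for m unfolding F_def by (rule cont_flux_\<theta>)
    show "integrable (lebesgue_on {0..T}) (\<lambda>s. (45 * pi * C * K) * (g s)\<^sup>2)"
      using g2 by (intro Bochner_Integration.integrable_mult_right) (simp add: g_def)
    have "AE s in lebesgue_on {0..T}. (\<lambda>m. F m s) \<longlonglongrightarrow> 0 \<and> (\<forall>m. \<bar>F m s\<bar> \<le> (45 * pi * C * K) * (g s)\<^sup>2)"
      using v_holder spc gfin
    proof eventually_elim
      case (elim s)
      then have s: "s \<in> {0..T}" and C: "holder C (v s)"
        and Ls: "small_holder (v s)" and fin: "besov2 (\<theta> s) < \<infinity>" by auto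
      have E0: "K * (g s)\<^sup>2 \<ge> 0" using K0 by simp
      have "(\<lambda>m. F m s) \<longlonglongrightarrow> 0"
        unfolding F0[OF s]
        using flux_estimate(2)[OF s C Ls, of "\<lambda>m. \<theta> s" "\<lambda>m. power_weight n (Suc (Suc m)) s", OF cper_\<theta>[OF s] cper_power_weight[OF s] E0 E[OF s fin]] .
      moreover have "\<bar>F m s\<bar> \<le> (45 * pi * C * K) * (g s)\<^sup>2" for m
        unfolding F0[OF s]
        using flux_estimate(1)[OF s C Ls, of "\<lambda>m. \<theta> s" "\<lambda>m. power_weight n (Suc (Suc m)) s", OF cper_\<theta>[OF s] cper_power_weight[OF s] E0 E[OF s fin], of m] by (simp add: mult.assoc)
      ultimately show ?case by blast
    qed
    then show "AE s in lebesgue_on {0..T}. (\<lambda>m. F m s) \<longlonglongrightarrow> 0" "AE s in lebesgue_on {0..T}. \<forall>m. \<bar>F m s\<bar> \<le> (45 * pi * C * K) * (g s)\<^sup>2"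
      by (auto elim: eventually_mono)
  qed auto
  then have Fl: "(\<lambda>m. integral {0..t} (F m)) \<longlonglongrightarrow> 0" by simp
  have cl: "(\<lambda>m. avg (\<lambda>x. conv (ker (Suc (Suc m))) (\<theta> s) x ^ n)) \<longlonglongrightarrow> avg (\<lambda>x. \<theta> s x ^ n)" if s: "s \<in> {0..T}" for s
  proof (rule dominated_convergence(2)[where h="\<lambda>x. M ^ n"])
    show "(\<lambda>x. conv (ker (Suc (Suc m))) (\<theta> s) x ^ n) integrable_on cube" for m
      by (intro integrable_cube continuous_intros cper_cont cper_conv_ker cper_\<theta> s)
    show "(\<lambda>x::real^3. M ^ n) integrable_on cube" by (intro integrable_cube continuous_intros)
    show "norm (conv (ker (Suc (Suc m))) (\<theta> s) x ^ n) \<le> M ^ n" for m x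
      unfolding norm_power using cM[OF s] by (intro power_mono) auto
    show "(\<lambda>m. conv (ker (Suc (Suc m))) (\<theta> s) x ^ n) \<longlonglongrightarrow> \<theta> s x ^ n" for x
      using LIMSEQ_Suc[OF LIMSEQ_Suc[OF conv_ker_tendsto[OF cper_\<theta>[OF s], of x]]] by (intro tendsto_intros)
  qed
  have "(\<lambda>m. avg (\<lambda>x. conv (ker (Suc (Suc m))) (\<theta> 0) x ^ n) + integral {0..t} (F m)) \<longlonglongrightarrow> avg (\<lambda>x. \<theta> 0 x ^ n) + 0"
    using T by (intro tendsto_add cl Fl) auto
  moreover have "avg (\<lambda>x. conv (ker (Suc (Suc m))) (\<theta> t) x ^ n) = avg (\<lambda>x. conv (ker (Suc (Suc m))) (\<theta> 0) x ^ n) + integral {0..t} (F m)" for m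
    unfolding F_def by (rule \<theta>_power_evolution[OF t])
  ultimately have "(\<lambda>m. avg (\<lambda>x. conv (ker (Suc (Suc m))) (\<theta> t) x ^ n)) \<longlonglongrightarrow> avg (\<lambda>x. \<theta> 0 x ^ n)" by simp
  then show ?thesis using LIMSEQ_unique[OF _ cl[OF t]] \<theta>_0 by simp
qed

end

end

section \<open>Conservation of Lp norms\<close>

text \<open>Both functions take values in one compact interval, where \<beta> is within e/2 of a
  polynomial, and equal moments make the integrals of the polynomial agree.\<close>

lemma moments_determine_integrals:
  fixes f g :: "real^3 \<Rightarrow> real"
  assumes f: "cper f" and g: "cper g" and eq: "\<And>n. avg (\<lambda>x. f x ^ n) = avg (\<lambda>x. g x ^ n)"
    and \<beta>: "continuous_on UNIV \<beta>"
  shows "avg (\<lambda>x. \<beta> (f x)) = (avg (\<lambda>x. \<beta> (g x)) :: real)"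
proof -
  obtain M1 where M1: "\<And>x. norm (f x) \<le> M1" using cper_bounded[OF f] by blast
  obtain M2 where M2: "\<And>x. norm (g x) \<le> M2" using cper_bounded[OF g] by blast
  define S where "S = cball (0::real) (max M1 M2)"
  have S: "f x \<in> S" "g x \<in> S" for x using M1[of x] M2[of x] by (auto simp: S_def)
  have cf: "continuous_on UNIV f" and cg: "continuous_on UNIV g" using f g by (auto simp: cper_def)
  have "\<bar>avg (\<lambda>x. \<beta> (f x)) - avg (\<lambda>x. \<beta> (g x))\<bar> \<le> e" if e: "e > 0" for e
  proof -
    obtain p where p: "real_polynomial_function p" "\<And>x. x \<in> S \<Longrightarrow> \<bar>\<beta> x - p x\<bar> < e/2"
      using Stone_Weierstrass_real_polynomial_function[of S \<beta> "e/2"] e continuous_on_subset[OF \<beta>]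
      by (metis S_def compact_cball half_gt_zero subset_UNIV)
    obtain a N where a: "p = (\<lambda>x. \<Sum>i\<le>N. a i * x ^ i)"
      using p(1) unfolding real_polynomial_function_iff_sum by auto
    have pe: "avg (\<lambda>x. p (u x)) = (\<Sum>i\<le>N. a i * avg (\<lambda>x. u x ^ i))" if "continuous_on UNIV u" for u
      unfolding a by (subst integral_sum) (auto intro!: integrable_cube continuous_intros that)
    have cp: "continuous_on UNIV (\<lambda>x. p (u x))" if "continuous_on UNIV u" for u :: "real^3 \<Rightarrow> real"
      unfolding a by (intro continuous_intros that)
    have b: "\<bar>avg (\<lambda>x. \<beta> (u x)) - avg (\<lambda>x. p (u x))\<bar> \<le> e/2" if u: "continuous_on UNIV u" "\<And>x. u x \<in> S" for u
    proof -
      have c\<beta>: "continuous_on UNIV (\<lambda>x. \<beta> (u x))" by (rule cont_UNIV_compose[OF \<beta> u(1)])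
      have "avg (\<lambda>x. \<beta> (u x)) - avg (\<lambda>x. p (u x)) = avg (\<lambda>x. \<beta> (u x) - p (u x))"
        by (intro integral_diff[symmetric] integrable_cube c\<beta> cp u)
      also have "norm \<dots> \<le> avg (\<lambda>x::real^3. e/2)"
        using p(2)[OF u(2)] by (intro integral_norm_bound_integral integrable_cube continuous_on_diff c\<beta> cp u continuous_on_const) (auto intro: less_imp_le)
      finally show ?thesis by simp
    qed
    have "avg (\<lambda>x. p (f x)) = avg (\<lambda>x. p (g x))"
      by (simp add: pe cf cg eq)
    then show ?thesis using b[OF cf S(1)] b[OF cg S(2)] by linarith
  qed
  then have "\<bar>avg (\<lambda>x. \<beta> (f x)) - avg (\<lambda>x. \<beta> (g x))\<bar> \<le> 0"
    by (rule dense_ge)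
  then show ?thesis by simp
qed

text \<open>The test function is the excess of |y| over the sup norm of g. Its mean is zero for g,
  hence for f, and a nonnegative continuous function with mean zero vanishes.\<close>

lemma Lp_inf_le_of_moments:
  fixes f g :: "real^3 \<Rightarrow> real"
  assumes f: "cper f" and g: "cper g" and eq: "\<And>n. avg (\<lambda>x. f x ^ n) = avg (\<lambda>x. g x ^ n)"
  shows "Lp_norm \<infinity> f \<le> Lp_norm \<infinity> g"
proof -
  define N where "N = Lp_norm \<infinity> g"
  define \<beta> where "\<beta> = (\<lambda>y::real. max (\<bar>y\<bar> - N) 0)"
  have \<beta>: "continuous_on UNIV \<beta>" unfolding \<beta>_def by (intro continuous_intros)
  have c: "continuous_on S (\<lambda>x. \<beta> (f x))" for S
    by (rule continuous_on_subset[OF cont_UNIV_compose[OF \<beta> cper_cont[OF f]]]) simp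
  have "avg (\<lambda>x. \<beta> (f x)) = avg (\<lambda>x. \<beta> (g x))"
    by (rule moments_determine_integrals[OF f g eq \<beta>])
  also have "(\<lambda>x. \<beta> (g x)) = (\<lambda>x. 0)"
    using norm_le_Lp_inf[OF g] by (auto simp: \<beta>_def N_def max_def)
  finally have i0: "((\<lambda>x. \<beta> (f x)) has_integral 0) (cbox 0 One)"
    using integrable_integral[OF integrable_cube[OF c]] by (simp add: cube_def)
  have "\<beta> (f x) = 0" if "x \<in> cbox 0 One" for x
    by (rule has_integral_0_cbox_imp_0[OF c _ i0 _ that]) (auto simp: \<beta>_def box_ne_empty)
  then have "norm (f x) \<le> N" if "x \<in> cube" for x
    using that by (fastforce simp: cube_def \<beta>_def max_def split: if_splits)
  then show ?thesis
    using cube_nonempty by (auto simp: Lp_norm_def[of _ f] N_def[symmetric] intro!: cSup_least)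
qed

lemma Lp_norm_eq_of_moments:
  fixes f g :: "real^3 \<Rightarrow> real"
  assumes f: "cper f" and g: "cper g" and eq: "\<And>n. avg (\<lambda>x. f x ^ n) = avg (\<lambda>x. g x ^ n)" and p: "1 \<le> p"
  shows "Lp_norm p f = Lp_norm p g"
proof (cases "p = \<infinity>")
  case True
  then show ?thesis using Lp_inf_le_of_moments[OF f g eq] Lp_inf_le_of_moments[OF g f eq[symmetric]] by simp
next
  case False
  define r where "r = real_of_ereal p"
  have r: "r > 0" using p False by (cases p) (auto simp: r_def)
  have "continuous_on UNIV (\<lambda>y::real. \<bar>y\<bar> powr r)"
    by (rule continuous_on_powr') (use r in \<open>auto intro!: continuous_intros\<close>)
  from moments_determine_integrals[OF f g eq this] show ?thesis
    using False by (simp add: Lp_norm_def r_def)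
qed

lemma Lp_norm_2_square:
  fixes V :: "real^3 \<Rightarrow> real^3"
  assumes "cper V" shows "(Lp_norm 2 V)\<^sup>2 = avg (\<lambda>x. V x \<bullet> V x)"
proof -
  have e: "norm (V x) powr 2 = V x \<bullet> V x" for x by (simp add: powr_numeral power2_norm_eq_inner)
  have "0 \<le> avg (\<lambda>x. V x \<bullet> V x)"
    by (intro integral_nonneg integrable_cube continuous_intros cper_cont assms) auto
  then show ?thesis by (simp add: Lp_norm_def e powr_half_sqrt)
qed

theorem theorem1p2:
  fixes T :: real and p :: ereal
    and vin :: "real^3 \<Rightarrow> real^3" and \<theta>in :: "real^3 \<Rightarrow> real"
    and v :: "real \<Rightarrow> real^3 \<Rightarrow> real^3" and \<theta> :: "real \<Rightarrow> real^3 \<Rightarrow> real"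
    and \<kappa> \<phi> :: "real^3 \<Rightarrow> real"
  assumes T: "0 < T"
    and ws: "weak_solution T vin \<theta>in v \<theta>"
    and LP: "LP_pair \<kappa> \<phi>"
    and p: "1 \<le> p"
    and v_reg: "AE t in lebesgue_on {0..T}. besov_c_vec \<kappa> \<phi> (1/3) \<infinity> (v t)"
    and v_bd: "time_Lq \<infinity> T (\<lambda>t. besov_norm_vec \<kappa> \<phi> (1/3) \<infinity> (v t))"
    and \<theta>_cont: "\<forall>t\<in>{0..T}. ((\<lambda>s. Lp_norm p (\<lambda>x. \<theta> s x - \<theta> t x)) \<longlongrightarrow> 0) (at t within {0..T})"
    and \<theta>_small: "p < 2 \<Longrightarrow>
        (AE t in lebesgue_on {0..T}. besov_c \<kappa> \<phi> (1/3) (conj_exp p) (\<theta> t)) \<and>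
        time_Lq 2 T (\<lambda>t. besov_norm \<kappa> \<phi> (1/3) (conj_exp p) (\<theta> t))"
    and \<theta>_large: "2 \<le> p \<Longrightarrow>
        (AE t in lebesgue_on {0..T}. besov_c \<kappa> \<phi> (1/3) p (\<theta> t)) \<and>
        time_Lq p T (\<lambda>t. besov_norm \<kappa> \<phi> (1/3) p (\<theta> t))"
  shows "\<forall>t\<in>{0..T}.
           (Lp_norm 2 (v t))^2 = (Lp_norm 2 vin)^2
              + 2 * integral {0..t} (\<lambda>s. integral cube (\<lambda>x. \<theta> s x * v s x $ 3))
         \<and> Lp_norm p (\<theta> t) = Lp_norm p \<theta>in"
proof -
  interpret boussinesq_lp T vin \<theta>in v \<theta> \<kappa> \<phi>
    by unfold_locales (use T ws LP in auto)
  obtain C0 where C0: "AE t in lebesgue_on {0..T}. besov_norm_vec \<kappa> \<phi> (1/3) \<infinity> (v t) \<le> ennreal C0"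
    using v_bd unfolding time_Lq_def by auto
  \<comment> \<open>The 2 is the index-shift loss of \<open>besov_block\<close>; the maximum with 0
    makes the bound nonnegative whatever the sign of \<open>C0\<close>.\<close>
  define C where "C = holder_const * (2 * max C0 0)"
  have C: "C \<ge> 0" using holder_const by (simp add: C_def)
  have spc: "AE s in lebesgue_on {0..T}. s \<in> {0..T}" by (intro AE_I2) auto
  have vh: "AE s in lebesgue_on {0..T}. holder C (v s) \<and> small_holder (v s)"
    using C0 v_reg spc
  proof eventually_elim
    case (elim s)
    have cv: "cper (\<lambda>x. v s x $ j)" for j by (rule cper_vec_nth[OF cper_v[OF elim(3)]])
    have "besov_norm \<kappa> \<phi> (1/3) \<infinity> (\<lambda>x. v s x $ j) \<le> ennreal (max C0 0)" for j
    proof -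
      have "besov_norm \<kappa> \<phi> (1/3) \<infinity> (\<lambda>x. v s x $ j) \<le> besov_norm_vec \<kappa> \<phi> (1/3) \<infinity> (v s)"
        unfolding besov_norm_vec_def by (rule member_le_sum) auto
      also have "\<dots> \<le> ennreal C0" by (rule elim(1))
      also have "\<dots> \<le> ennreal (max C0 0)" by (rule ennreal_leI) simp
      finally show ?thesis .
    qed
    then have "\<bar>v s (x + z) $ j - v s x $ j\<bar> \<le> C * norm z powr (1/3)" for x z j
      unfolding C_def by (intro besov_holder[OF cv]) auto
    moreover have "\<exists>d>0. \<forall>x z j. norm z < d \<longrightarrow> \<bar>v s (x + z) $ j - v s x $ j\<bar> \<le> e * norm z powr (1/3)" if e: "e > 0" for e
    proof -
      have "\<exists>d>0. \<forall>x z. norm z < d \<longrightarrow> \<bar>v s (x + z) $ j - v s x $ j\<bar> \<le> e * norm z powr (1/3)" for j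
      proof -
        have "besov_c \<kappa> \<phi> (1/3) \<infinity> (\<lambda>x. v s x $ j)" using elim(2) unfolding besov_c_vec_def by blast
        from besov_c_holder[OF cv this e] show ?thesis by metis
      qed
      then obtain d where d: "\<And>j. d j > 0" "\<And>j x z. norm z < d j \<Longrightarrow> \<bar>v s (x + z) $ j - v s x $ j\<bar> \<le> e * norm z powr (1/3)" by metis
      \<comment> \<open>One radius that serves all three components.\<close>
      have "Min (range d) > 0" using d(1) by (subst Min_gr_iff) auto
      moreover have "norm z < d j" if "norm z < Min (range d)" for z :: "real^3" and j
        using that by (simp add: Min_gr_iff)
      ultimately show ?thesis using d(2) by (intro exI[of _ "Min (range d)"]) blast
    qed
    ultimately show ?case unfolding holder_def small_holder_def by blast
  qed
  \<comment> \<open>Both ranges of p fit one pattern: (q, r) is (p', 2) for p < 2, where the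
    conjugate exponent p' is at least 2, and (p, p) otherwise.\<close>
  have "\<exists>q r. 2 \<le> q \<and> 2 \<le> r \<and> (AE t in lebesgue_on {0..T}. besov_c \<kappa> \<phi> (1/3) q (\<theta> t)) \<and> time_Lq r T (\<lambda>t. besov_norm \<kappa> \<phi> (1/3) q (\<theta> t))"
  proof (cases "p < 2")
    case True
    have "2 \<le> conj_exp p"
    proof (cases "p = 1")
      case False
      then obtain r where r: "p = ereal r" "1 < r" "r < 2" using p True by (cases p) auto
      have "2 \<le> r / (r - 1)" using r by (simp add: pos_le_divide_eq)
      then show ?thesis using r False by (simp add: conj_exp_def)
    qed (simp add: conj_exp_def)
    then show ?thesis using \<theta>_small[OF True] by blast
  next
    case False
    then have "2 \<le> p" by simp
    then show ?thesis using \<theta>_large by blast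
  qed
  then obtain q r where qr: "2 \<le> q" "2 \<le> r" "AE t in lebesgue_on {0..T}. besov_c \<kappa> \<phi> (1/3) q (\<theta> t)"
    "time_Lq r T (\<lambda>t. besov_norm \<kappa> \<phi> (1/3) q (\<theta> t))" by blast
  have ae: "AE t in lebesgue_on {0..T}. besov_norm \<kappa> \<phi> (1/3) q (\<theta> t) < \<infinity>"
    using qr(3) by eventually_elim (simp add: besov_c_def)
  note besov2 = besov2_square_integrable[OF qr(1,2) ae qr(4)]
  show ?thesis
  proof (intro ballI conjI)
    fix t assume t: "t \<in> {0..T}"
    show "(Lp_norm 2 (v t))^2 = (Lp_norm 2 vin)^2 + 2 * integral {0..t} (\<lambda>s. avg (\<lambda>x. \<theta> s x * v s x $ 3))"
      using energy_balance[OF C vh t] unfolding Lp_norm_2_square[OF cper_v[OF t]] Lp_norm_2_square[OF cper_vin] .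
    show "Lp_norm p (\<theta> t) = Lp_norm p \<theta>in"
      by (intro Lp_norm_eq_of_moments cper_\<theta> t cper_\<theta>in power_conserved[OF C vh t besov2] p)
  qed
qed

end
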